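(* Let $f:S^2\to S^2$ be a quotient of a torus endomorphism. Then there exist a branched covering map $\widehat\pi:T^2\to S^2$ and a torus endomorphism $\widehat F:T^2\to T^2$ of degree $\deg(\widehat F)\ge 2$ such that $\widehat\pi\circ\widehat F=f\circ\widehat\pi$ and $\widehat F$ is $\widehat\pi$-injective.
   Context: $S^2$ is the (oriented) 2-sphere and $T^2$ the (oriented) 2-torus. A branched covering map between compact connected oriented surfaces is a continuous surjective map which near every point $x$ has, in suitable orientation-preserving local coordinates centered at $x$ and its image, the form $z\mapsto z^{d}$ with $d=\deg(f,x)\ge 1$ (the local degree); $\deg(f)$ denotes the topological degree. A torus endomorphism is an (orientation-preserving) local homeomorphism $F:T^2\to T^2$, i.e. a covering map of the torus to itself. For a branched covering map $f:S^2\to S^2$, $S_f=\{x:\deg(f,x)\ge 2\}$ is the set of critical points and $P_f=\bigcup_{k\ge 1} f^k(S_f)$ is the set of postcritical points. A quotient of a torus endomorphism is a map $f:S^2\to S^2$ such that there exist a torus endomorphism $F:T^2\to T^2$ with $\deg(F)\ge 2$ and a branched covering map $\pi:T^2\to S^2$ with $\pi\circ F=f\circ\pi$. It is known that every such $f$ is an orientation-preserving branched covering map with $P_f$ finite, and that $\pi(S_\pi)=P_f$, where $S_\pi$ is the set of critical points of $\pi$. Put $Y=S^2\setminus f^{-1}(P_f)$. For a torus endomorphism $F$ of degree at least $2$ and a branched covering map $\pi:T^2\to S^2$ with $\pi\circ F=f\circ\pi$, $F$ is called $\pi$-injective if $F$ is injective when restricted to each set $\pi^{-1}(y)$ with $y\in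 Y$. *)

theory Defs
  imports "HOL-Complex_Analysis.Complex_Analysis"
begin

text \<open>Local degree at \<open>z\<close> of a planar map: winding number of the images of all sufficiently small,
  positively oriented circles about \<open>z\<close>. Meaningful when \<open>h\<close> is continuous near \<open>z\<close> and \<open>z\<close> is isolated
  in its fibre.\<close>

definition has_planar_index :: "(complex \<Rightarrow> complex) \<Rightarrow> complex \<Rightarrow> int \<Rightarrow> bool" where
  "has_planar_index h z n \<longleftrightarrow>
     (\<forall>\<^sub>F r in at_right 0. winding_number (h \<circ> circlepath z r) (h z) = of_int n)"

text \<open>A surface is given by its set of points (with the subspace topology) together with local
  homeomorphisms from the complex plane that jointly cover it and differ by orientation-preserving
  transition maps. These parametrizations fix the orientation.\<close>

record 'a oriented_surface =
  points :: "'a set"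
  params :: "(complex \<Rightarrow> 'a) set"

text \<open>\<open>sphere_param_south\<close> is the inverse of stereographic projection from the north pole, and
  \<open>sphere_param_north z = sphere_param_south (1 / z)\<close> for \<open>z \<noteq> 0\<close>; the transition map \<open>1 / z\<close> is
  holomorphic, hence orientation-preserving.\<close>

definition sphere_param_south :: "complex \<Rightarrow> real ^ 3" where
  "sphere_param_south z = (1 / (1 + (norm z)\<^sup>2)) *\<^sub>R vector [2 * Re z, 2 * Im z, (norm z)\<^sup>2 - 1]"

definition sphere_param_north :: "complex \<Rightarrow> real ^ 3" where
  "sphere_param_north z = (1 / (1 + (norm z)\<^sup>2)) *\<^sub>R vector [2 * Re z, - 2 * Im z, 1 - (norm z)\<^sup>2]"

definition S2 :: "(real ^ 3) oriented_surface" where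
  "S2 = \<lparr>points = sphere 0 1, params = {sphere_param_south, sphere_param_north}\<rparr>"

definition torus_param :: "complex \<Rightarrow> complex \<times> complex" where
  "torus_param z = (cis (2 * pi * Re z), cis (2 * pi * Im z))"

definition T2 :: "(complex \<times> complex) oriented_surface" where
  "T2 = \<lparr>points = sphere 0 1 \<times> sphere 0 1, params = {torus_param}\<rparr>"

definition oriented_coordinate ::
  "('a::topological_space) oriented_surface \<Rightarrow> 'a \<Rightarrow> 'a set \<Rightarrow> ('a \<Rightarrow> complex) \<Rightarrow> bool" where
  "oriented_coordinate M x U \<phi> \<longleftrightarrow>
     openin (top_of_set (points M)) U \<and> x \<in> U \<and> \<phi> x = 0 \<and>
     open (\<phi> ` U) \<and> (\<exists>g. homeomorphism U (\<phi> ` U) \<phi> g) \<and>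
     (\<forall>p\<in>params M. \<forall>z. p z \<in> U \<longrightarrow> has_planar_index (\<phi> \<circ> p) z 1)"

definition has_power_form ::
  "('a::topological_space) oriented_surface \<Rightarrow> ('b::topological_space) oriented_surface \<Rightarrow>
   ('a \<Rightarrow> 'b) \<Rightarrow> 'a \<Rightarrow> nat \<Rightarrow> bool" where
  "has_power_form M N f x d \<longleftrightarrow>
     (\<exists>U \<phi> V \<psi>. oriented_coordinate M x U \<phi> \<and> oriented_coordinate N (f x) V \<psi> \<and>
        f ` U \<subseteq> V \<and> (\<forall>u\<in>U. \<psi> (f u) = \<phi> u ^ d))"

definition branched_covering ::
  "('a::topological_space) oriented_surface \<Rightarrow> ('b::topological_space) oriented_surface \<Rightarrow>
   ('a \<Rightarrow> 'b) \<Rightarrow> bool" where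
  "branched_covering M N f \<longleftrightarrow>
     continuous_on (points M) f \<and> f ` points M = points N \<and>
     (\<forall>x\<in>points M. \<exists>d\<ge>1. has_power_form M N f x d)"

definition local_degree ::
  "('a::topological_space) oriented_surface \<Rightarrow> ('b::topological_space) oriented_surface \<Rightarrow>
   ('a \<Rightarrow> 'b) \<Rightarrow> 'a \<Rightarrow> nat" where
  "local_degree M N f x = (THE d. d \<ge> 1 \<and> has_power_form M N f x d)"

text \<open>Local index of a map between oriented surfaces at a point that is isolated in its fibre; no
  branched covering structure is assumed.\<close>

definition has_local_index ::
  "('a::topological_space) oriented_surface \<Rightarrow> ('b::topological_space) oriented_surface \<Rightarrow>
   ('a \<Rightarrow> 'b) \<Rightarrow> 'a \<Rightarrow> int \<Rightarrow> bool" where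
  "has_local_index M N f x n \<longleftrightarrow>
     (\<exists>U \<phi> V \<psi>. oriented_coordinate M x U \<phi> \<and> oriented_coordinate N (f x) V \<psi> \<and>
        f ` U \<subseteq> V \<and> (\<forall>u\<in>U. f u = f x \<longrightarrow> u = x) \<and>
        has_planar_index (\<psi> \<circ> f \<circ> inv_into U \<phi>) 0 n)"

definition local_index ::
  "('a::topological_space) oriented_surface \<Rightarrow> ('b::topological_space) oriented_surface \<Rightarrow>
   ('a \<Rightarrow> 'b) \<Rightarrow> 'a \<Rightarrow> int" where
  "local_index M N f x = (THE n. has_local_index M N f x n)"

text \<open>Brouwer's degree of a continuous map between compact connected oriented surfaces: the sum of
  the local indices over any finite fibre. It is independent of the chosen fibre; finite-to-one maps
  (in particular branched coverings and local homeomorphisms) have only finite fibres.\<close>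

definition topological_degree ::
  "('a::topological_space) oriented_surface \<Rightarrow> ('b::topological_space) oriented_surface \<Rightarrow>
   ('a \<Rightarrow> 'b) \<Rightarrow> int" where
  "topological_degree M N f =
     (THE d. \<forall>y\<in>points N. finite {x \<in> points M. f x = y} \<longrightarrow>
        (\<Sum>x | x \<in> points M \<and> f x = y. local_index M N f x) = d)"

definition torus_endomorphism :: "(complex \<times> complex \<Rightarrow> complex \<times> complex) \<Rightarrow> bool" where
  "torus_endomorphism F \<longleftrightarrow>
     F ` points T2 \<subseteq> points T2 \<and>
     (\<forall>x\<in>points T2. \<exists>U. openin (top_of_set (points T2)) U \<and> x \<in> U \<and>
        openin (top_of_set (points T2)) (F ` U) \<and> (\<exists>g. homeomorphism U (F ` U) F g)) \<and>
     (\<forall>x\<in>points T2. has_local_index T2 T2 F x 1)"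

definition quotient_of_torus_endomorphism :: "(real ^ 3 \<Rightarrow> real ^ 3) \<Rightarrow> bool" where
  "quotient_of_torus_endomorphism f \<longleftrightarrow>
     f ` points S2 \<subseteq> points S2 \<and>
     (\<exists>F \<pi>. torus_endomorphism F \<and> topological_degree T2 T2 F \<ge> 2 \<and>
        branched_covering T2 S2 \<pi> \<and> (\<forall>x\<in>points T2. \<pi> (F x) = f (\<pi> x)))"

definition critical_points :: "(real ^ 3 \<Rightarrow> real ^ 3) \<Rightarrow> (real ^ 3) set" where
  "critical_points f = {x \<in> points S2. local_degree S2 S2 f x \<ge> 2}"

definition postcritical_points :: "(real ^ 3 \<Rightarrow> real ^ 3) \<Rightarrow> (real ^ 3) set" where
  "postcritical_points f = (\<Union>k\<in>{1..}. (f ^^ k) ` critical_points f)"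

definition pi_injective ::
  "(real ^ 3 \<Rightarrow> real ^ 3) \<Rightarrow> (complex \<times> complex \<Rightarrow> real ^ 3) \<Rightarrow>
   (complex \<times> complex \<Rightarrow> complex \<times> complex) \<Rightarrow> bool" where
  "pi_injective f \<pi> F \<longleftrightarrow>
     (\<forall>y \<in> points S2 - {x \<in> points S2. f x \<in> postcritical_points f}.
        inj_on F {x \<in> points T2. \<pi> x = y})"

end

theory Submission imports Defs begin

text \<open>Write \<open>p\<close> for the universal covering \<open>torus_param\<close> of the torus, whose deck group is the lattice of
Gaussian integers. A torus endomorphism \<open>F\<close> lifts to an orientation preserving homeomorphism
\<open>E\<close> of the plane with \<open>E (u + v) = E u + L v\<close> for lattice vectors \<open>v\<close>, where \<open>L\<close> is an injective
endomorphism of the lattice (\<open>torus_endomorphism_lift\<close>, \<open>lift_add_lat\<close>). Conversely a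
self-map of the torus with such a lift is a torus endomorphism (\<open>torus_endomorphism_of_lift\<close>), and its
degree is at least 2 as soon as \<open>L\<close> misses a lattice vector (\<open>topological_degree_ge_2\<close>).

Fix a point \<open>y0\<close> of the sphere. The theorem follows by descent on the number of points in the fibre
of \<open>\<pi>\<close> over \<open>y0\<close>: if \<open>F\<close> is not \<open>\<pi>\<close>-injective, then \<open>\<pi>\<close> factors through a covering of tori with at
least two sheets, compatibly with the dynamics, so that the fibre gets smaller
(\<open>torus_quotient_reduce\<close>).

To find the factorization, suppose that \<open>F (p z) = F (p z')\<close> and \<open>\<pi> (p z) = \<pi> (p z') = y\<close> for distinct
points \<open>p z\<close> and \<open>p z'\<close>, where \<open>f y\<close> is not postcritical. Then \<open>w = E z - E z'\<close> is a lattice vector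
outside the image of \<open>L\<close>. The function \<open>\<Theta> = \<pi> \<circ> p \<circ> E\<inverse>\<close> satisfies \<open>f \<circ> \<Theta> = \<pi> \<circ> p\<close>, which is
\<open>w\<close>-periodic, and \<open>\<Theta>\<close> takes the same value \<open>y\<close> at \<open>E z\<close> and at \<open>E z - w\<close>. Since \<open>y\<close> is not critical,
\<open>f\<close> is injective near \<open>y\<close>, so \<open>\<Theta>\<close> and its translate agree near \<open>E z\<close>. This agreement spreads: at every
point where \<open>\<pi> \<circ> p\<close> is locally injective, \<open>f\<close> is locally injective at the value of \<open>\<Theta>\<close>, and the
remaining points are isolated, so that their complement is connected and dense. Hence \<open>\<Theta>\<close> itself is
\<open>w\<close>-periodic (\<open>semiconjugate_period\<close>). The lattice vectors that are periods of \<open>\<Theta>\<close> form a group \<open>H\<close>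
which contains \<open>w\<close> and the image of \<open>L\<close>; hence it has rank two, and \<open>H = M (lattice)\<close> for a linear map
\<open>M\<close> of positive determinant. The new maps are induced by \<open>\<Theta> \<circ> M\<close> and \<open>M\<inverse> \<circ> E \<circ> M\<close>, and \<open>\<pi>\<close> is the
composition of the new \<open>\<pi>\<close> with the covering induced by \<open>M\<inverse> \<circ> E\<close>, which identifies \<open>p u\<close> with
\<open>p (E\<inverse> (E u + w))\<close>.

The step from \<open>f y\<close> not being postcritical to the local injectivity of \<open>f\<close> at \<open>y\<close> requires that \<open>f\<close>
has the form of a power in suitable oriented coordinates at every point
(\<open>power_form_of_quotient\<close>). In the coordinates that turn \<open>\<pi>\<close> into \<open>\<zeta>\<^sup>a\<close> at a preimage \<open>x\<close> of \<open>y\<close> and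
into \<open>\<zeta>\<^sup>b\<close> at \<open>F x\<close>, the map \<open>F\<close> becomes an injective map \<open>k\<close> which carries the rotations by \<open>a\<close>-th roots
of unity to rotations. Therefore \<open>a\<close> divides \<open>b\<close>, and \<open>k (\<zeta>)\<^sup>a\<close> is a homeomorphic function of
\<open>\<zeta>\<^sup>a\<close>; this function supplies the new coordinate at \<open>y\<close>. Orientations are tracked throughout by
planar indices, which multiply under composition (\<open>has_planar_index_comp\<close>).\<close>

section \<open>Planar indices\<close>

lemma circlepath_eq: "circlepath z r t = z + of_real r * exp (2 * of_real pi * \<i> * of_real t)"
  by (simp add: circlepath)

text \<open>A path with a given logarithm can be deformed to the exponential of a segment, whose winding number
is a trivial contour integral. Winding numbers of images of loops are computed below by following
logarithms.\<close>

lemma winding_number_of_log: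
  assumes q: "path q" and n: "pathfinish q - pathstart q = 2 * of_real pi * \<i> * of_int n"
    and g: "\<And>t. t \<in> {0..1} \<Longrightarrow> g t = c + exp (q t)"
  shows "winding_number g c = of_int n"
proof -
  let ?l = "linepath (pathstart q) (pathfinish q)"
  let ?e = "\<lambda>w. c + exp w"
  have "homotopic_paths UNIV q ?l"
    by (rule homotopic_paths_linear) (use q in auto)
  hence h: "homotopic_paths (-{c}) (?e \<circ> q) (?e \<circ> ?l)"
    by (rule homotopic_paths_continuous_image) (auto intro!: continuous_intros)
  have "winding_number g c = winding_number (?e \<circ> q) c"
    by (rule winding_number_cong) (use g in auto)
  also have "\<dots> = winding_number (?e \<circ> ?l) c"
    by (rule winding_number_homotopic_paths[OF h])
  also have "\<dots> = of_int n"
  proof -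
    have vp: "valid_path (?e \<circ> ?l)"
      by (rule valid_path_compose_holomorphic[where S=UNIV]) (auto intro!: holomorphic_intros)
    have nz: "c \<notin> path_image (?e \<circ> ?l)" by (auto simp: path_image_def)
    let ?d = "pathfinish q - pathstart q"
    have vd: "vector_derivative (?e \<circ> ?l) (at t) = exp (?l t) * ?d" for t
    proof (rule vector_derivative_at)
      have 1: "(?l has_vector_derivative ?d) (at t)"
        by (rule has_vector_derivative_linepath_within)
      have 2: "(?e has_field_derivative exp (?l t)) (at (?l t))"
        by (auto intro!: derivative_eq_intros)
      show "(?e \<circ> ?l has_vector_derivative exp (?l t) * ?d) (at t)"
        using field_vector_diff_chain_at[OF 1 2] by (simp add: mult.commute)
    qed
    have "contour_integral (?e \<circ> ?l) (\<lambda>w. 1 / (w - c)) = ?d"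
      unfolding contour_integral_integral vd by simp
    thus ?thesis unfolding winding_number_valid_path[OF vp nz] n by simp
  qed
  finally show ?thesis .
qed

lemma log_of_loop:
  assumes "path p" "\<zeta> \<notin> path_image p" "pathfinish p = pathstart p"
  obtains q and n :: int where "path q"
    "pathfinish q - pathstart q = 2 * of_real pi * \<i> * of_int n"
    "winding_number p \<zeta> = of_int n"
    "\<And>t. t \<in> {0..1} \<Longrightarrow> p t = \<zeta> + exp (q t)"
  by (metis Ints_cases assms integer_winding_number winding_number_as_continuous_log)

text \<open>The half-plane below \<open>ln e\<close> is the universal covering of the punctured disc, by \<open>s \<mapsto> z + exp s\<close>. It is
convex, so the nonvanishing function \<open>h (z + exp s) - h z\<close> has a logarithm \<open>G\<close> there. The deck
transformation \<open>s \<mapsto> s + 2 \<pi> \<i>\<close> changes \<open>G\<close> by an integer multiple of \<open>2 \<pi> \<i>\<close>, constant by continuity;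
this integer \<open>n\<close> is the index of \<open>h\<close> at \<open>z\<close>.\<close>

lemma punctured_disc_log:
  assumes h: "continuous_on (ball z e) h" and e: "e > 0"
    and nz: "\<And>w. w \<in> ball z e \<Longrightarrow> w \<noteq> z \<Longrightarrow> h w \<noteq> h z"
  obtains G and n :: int where
    "continuous_on {s. Re s < ln e} G"
    "\<And>s. Re s < ln e \<Longrightarrow> h (z + exp s) = h z + exp (G s)"
    "\<And>s m. Re s < ln e \<Longrightarrow> G (s + 2 * of_real pi * \<i> * of_int m) = G s + 2 * of_real pi * \<i> * of_int (m * n)"
proof -
  let ?H = "{s. Re s < ln e}"
  have ex: "z + exp s \<in> ball z e" "z + exp s \<noteq> z" if "s \<in> ?H" for s
    using that e by (auto simp: dist_norm ln_ge_iff exp_less_cancel_iff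
        intro: less_le_trans[OF iffD2[OF exp_less_cancel_iff] eq_refl])
  \<comment> \<open>Convex sets are contractible, so nonvanishing functions on them have logarithms.\<close>
  have conv: "convex ?H" using convex_halfspace_Re_lt by simp
  have c: "continuous_on ?H (\<lambda>s. h (z + exp s) - h z)"
    by (intro continuous_intros continuous_on_compose2[OF h]) (use ex in auto)
  have nz': "\<And>s. s \<in> ?H \<Longrightarrow> h (z + exp s) - h z \<noteq> 0" using nz ex by force
  obtain G where G: "continuous_on ?H G" "\<And>s. s \<in> ?H \<Longrightarrow> h (z + exp s) - h z = exp (G s)"
    using continuous_logarithm_on_contractible[OF c convex_imp_contractible[OF conv] nz'] by blast
  let ?p = "2 * of_real pi * \<i> :: complex"
  have Gs: "exp (G (s + ?p)) = exp (G s)" if "s \<in> ?H" for s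
  proof -
    have "s + ?p \<in> ?H" using that by simp
    from G(2)[OF this] G(2)[OF that] show ?thesis
      by (simp add: exp_add exp_two_pi_i)
  qed
  define k where "k s = (G (s + ?p) - G s) / ?p" for s
  \<comment> \<open>Two logarithms of the same number differ by a multiple of \<open>2 \<pi> \<i>\<close>.\<close>
  have kint: "k s \<in> \<int>" if s: "s \<in> ?H" for s
  proof -
    have "\<exists>n. G (s + ?p) = G s + of_int (2 * n) * (of_real pi * \<i>)"
      using Gs[OF s] by (simp add: exp_eq ac_simps)
    then obtain n :: int where "G (s + ?p) = G s + of_int (2 * n) * (of_real pi * \<i>)" ..
    hence "k s = of_int n" unfolding k_def by (simp add: field_simps)
    thus ?thesis by simp
  qed
  have kc: "k constant_on ?H"
  proof (rule continuous_discrete_range_constant)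
    show "connected ?H" by (rule convex_connected[OF conv])
    show "continuous_on ?H k" unfolding k_def
      by (intro continuous_intros continuous_on_compose2[OF G(1)] G(1)) auto
    fix x assume x: "x \<in> ?H"
    show "\<exists>e>0. \<forall>y. y \<in> ?H \<and> k y \<noteq> k x \<longrightarrow> e \<le> cmod (k y - k x)"
    proof (intro exI[of _ 1] conjI allI impI)
      fix y assume y: "y \<in> ?H \<and> k y \<noteq> k x"
      then obtain a b where ab: "k y = of_int a" "k x = of_int b" using kint x by (metis Ints_cases)
      with y have "a \<noteq> b" by auto
      have "cmod (k y - k x) = \<bar>of_int (a - b)\<bar>"
        using ab by (metis norm_of_int of_int_diff)
      with \<open>a \<noteq> b\<close> show "1 \<le> cmod (k y - k x)" by linarith
    qed simp
  qed
  then obtain k0 where k0: "\<And>s. s \<in> ?H \<Longrightarrow> k s = k0" unfolding constant_on_def by blast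
  have "of_real (ln e - 1) \<in> ?H" by simp
  then obtain n where n: "k0 = of_int n" using kint k0 by (metis Ints_cases)
  have step: "G (s + ?p) = G s + ?p * of_int n" if "s \<in> ?H" for s
    using k0[OF that] n unfolding k_def by (simp add: field_simps)
  have pos: "G (s + ?p * of_nat m) = G s + ?p * of_int (int m * n)" if "s \<in> ?H" for s m
  proof (induction m)
    case (Suc m)
    have "s + ?p * of_nat m \<in> ?H" using that by simp
    from step[OF this] Suc show ?case by (simp add: algebra_simps)
  qed simp
  have "G (s + ?p * of_int m) = G s + ?p * of_int (m * n)" if "s \<in> ?H" for s m
  proof (cases "m \<ge> 0")
    case True thus ?thesis using pos[OF that, of "nat m"] by simp
  next
    case False
    have s': "s + ?p * of_int m \<in> ?H" using that by simp
    from pos[OF s', of "nat (-m)"] False show ?thesis by (simp add: algebra_simps)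
  qed
  thus thesis using G by (intro that[of G n]) (auto simp: algebra_simps)
qed

text \<open>Lifting a loop to the half-plane of \<open>punctured_disc_log\<close> gives a path from \<open>s\<close> to \<open>s + 2 \<pi> \<i> m\<close>,
where \<open>m\<close> is the winding number of the loop. Not only circles but all loops close to \<open>z\<close> are covered;
this is what makes indices multiplicative.\<close>

lemma winding_number_image_loop:
  assumes h: "continuous_on (ball z e) h" and e: "e > 0"
    and nz: "\<And>w. w \<in> ball z e \<Longrightarrow> w \<noteq> z \<Longrightarrow> h w \<noteq> h z"
  obtains n :: int where
    "\<And>\<gamma>. path \<gamma> \<Longrightarrow> pathfinish \<gamma> = pathstart \<gamma> \<Longrightarrow> path_image \<gamma> \<subseteq> ball z e - {z} \<Longrightarrow>
       winding_number (h \<circ> \<gamma>) (h z) = of_int n * winding_number \<gamma> z"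
proof -
  obtain G n where G: "continuous_on {s. Re s < ln e} G"
    "\<And>s. Re s < ln e \<Longrightarrow> h (z + exp s) = h z + exp (G s)"
    "\<And>s m. Re s < ln e \<Longrightarrow> G (s + 2 * of_real pi * \<i> * of_int m) = G s + 2 * of_real pi * \<i> * of_int (m * n)"
    using punctured_disc_log[OF assms] by metis
  show thesis
  proof (rule that[of n])
    fix \<gamma> assume p: "path \<gamma>" "pathfinish \<gamma> = pathstart \<gamma>" and im: "path_image \<gamma> \<subseteq> ball z e - {z}"
    obtain q m where q: "path q" "pathfinish q - pathstart q = 2 * of_real pi * \<i> * of_int m"
      "winding_number \<gamma> z = of_int m" "\<And>t. t \<in> {0..1} \<Longrightarrow> \<gamma> t = z + exp (q t)"
      using log_of_loop[OF p(1) _ p(2), of z] im by blast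
    have re: "Re (q t) < ln e" if t: "t \<in> {0..1}" for t
    proof -
      have "\<gamma> t \<in> ball z e" using im t unfolding path_image_def by blast
      hence "exp (Re (q t)) < e" using q(4)[OF t] by (simp add: dist_norm)
      thus ?thesis using e by (metis exp_less_cancel_iff exp_ln)
    qed
    have "winding_number (h \<circ> \<gamma>) (h z) = of_int (m * n)"
    proof (rule winding_number_of_log[where q="G \<circ> q"])
      show "path (G \<circ> q)"
        using q(1) re by (intro path_continuous_image continuous_on_subset[OF G(1)]) (auto simp: path_image_def)
      have "pathfinish q = pathstart q + 2 * of_real pi * \<i> * of_int m" using q(2) by (simp add: algebra_simps)
      thus "pathfinish (G \<circ> q) - pathstart (G \<circ> q) = 2 * of_real pi * \<i> * of_int (m * n)"
        using G(3)[of "pathstart q" m] re[of 0] by (simp add: pathstart_def pathfinish_def)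
      show "\<And>t. t \<in> {0..1} \<Longrightarrow> (h \<circ> \<gamma>) t = h z + exp ((G \<circ> q) t)"
        using G(2) re q(4) by simp
    qed
    thus "winding_number (h \<circ> \<gamma>) (h z) = of_int n * winding_number \<gamma> z" using q(3) by simp
  qed
qed

text \<open>The hypothesis under which the planar index exists and is meaningful.\<close>

definition isolated_in_fibre :: "(complex \<Rightarrow> complex) \<Rightarrow> complex \<Rightarrow> bool" where
  "isolated_in_fibre h z \<longleftrightarrow> (\<exists>e>0. continuous_on (ball z e) h \<and> (\<forall>w\<in>ball z e. w \<noteq> z \<longrightarrow> h w \<noteq> h z))"

lemma planar_index_small_circles:
  assumes "isolated_in_fibre h z"
  obtains n e where "e > 0" "\<And>\<gamma>. path \<gamma> \<Longrightarrow> pathfinish \<gamma> = pathstart \<gamma> \<Longrightarrow> path_image \<gamma> \<subseteq> ball z e - {z} \<Longrightarrow>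
       winding_number (h \<circ> \<gamma>) (h z) = of_int n * winding_number \<gamma> z"
      "has_planar_index h z n"
proof -
  obtain e where e: "e > 0" "continuous_on (ball z e) h" "\<And>w. w\<in>ball z e \<Longrightarrow> w \<noteq> z \<Longrightarrow> h w \<noteq> h z"
    using assms unfolding isolated_in_fibre_def by auto
  obtain n where n: "\<And>\<gamma>. path \<gamma> \<Longrightarrow> pathfinish \<gamma> = pathstart \<gamma> \<Longrightarrow> path_image \<gamma> \<subseteq> ball z e - {z} \<Longrightarrow>
       winding_number (h \<circ> \<gamma>) (h z) = of_int n * winding_number \<gamma> z"
    using winding_number_image_loop[OF e(2,1,3)] by blast
  have "has_planar_index h z n" unfolding has_planar_index_def
  proof (rule eventually_at_rightI[where b=e])
    fix r assume r: "r \<in> {0<..<e}"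
    have "winding_number (h \<circ> circlepath z r) (h z) = of_int n * winding_number (circlepath z r) z"
      by (rule n) (use r in \<open>auto simp: dist_norm norm_minus_commute\<close>)
    thus "winding_number (h \<circ> circlepath z r) (h z) = of_int n"
      using r by (simp add: winding_number_circlepath_centre)
  qed (use e in auto)
  thus thesis using that e n by blast
qed

lemma has_planar_index_unique:
  assumes "has_planar_index h z m" "has_planar_index h z n" shows "m = n"
proof -
  have "\<forall>\<^sub>F r in at_right (0::real). of_int m = (of_int n :: complex)"
    using eventually_conj[OF assms[unfolded has_planar_index_def]] by (rule eventually_mono) (metis of_int_eq_iff)
  thus ?thesis by (simp add: trivial_limit_at_right_real)
qed

lemma has_planar_index_exists: "isolated_in_fibre h z \<Longrightarrow> \<exists>n. has_planar_index h z n"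
  by (metis planar_index_small_circles)

lemma has_planar_index_cong:
  assumes "has_planar_index h z n" "\<forall>\<^sub>F w in nhds z. h w = k w"
  shows "has_planar_index k z n"
proof -
  obtain e where e: "e > 0" "\<And>w. w \<in> ball z e \<Longrightarrow> h w = k w"
    using assms(2) by (auto simp: eventually_nhds_metric dist_commute)
  have "\<forall>\<^sub>F r in at_right (0::real). r < e \<and> r > 0"
    by (rule eventually_at_rightI[where b=e]) (use e in auto)
  with assms(1) have "\<forall>\<^sub>F r in at_right 0. winding_number (h \<circ> circlepath z r) (h z) = of_int n \<and> r < e \<and> r > 0"
    unfolding has_planar_index_def by (rule eventually_conj)
  thus ?thesis unfolding has_planar_index_def
  proof (rule eventually_mono)
    fix r assume r: "winding_number (h \<circ> circlepath z r) (h z) = of_int n \<and> r < e \<and> r > 0"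
    have "h \<circ> circlepath z r = k \<circ> circlepath z r"
    proof
      fix t
      have "circlepath z r t \<in> ball z e" using r
        by (simp add: circlepath_eq dist_norm norm_mult norm_exp_eq_Re)
      thus "(h \<circ> circlepath z r) t = (k \<circ> circlepath z r) t" using e by simp
    qed
    with r e show "winding_number (k \<circ> circlepath z r) (k z) = of_int n" by simp
  qed
qed

lemma isolated_in_fibre_continuous:
  assumes "isolated_in_fibre h z" shows "isCont h z"
  using assms unfolding isolated_in_fibre_def
  by (metis continuous_on_eq_continuous_at open_ball centre_in_ball)

lemma isolated_in_fibre_comp:
  assumes "isolated_in_fibre h z" "isolated_in_fibre k (h z)"
  shows "isolated_in_fibre (k \<circ> h) z"
proof -
  obtain e where e: "e > 0" "continuous_on (ball z e) h" "\<And>w. w\<in>ball z e \<Longrightarrow> w \<noteq> z \<Longrightarrow> h w \<noteq> h z"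
    using assms unfolding isolated_in_fibre_def by auto
  obtain e' where e': "e' > 0" "continuous_on (ball (h z) e') k"
     "\<And>w. w\<in>ball (h z) e' \<Longrightarrow> w \<noteq> h z \<Longrightarrow> k w \<noteq> k (h z)"
    using assms unfolding isolated_in_fibre_def by auto
  obtain d where d: "d > 0" "\<And>w. dist w z < d \<Longrightarrow> dist (h w) (h z) < e'"
    using isolated_in_fibre_continuous[OF assms(1)] e'(1) unfolding continuous_at_eps_delta by blast
  show ?thesis unfolding isolated_in_fibre_def
  proof (intro exI[of _ "min d e"] conjI ballI impI)
    show "continuous_on (ball z (min d e)) (k \<circ> h)"
      by (intro continuous_on_compose continuous_on_subset[OF e(2)] continuous_on_subset[OF e'(2)])
         (use d in \<open>auto simp: dist_commute\<close>)
    fix w assume w: "w \<in> ball z (min d e)" "w \<noteq> z"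
    have "h w \<in> ball (h z) e'" using d(2)[of w] w by (simp add: dist_commute)
    thus "(k \<circ> h) w \<noteq> (k \<circ> h) z" using e'(3) e(3) w by simp
  qed (use d e in auto)
qed

text \<open>The image of a small circle under \<open>h\<close> is a loop that winds \<open>m\<close> times around \<open>h z\<close>, and \<open>k\<close> multiplies
the winding numbers of such loops by \<open>n\<close>.\<close>

lemma has_planar_index_comp:
  assumes h: "isolated_in_fibre h z" and k: "isolated_in_fibre k (h z)"
    and m: "has_planar_index h z m" and n: "has_planar_index k (h z) n"
  shows "has_planar_index (k \<circ> h) z (n * m)"
proof -
  obtain n' e where e: "e > 0" "\<And>\<gamma>. path \<gamma> \<Longrightarrow> pathfinish \<gamma> = pathstart \<gamma> \<Longrightarrow> path_image \<gamma> \<subseteq> ball (h z) e - {h z} \<Longrightarrow>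
       winding_number (k \<circ> \<gamma>) (k (h z)) = of_int n' * winding_number \<gamma> (h z)" "has_planar_index k (h z) n'"
    using planar_index_small_circles[OF k] by metis
  have n': "n' = n" using has_planar_index_unique[OF e(3) n] .
  obtain e1 where e1: "e1 > 0" "continuous_on (ball z e1) h" "\<And>w. w\<in>ball z e1 \<Longrightarrow> w \<noteq> z \<Longrightarrow> h w \<noteq> h z"
    using h unfolding isolated_in_fibre_def by auto
  obtain d where d: "d > 0" "\<And>w. dist w z < d \<Longrightarrow> dist (h w) (h z) < e"
    using isolated_in_fibre_continuous[OF h] e(1) unfolding continuous_at_eps_delta by blast
  have "\<forall>\<^sub>F r in at_right (0::real). r > 0 \<and> r < d \<and> r < e1"
    by (rule eventually_at_rightI[where b="min d e1"]) (use d e1 in auto)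
  with m have "\<forall>\<^sub>F r in at_right 0. winding_number (h \<circ> circlepath z r) (h z) = of_int m \<and> r > 0 \<and> r < d \<and> r < e1"
    unfolding has_planar_index_def by (rule eventually_conj)
  thus ?thesis unfolding has_planar_index_def
  proof (rule eventually_mono)
    fix r assume r: "winding_number (h \<circ> circlepath z r) (h z) = of_int m \<and> r > 0 \<and> r < d \<and> r < e1"
    let ?g = "h \<circ> circlepath z r"
    have pi: "path_image (circlepath z r) \<subseteq> ball z (min d e1) - {z}"
      using r by (auto simp: dist_norm norm_minus_commute)
    have p1: "path ?g" by (intro path_continuous_image continuous_on_subset[OF e1(2)]) (use pi in auto)
    have p2: "path_image ?g \<subseteq> ball (h z) e - {h z}"
    proof -
      have "h w \<in> ball (h z) e - {h z}" if "w \<in> ball z (min d e1) - {z}" for w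
        using d(2)[of w] e1(3)[of w] that by (auto simp: dist_commute)
      hence "h ` path_image (circlepath z r) \<subseteq> ball (h z) e - {h z}"
        using pi by (meson image_subsetI subsetD)
      thus ?thesis by (simp only: path_image_compose)
    qed
    have "winding_number (k \<circ> ?g) (k (h z)) = of_int n' * winding_number ?g (h z)"
      by (rule e(2)[OF p1 _ p2]) (simp add: pathstart_def pathfinish_def circlepath_eq)
    thus "winding_number (k \<circ> h \<circ> circlepath z r) ((k \<circ> h) z) = of_int (n * m)"
      using r n' by (simp add: o_assoc)
  qed
qed

lemma isolated_in_fibre_inj:
  assumes "open S" "z \<in> S" "continuous_on S h" "inj_on h S"
  shows "isolated_in_fibre h z"
proof -
  obtain e where "e > 0" "ball z e \<subseteq> S" using assms openE by blast
  thus ?thesis unfolding isolated_in_fibre_def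
    by (metis assms(2-4) continuous_on_subset inj_on_eq_iff subset_iff)
qed

text \<open>On small circles \<open>h\<close> is closer to its linear part \<open>h z + D (w - z)\<close> than that part is to \<open>h z\<close>,
so both images wind equally often around \<open>h z\<close>.\<close>

lemma has_planar_index_deriv:
  assumes D: "D \<noteq> 0" and der: "(h has_field_derivative D) (at z)"
    and cont: "\<forall>\<^sub>F w in nhds z. isCont h w"
  shows "has_planar_index h z 1"
proof -
  define c where "c = norm D"
  have c: "c > 0" using D by (simp add: c_def)
  obtain d where d: "d > 0" "\<And>w. norm (w - z) < d \<Longrightarrow> norm (h w - h z - D * (w - z)) \<le> c/2 * norm (w - z)"
    using der[unfolded has_field_derivative_def has_derivative_at_alt] c by (meson half_gt_zero)
  obtain e where e: "e > 0" "\<And>w. w \<in> ball z e \<Longrightarrow> isCont h w"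
    using cont by (auto simp: eventually_nhds_metric dist_commute)
  show ?thesis unfolding has_planar_index_def
  proof (rule eventually_at_rightI[where b="min d e"])
    fix r assume r: "r \<in> {0<..<min d e}"
    have nm: "norm (circlepath z r t - z) = r" for t
      using r by (simp add: circlepath_eq norm_mult)
    have "winding_number (h \<circ> circlepath z r) (h z) = winding_number (\<lambda>t. h z + D * (circlepath z r t - z)) (h z)"
    proof (rule winding_number_nearby_loops_eq)
      show "path (\<lambda>t. h z + D * (circlepath z r t - z))"
        unfolding path_def circlepath_eq by (intro continuous_intros)
      have "continuous_on (ball z e) h" using e continuous_at_imp_continuous_on by blast
      moreover have "path_image (circlepath z r) \<subseteq> ball z e"
        using r by (auto simp: dist_norm norm_minus_commute)
      ultimately show "path (h \<circ> circlepath z r)"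
        by (intro path_continuous_image) (auto intro: continuous_on_subset)
      fix t :: real
      let ?w = "circlepath z r t"
      have "norm (h ?w - h z - D * (?w - z)) \<le> c/2 * r" using d(2)[of ?w] nm[of t] r by simp
      moreover have "norm (D * (?w - z)) = c * r" using nm[of t] by (simp add: c_def norm_mult)
      moreover have "c/2*r < c * r" using c r by simp
      ultimately show "norm ((h \<circ> circlepath z r) t - (h z + D * (?w - z))) < norm (h z + D * (?w - z) - h z)"
        by (simp add: algebra_simps)
    qed (auto simp: pathstart_def pathfinish_def circlepath_eq)
    also have "\<dots> = of_int 1"
    proof (rule winding_number_of_log[where q="\<lambda>t. Ln D + Ln r + 2 * of_real pi * \<i> * of_real t"])
      show "path (\<lambda>t. Ln D + Ln r + 2 * of_real pi * \<i> * of_real t)"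
        unfolding path_def by (intro continuous_intros)
      show "h z + D * (circlepath z r t - z) = h z + exp (Ln D + Ln r + 2 * of_real pi * \<i> * of_real t)" for t
        using D r by (simp add: circlepath_eq exp_add)
    qed (simp add: pathstart_def pathfinish_def)
    finally show "winding_number (h \<circ> circlepath z r) (h z) = of_int 1" .
  qed (use d e in auto)
qed

lemma has_planar_index_power_0:
  assumes "d \<ge> 1" shows "has_planar_index (\<lambda>w. w ^ d) 0 (int d)"
  unfolding has_planar_index_def
proof (rule eventually_at_rightI[where b=1])
  fix r assume r: "r \<in> {0<..<(1::real)}"
  show "winding_number ((\<lambda>w. w ^ d) \<circ> circlepath 0 r) (0 ^ d) = of_int (int d)"
  proof (rule winding_number_of_log[where q="\<lambda>t. of_nat d * (Ln r + 2 * of_real pi * \<i> * of_real t)"])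
    show "path (\<lambda>t. of_nat d * (Ln r + 2 * of_real pi * \<i> * of_real t))"
      unfolding path_def by (intro continuous_intros)
    show "((\<lambda>w. w ^ d) \<circ> circlepath 0 r) t = 0 ^ d + exp (of_nat d * (Ln r + 2 * of_real pi * \<i> * of_real t))" for t
      using assms r by (simp add: circlepath_eq exp_of_nat_mult exp_add)
  qed (simp add: pathstart_def pathfinish_def algebra_simps)
qed simp

lemma has_planar_index_power:
  assumes "d \<ge> 1" shows "has_planar_index (\<lambda>w. w ^ d) z (if z = 0 then int d else 1)"
proof (cases "z = 0")
  case False
  have "has_planar_index (\<lambda>w. w ^ d) z 1"
    by (rule has_planar_index_deriv[where D="of_nat d * z ^ (d - 1)"])
       (use False assms in \<open>auto intro!: derivative_eq_intros\<close>)
  thus ?thesis using False by simp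
qed (use has_planar_index_power_0[OF assms] in simp)

lemma power_locally_injective:
  assumes "z \<noteq> 0" "d \<ge> 1"
  obtains r where "r > 0" "inj_on (\<lambda>w::complex. w ^ d) (ball z r)"
proof -
  have "((\<lambda>w. w ^ d) has_field_derivative of_nat d * z ^ (d - 1)) (at z)"
    by (auto intro!: derivative_eq_intros)
  hence "deriv (\<lambda>w. w ^ d) z \<noteq> 0" using assms by (simp add: DERIV_imp_deriv)
  moreover have "(\<lambda>w::complex. w ^ d) holomorphic_on UNIV" by (intro holomorphic_intros)
  ultimately show thesis
    using has_complex_derivative_locally_injective[OF _ UNIV_I open_UNIV] that by metis
qed

lemma isolated_in_fibre_power:
  assumes "d \<ge> 1" shows "isolated_in_fibre (\<lambda>w. w ^ d) z"
proof (cases "z = 0")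
  case True
  show ?thesis unfolding isolated_in_fibre_def
    by (intro exI[of _ 1]) (use True assms in \<open>auto intro!: continuous_intros simp: power_0_left\<close>)
next
  case False
  then obtain r where r: "r > 0" "inj_on (\<lambda>w::complex. w ^ d) (ball z r)"
    using power_locally_injective assms by metis
  show ?thesis
    by (rule isolated_in_fibre_inj[OF open_ball _ _ r(2)]) (use r(1) in \<open>auto intro!: continuous_intros\<close>)
qed

section \<open>The universal covering of the torus\<close>

text \<open>The Gaussian integers, which are the periods of \<open>torus_param\<close>.\<close>

definition lat :: "complex set" where "lat = {z. Re z \<in> \<int> \<and> Im z \<in> \<int>}"

lemma lat_0 [simp]: "0 \<in> lat" and lat_add: "u \<in> lat \<Longrightarrow> v \<in> lat \<Longrightarrow> u + v \<in> lat"
  and lat_diff: "u \<in> lat \<Longrightarrow> v \<in> lat \<Longrightarrow> u - v \<in> lat" and lat_minus: "u \<in> lat \<Longrightarrow> - u \<in> lat"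
  by (auto simp: lat_def)

lemma lat_norm_ge_1: assumes "u \<in> lat" "u \<noteq> 0" shows "1 \<le> norm u"
proof -
  obtain a b where ab: "Re u = of_int a" "Im u = of_int b" using assms by (auto simp: lat_def elim!: Ints_cases)
  have "a \<noteq> 0 \<or> b \<noteq> 0" using ab assms(2) by (auto simp: complex_eq_iff)
  hence "\<bar>Re u\<bar> \<ge> 1 \<or> \<bar>Im u\<bar> \<ge> 1" unfolding ab by linarith
  thus ?thesis using abs_Re_le_cmod[of u] abs_Im_le_cmod[of u] by linarith
qed

lemma cis_2pi_eq_iff: "cis (2 * pi * x) = cis (2 * pi * y) \<longleftrightarrow> x - y \<in> \<int>"
proof -
  have "cis (2 * pi * x) = cis (2 * pi * y) \<longleftrightarrow> (\<exists>n::int. 2 * pi * x = 2 * pi * y + 2 * pi * n)"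
    by (auto simp: complex_eq_iff sin_cos_eq_iff[symmetric])
  also have "\<dots> \<longleftrightarrow> (\<exists>n::int. x - y = n)"
  proof -
    have "2 * pi * x = 2 * pi * y + 2 * pi * n \<longleftrightarrow> x - y = n" for n :: real
    proof -
      have "2 * pi * x = 2 * pi * y + 2 * pi * n \<longleftrightarrow> 2 * pi * x = 2 * pi * (y + n)" by (simp add: algebra_simps)
      also have "\<dots> \<longleftrightarrow> x = y + n" by simp
      finally show ?thesis by auto
    qed
    thus ?thesis by simp
  qed
  finally show ?thesis by (metis Ints_cases Ints_of_int)
qed

lemma torus_param_eq_iff: "torus_param z = torus_param w \<longleftrightarrow> z - w \<in> lat"
  by (simp add: torus_param_def cis_2pi_eq_iff lat_def)

lemma torus_param_add_lat: "v \<in> lat \<Longrightarrow> torus_param (z + v) = torus_param z"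
  by (simp add: torus_param_eq_iff)

lemma continuous_torus_param: "continuous_on S torus_param"
  unfolding torus_param_def cis_conv_exp by (intro continuous_intros)

lemma points_T2: "points T2 = sphere 0 1 \<times> sphere 0 1" and params_T2: "params T2 = {torus_param}"
  by (simp_all add: T2_def)

lemma sphere_complex_cis: assumes "norm z = 1" shows "\<exists>t\<in>{0..1}. z = cis (2 * pi * t)"
proof -
  have "z = cis (Arg2pi z)" using assms Arg2pi_eq[of z] by (simp add: cis_conv_exp)
  thus ?thesis using Arg2pi[of z] by (intro bexI[of _ "Arg2pi z / (2*pi)"]) auto
qed

lemma torus_param_square: "x \<in> points T2 \<Longrightarrow> \<exists>z\<in>cbox 0 (Complex 1 1). torus_param z = x"
proof -
  assume x: "x \<in> points T2"
  then obtain s t where "s \<in> {0..1}" "t \<in> {0..1}" "fst x = cis (2 * pi * s)" "snd x = cis (2 * pi * t)"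
    unfolding points_T2 using sphere_complex_cis[of "fst x"] sphere_complex_cis[of "snd x"] by auto
  thus ?thesis by (intro bexI[of _ "Complex s t"]) (auto simp: torus_param_def in_cbox_complex_iff prod_eq_iff)
qed

lemma torus_param_in [simp]: "torus_param z \<in> points T2"
  by (simp add: points_T2 torus_param_def)

lemma torus_param_surj: "x \<in> points T2 \<Longrightarrow> \<exists>z. x = torus_param z"
  using torus_param_square by metis

lemma range_torus_param: "range torus_param = points T2"
proof
  show "points T2 \<subseteq> range torus_param" using torus_param_surj by (metis rangeI subsetI)
qed (auto simp del: split_paired_All)

lemma compact_T2: "compact (points T2)" unfolding points_T2 by (intro compact_Times compact_sphere)

lemma connected_T2: "connected (points T2)"
  using connected_continuous_image[OF continuous_torus_param, of UNIV] by (simp add: range_torus_param connected_UNIV)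

text \<open>The saturation of an open set \<open>W\<close> is a union of translates of \<open>W\<close>, hence open. The complement of the
image of \<open>W\<close> is therefore the image of a compact subset of the unit square.\<close>

lemma torus_param_open_map:
  assumes "open W" shows "openin (top_of_set (points T2)) (torus_param ` W)"
proof -
  define W' where "W' = (\<Union>v\<in>lat. (+) v ` W)"
  have oW: "open W'" unfolding W'_def using assms by (auto intro: open_translation)
  have W': "torus_param z \<in> torus_param ` W \<longleftrightarrow> z \<in> W'" for z
  proof
    assume "torus_param z \<in> torus_param ` W"
    then obtain w where "w \<in> W" "z - w \<in> lat" by (auto simp: torus_param_eq_iff)
    thus "z \<in> W'" unfolding W'_def by (auto intro!: bexI[of _ "z - w"] image_eqI[of _ _ w])
  next
    assume "z \<in> W'"
    then obtain v w where "v \<in> lat" "w \<in> W" "z = v + w" unfolding W'_def by auto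
    thus "torus_param z \<in> torus_param ` W" using torus_param_add_lat[of v w] by (auto simp: add.commute)
  qed
  have "points T2 - torus_param ` W = torus_param ` (cbox 0 (Complex 1 1) - W')"
  proof (intro equalityI subsetI)
    fix x assume x: "x \<in> points T2 - torus_param ` W"
    then obtain z where z: "z \<in> cbox 0 (Complex 1 1)" "torus_param z = x" using torus_param_square by blast
    have "z \<notin> W'" using x W'[of z] z(2) by simp
    thus "x \<in> torus_param ` (cbox 0 (Complex 1 1) - W')" using z by blast
  next
    fix x assume "x \<in> torus_param ` (cbox 0 (Complex 1 1) - W')"
    then obtain z where "z \<notin> W'" "x = torus_param z" by blast
    thus "x \<in> points T2 - torus_param ` W" using W'[of z] by simp
  qed
  moreover have "compact (torus_param ` (cbox 0 (Complex 1 1) - W'))"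
    by (intro compact_continuous_image continuous_torus_param compact_diff compact_cbox oW)
  ultimately have "closed (points T2 - torus_param ` W)" by (simp add: compact_imp_closed)
  hence "closedin (top_of_set (points T2)) (points T2 - torus_param ` W)"
    by (intro closed_subset) auto
  moreover have "torus_param ` W \<subseteq> points T2" using range_torus_param by blast
  ultimately show ?thesis by (simp add: openin_closedin_eq)
qed

lemma torus_param_inj_ball: assumes "r \<le> 1/2" shows "inj_on torus_param (ball z r)"
proof (rule inj_onI)
  fix a b assume "a \<in> ball z r" "b \<in> ball z r" "torus_param a = torus_param b"
  moreover from this have "dist a b < 1" using assms dist_triangle2[of a b z] by (auto simp: dist_commute)
  ultimately show "a = b" using lat_norm_ge_1[of "a - b"] by (auto simp: torus_param_eq_iff dist_norm)
qed

lemma torus_param_homeo: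
  assumes "open W" "W \<subseteq> ball z (1/2)"
  shows "\<exists>g. homeomorphism W (torus_param ` W) torus_param g"
proof -
  have "inj_on torus_param W" using inj_on_subset torus_param_inj_ball assms by blast
  moreover have "openin (top_of_set (torus_param ` W)) (torus_param ` U)" if "openin (top_of_set W) U" for U
  proof -
    have "open U" "U \<subseteq> W" using that assms(1) openin_open_trans openin_imp_subset by blast+
    thus ?thesis
      by (intro openin_subset_trans[OF torus_param_open_map[OF \<open>open U\<close>]])
         (auto simp del: split_paired_All)
  qed
  ultimately show ?thesis
    using homeomorphism_injective_open_map[OF continuous_torus_param refl] by metis
qed

text \<open>The image of a disc of radius 1/2 is evenly covered by the translates of that disc, which are disjoint
because distinct lattice points have distance at least 1.\<close>

lemma covering_torus_param: "covering_space UNIV torus_param (points T2)"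
proof (rule covering_spaceI[OF continuous_torus_param range_torus_param])
  fix x assume "x \<in> points T2"
  then obtain z where z: "x = torus_param z" using torus_param_surj by blast
  let ?B = "\<lambda>v. ball (z + v) (1/2)"
  have B: "torus_param ` ?B v = torus_param ` ball z (1/2)" if v: "v \<in> lat" for v
  proof -
    have "?B v = (+) v ` ball z (1/2)"
      by (auto simp: dist_norm algebra_simps intro!: image_eqI[of _ _ "_ - v"])
    thus ?thesis using torus_param_add_lat[OF v] by (simp add: image_image add.commute)
  qed
  show "\<exists>T. x \<in> T \<and> openin (top_of_set (points T2)) T \<and>
     (\<exists>v. \<Union>v = UNIV \<inter> torus_param -` T \<and> (\<forall>u\<in>v. openin (top_of_set UNIV) u) \<and> pairwise disjnt v \<and>
        (\<forall>u\<in>v. \<exists>q. homeomorphism u T torus_param q))"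
  proof (intro exI[of _ "torus_param ` ball z (1/2)"] exI[of _ "?B ` lat"] conjI ballI)
    show "openin (top_of_set (points T2)) (torus_param ` ball z (1/2))" by (simp add: torus_param_open_map)
    show "\<Union>(?B ` lat) = UNIV \<inter> torus_param -` torus_param ` ball z (1/2)"
    proof (rule set_eqI)
      fix w
      have "w \<in> \<Union>(?B ` lat) \<longleftrightarrow> (\<exists>v\<in>lat. w - v \<in> ball z (1/2))"
        by (auto simp: dist_norm algebra_simps)
      also have "\<dots> \<longleftrightarrow> (\<exists>u\<in>ball z (1/2). w - u \<in> lat)"
        by (metis diff_diff_eq2 add_diff_cancel_left')
      also have "\<dots> \<longleftrightarrow> w \<in> UNIV \<inter> torus_param -` torus_param ` ball z (1/2)"
        by (auto simp: torus_param_eq_iff[symmetric])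
      finally show "w \<in> \<Union>(?B ` lat) \<longleftrightarrow> \<dots>" .
    qed
    show "pairwise disjnt (?B ` lat)"
    proof (rule pairwiseI)
      fix S T assume ST: "S \<in> ?B ` lat" "T \<in> ?B ` lat" "S \<noteq> T"
      then obtain u v where uv: "u \<in> lat" "v \<in> lat" "S = ?B u" "T = ?B v" by blast
      hence "1 \<le> norm (u - v)" using ST(3) by (intro lat_norm_ge_1 lat_diff) auto
      thus "disjnt S T" unfolding disjnt_def uv
        by (intro disjoint_ballI) (simp add: dist_norm)
    qed
    fix u assume "u \<in> ?B ` lat"
    then obtain v where v: "v \<in> lat" "u = ?B v" by auto
    show "openin (top_of_set UNIV) u" using v by simp
    show "\<exists>q. homeomorphism u (torus_param ` ball z (1/2)) torus_param q"
      using torus_param_homeo[of u "z + v"] B v by (metis open_ball subset_refl)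
  qed (use z in auto)
qed

lemma continuous_on_T2I:
  fixes h :: "complex \<times> complex \<Rightarrow> 'b::topological_space"
  assumes "continuous_on UNIV (h \<circ> torus_param)"
  shows "continuous_on (points T2) h"
  unfolding continuous_on_open_invariant
proof (intro allI impI)
  fix B :: "'b set" assume "open B"
  hence o: "open ((h \<circ> torus_param) -` B)" using assms by (subst (asm) continuous_on_open_vimage) auto
  have "torus_param ` ((h \<circ> torus_param) -` B) = h -` B \<inter> points T2"
    unfolding range_torus_param[symmetric] by auto
  thus "\<exists>A. open A \<and> A \<inter> points T2 = h -` B \<inter> points T2"
    using torus_param_open_map[OF o] unfolding openin_open by (metis inf_commute)
qed

section \<open>Local homeomorphisms of compact spaces\<close>

text \<open>A limit point of an infinite fibre would lie in the fibre without being isolated in it.\<close>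

lemma finite_fibre:
  fixes h :: "'a::metric_space \<Rightarrow> 'b::t1_space"
  assumes K: "compact K" and c: "continuous_on K h"
    and i: "\<And>x. x \<in> K \<Longrightarrow> \<exists>U. openin (top_of_set K) U \<and> x \<in> U \<and> (\<forall>u\<in>U. h u = h x \<longrightarrow> u = x)"
  shows "finite {x \<in> K. h x = y}"
proof (rule ccontr)
  let ?X = "{x \<in> K. h x = y}"
  assume "infinite ?X"
  then obtain x where x: "x \<in> K" "x islimpt ?X" using Heine_Borel_imp_Bolzano_Weierstrass[OF K, of ?X] by auto
  have "closedin (top_of_set K) (K \<inter> h -` {y})" using c by (intro continuous_closedin_preimage) auto
  moreover have "K \<inter> h -` {y} = ?X" by auto
  ultimately have "closed ?X" using K closedin_compact compact_imp_closed by metis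
  hence "x \<in> ?X" using x closed_limpt by blast
  obtain U where U: "openin (top_of_set K) U" "x \<in> U" "\<forall>u\<in>U. h u = h x \<longrightarrow> u = x" using i x by blast
  obtain O' where O': "open O'" "U = K \<inter> O'" using U(1) openin_open by metis
  obtain u where "u \<in> ?X" "u \<in> O'" "u \<noteq> x" using x(2) O' U(2) unfolding islimpt_def by blast
  thus False using U O' \<open>x \<in> ?X\<close> by auto
qed

text \<open>The image is open, and it is closed by compactness, so the map is onto. A fibre is finite; choose
disjoint sheets around its points. The images of the sheets intersect in a neighbourhood of the base
point, and removing the image of what lies outside the sheets, a closed set that misses the base
point, makes this neighbourhood evenly covered.\<close>

lemma compact_local_homeo_covering:
  fixes F :: "'a::metric_space \<Rightarrow> 'b::metric_space"
  assumes K: "compact K" "K \<noteq> {}" and L: "connected L" and FK: "F ` K \<subseteq> L"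
    and loc: "\<And>x. x \<in> K \<Longrightarrow> \<exists>U. openin (top_of_set K) U \<and> x \<in> U \<and> openin (top_of_set L) (F ` U) \<and>
        (\<exists>g. homeomorphism U (F ` U) F g)"
  shows "covering_space K F L"
proof -
  have homeo_restrict: "(\<exists>g. homeomorphism N (F ` N) F g) \<and> openin (top_of_set L) (F ` N)"
    if U: "openin (top_of_set K) U" "openin (top_of_set L) (F ` U)" "homeomorphism U (F ` U) F g"
      and N: "openin (top_of_set K) N" "N \<subseteq> U" for U g N
  proof
    show "\<exists>g. homeomorphism N (F ` N) F g" using homeomorphism_of_subsets[OF U(3) N(2)] by blast
    have "openin (top_of_set U) N" using N U(1) openin_subset_trans openin_imp_subset by metis
    hence "openin (top_of_set (F ` U)) (F ` N)" using homeomorphism_imp_open_map[OF U(3)] by blast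
    thus "openin (top_of_set L) (F ` N)" using U(2) openin_trans by blast
  qed
  have cont: "continuous_on K F"
    unfolding continuous_on_eq_continuous_within
  proof
    fix x assume "x \<in> K"
    then obtain U g where U: "openin (top_of_set K) U" "x \<in> U" "homeomorphism U (F ` U) F g" using loc by blast
    obtain O' where "open O'" "U = K \<inter> O'" using U(1) openin_open by metis
    moreover have "continuous (at x within U) F" using U homeomorphism_cont1 continuous_on_eq_continuous_within by blast
    moreover have "at x within K = at x within U"
      using \<open>open O'\<close> \<open>U = _\<close> U(2) by (intro at_within_nhd[of x O']) auto
    ultimately show "continuous (at x within K) F" by simp
  qed
  have openmap: "openin (top_of_set L) (F ` N)" if N: "openin (top_of_set K) N" for N
  proof (subst openin_subopen, safe)
    fix x assume x: "x \<in> N"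
    hence "x \<in> K" using N openin_imp_subset by blast
    then obtain U g where U: "openin (top_of_set K) U" "x \<in> U" "openin (top_of_set L) (F ` U)" "homeomorphism U (F ` U) F g"
      using loc by blast
    have "openin (top_of_set L) (F ` (N \<inter> U))"
      using homeo_restrict[OF U(1,3,4), of "N \<inter> U"] N U(1) by (simp add: openin_Int)
    thus "\<exists>T. openin (top_of_set L) T \<and> F x \<in> T \<and> T \<subseteq> F ` N" using x U(2) by blast
  qed
  have surj: "F ` K = L"
  proof -
    have "openin (top_of_set L) (F ` K)" by (rule openmap) simp
    moreover have "closedin (top_of_set L) (F ` K)"
      using compact_continuous_image[OF cont K(1)] compact_imp_closed closed_subset FK by metis
    ultimately show ?thesis using L K(2) connected_clopen by blast
  qed
  show ?thesis
  proof (rule covering_spaceI[OF cont surj])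
    fix y assume y: "y \<in> L"
    define X where "X = {x \<in> K. F x = y}"
    have finX: "finite X" unfolding X_def
    proof (rule finite_fibre[OF K(1) cont])
      fix x assume "x \<in> K"
      then obtain U g where U: "openin (top_of_set K) U" "x \<in> U" "homeomorphism U (F ` U) F g" using loc by blast
      thus "\<exists>U. openin (top_of_set K) U \<and> x \<in> U \<and> (\<forall>u\<in>U. F u = F x \<longrightarrow> u = x)"
        by (metis homeomorphism_apply1)
    qed
    have neX: "X \<noteq> {}" using y surj by (auto simp: X_def)
    obtain d where d: "d > 0" "\<And>a b. a \<in> X \<Longrightarrow> b \<in> X \<Longrightarrow> a \<noteq> b \<Longrightarrow> d \<le> dist a b"
    proof -
      let ?D = "insert 1 ((\<lambda>q. dist (fst q) (snd q)) ` {q \<in> X \<times> X. fst q \<noteq> snd q})"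
      have fin: "finite ?D" using finX by simp
      have "0 < Min ?D" by (subst Min_gr_iff[OF fin]) auto
      moreover have "Min ?D \<le> dist a b" if "a \<in> X" "b \<in> X" "a \<noteq> b" for a b
        by (rule Min_le[OF fin]) (use that in \<open>auto intro!: image_eqI[of _ _ "(a, b)"]\<close>)
      ultimately show thesis using that by blast
    qed
    obtain U where U: "\<And>x. x \<in> X \<Longrightarrow> openin (top_of_set K) (U x) \<and> x \<in> U x \<and> openin (top_of_set L) (F ` U x) \<and>
        (\<exists>g. homeomorphism (U x) (F ` U x) F g)"
      using loc unfolding X_def by (metis (no_types, lifting) mem_Collect_eq)
    define N where "N x = U x \<inter> ball x (d/2)" for x
    have N: "openin (top_of_set K) (N x)" "x \<in> N x" "\<exists>g. homeomorphism (N x) (F ` N x) F g"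
      "openin (top_of_set L) (F ` N x)" if x: "x \<in> X" for x
    proof -
      show o: "openin (top_of_set K) (N x)" unfolding N_def using U[OF x] by (simp add: openin_Int_open)
      show "x \<in> N x" using U[OF x] d by (simp add: N_def)
      show "\<exists>g. homeomorphism (N x) (F ` N x) F g" "openin (top_of_set L) (F ` N x)"
        using homeo_restrict[of "U x" _ "N x"] U[OF x] o unfolding N_def by blast+
    qed
    have disj: "N a \<inter> N b = {}" if "a \<in> X" "b \<in> X" "a \<noteq> b" for a b
      using disjoint_ballI[of "d/2" "d/2" a b] d(2)[OF that] by (auto simp: N_def)
    define V where "V = (\<Inter>x\<in>X. F ` N x) - F ` (K - \<Union>(N ` X))"
    have oV: "openin (top_of_set L) V"
    proof -
      have "openin (top_of_set L) (\<Inter>x\<in>X. F ` N x)"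
        using finX neX N by (intro openin_INT2) auto
      moreover have "closed (F ` (K - \<Union>(N ` X)))"
      proof -
        have "openin (top_of_set K) (\<Union>(N ` X))" using N by blast
        hence "closedin (top_of_set K) (K - \<Union>(N ` X))" by (simp add: closedin_diff)
        hence "compact (K - \<Union>(N ` X))" using K closedin_compact by blast
        thus ?thesis by (intro compact_imp_closed compact_continuous_image continuous_on_subset[OF cont]) auto
      qed
      ultimately show ?thesis unfolding V_def Diff_eq by (intro openin_Int_open open_Compl)
    qed
    show "\<exists>T. y \<in> T \<and> openin (top_of_set L) T \<and>
            (\<exists>v. \<Union>v = K \<inter> F -` T \<and> (\<forall>u\<in>v. openin (top_of_set K) u) \<and> pairwise disjnt v \<and>
               (\<forall>u\<in>v. \<exists>q. homeomorphism u T F q))"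
    proof (intro exI[of _ V] exI[of _ "(\<lambda>x. N x \<inter> F -` V) ` X"] conjI ballI)
      show "y \<in> V" unfolding V_def
      proof
        show "y \<in> (\<Inter>x\<in>X. F ` N x)" using N(2) unfolding X_def by blast
        show "y \<notin> F ` (K - \<Union>(N ` X))" using N(2) unfolding X_def by blast
      qed
      have NK: "N x \<subseteq> K" if "x \<in> X" for x using N(1)[OF that] openin_imp_subset by blast
      show "\<Union>((\<lambda>x. N x \<inter> F -` V) ` X) = K \<inter> F -` V"
        using NK unfolding V_def by blast
      show "pairwise disjnt ((\<lambda>x. N x \<inter> F -` V) ` X)"
        using disj by (intro pairwiseI) (auto simp: disjnt_def)
      fix u assume "u \<in> (\<lambda>x. N x \<inter> F -` V) ` X"
      then obtain x where x: "x \<in> X" "u = N x \<inter> F -` V" by blast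
      have "openin (top_of_set K) (K \<inter> F -` V)" using continuous_openin_preimage[OF cont _ oV] FK by auto
      moreover have "u = N x \<inter> (K \<inter> F -` V)" using x NK by blast
      ultimately show "openin (top_of_set K) u" using N(1)[OF x(1)] by (metis openin_Int)
      obtain g where g: "homeomorphism (N x) (F ` N x) F g" using N(3) x by blast
      have "V \<subseteq> F ` N x" unfolding V_def using x(1) by (meson Diff_subset INT_lower subset_trans)
      hence "F ` u = V" unfolding x(2) by fast
      moreover have "u \<subseteq> N x" unfolding x(2) by (rule Int_lower1)
      ultimately show "\<exists>q. homeomorphism u V F q"
        using homeomorphism_of_subsets[OF g _ order_refl] by blast
    qed (use oV in auto)
  qed
qed

section \<open>Orientation preserving homeomorphisms of the plane\<close>

definition oriented_homeo :: "(complex \<Rightarrow> complex) \<Rightarrow> bool" where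
  "oriented_homeo E \<longleftrightarrow> (\<exists>G. homeomorphism UNIV UNIV E G) \<and> (\<forall>z. has_planar_index E z 1)"

lemma oriented_homeoD:
  assumes "oriented_homeo E"
  shows "continuous_on UNIV E" "inj E" "surj E" "has_planar_index E z 1" "isolated_in_fibre E z"
proof -
  obtain G where G: "homeomorphism UNIV UNIV E G" using assms unfolding oriented_homeo_def by blast
  show c: "continuous_on UNIV E" using G homeomorphism_cont1 by blast
  show i: "inj E" using G by (metis homeomorphism_apply1 injI UNIV_I)
  show "surj E" using G homeomorphism_image1 by blast
  show "has_planar_index E z 1" using assms unfolding oriented_homeo_def by blast
  show "isolated_in_fibre E z" using isolated_in_fibre_inj[of UNIV z E] c i by simp
qed

lemma oriented_homeo_comp:
  assumes E: "oriented_homeo E" and F: "oriented_homeo F" shows "oriented_homeo (F \<circ> E)"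
proof -
  have "has_planar_index (F \<circ> E) z 1" for z
    using has_planar_index_comp[OF oriented_homeoD(5)[OF E] oriented_homeoD(5)[OF F]
       oriented_homeoD(4)[OF E] oriented_homeoD(4)[OF F], of z] by simp
  thus ?thesis using E F homeomorphism_compose unfolding oriented_homeo_def by blast
qed

lemma has_planar_index_translation: "has_planar_index (\<lambda>w. w - c) z 1"
  by (rule has_planar_index_deriv[where D=1]) (auto intro!: derivative_eq_intros)

lemma isolated_in_fibre_translation: "isolated_in_fibre (\<lambda>w. w - c) z"
  by (rule isolated_in_fibre_inj[of UNIV]) (auto intro!: continuous_intros inj_onI)

text \<open>The product of the indices of a map and of its inverse is the index of the identity.\<close>

lemma oriented_homeo_inverse:
  assumes E: "oriented_homeo E" and G: "homeomorphism UNIV UNIV E G" shows "oriented_homeo G"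
proof -
  have cG: "continuous_on UNIV G" and iG: "inj G"
    using G homeomorphism_cont2 by (blast, metis homeomorphism_apply2 injI UNIV_I)
  have "has_planar_index G w 1" for w
  proof -
    have iso: "isolated_in_fibre G w" using isolated_in_fibre_inj[of UNIV w G] cG iG by simp
    then obtain n where n: "has_planar_index G w n" using has_planar_index_exists by blast
    have "has_planar_index (E \<circ> G) w (1 * n)"
      by (rule has_planar_index_comp[OF iso oriented_homeoD(5)[OF E] n oriented_homeoD(4)[OF E]])
    moreover have "E \<circ> G = (\<lambda>w. w - 0)" using G by (auto simp: fun_eq_iff homeomorphism_apply2)
    ultimately show ?thesis using n has_planar_index_unique has_planar_index_translation[of 0 w] by fastforce
  qed
  thus ?thesis using G homeomorphism_sym unfolding oriented_homeo_def by blast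
qed

text \<open>Triangular matrices with positive diagonal are joined to the identity by a segment of invertible
matrices. They suffice below, since every rank two sublattice of the
Gaussian integers has a triangular basis.\<close>

lemma oriented_homeo_triangular:
  fixes a b d :: real
  assumes a: "a > 0" and d: "d > 0"
  shows "oriented_homeo (\<lambda>z. Complex (a * Re z + b * Im z) (d * Im z))" (is "oriented_homeo ?M")
proof -
  let ?G = "\<lambda>z. Complex ((Re z - b * (Im z / d)) / a) (Im z / d)"
  have cont: "continuous_on S ?M" "continuous_on S ?G" for S
    unfolding Complex_eq using a d by (auto intro!: continuous_intros)
  have h: "homeomorphism UNIV UNIV ?M ?G"
    using a d by (intro homeomorphismI cont) (auto simp: complex_eq_iff field_simps)
  have wn: "winding_number (?M \<circ> circlepath z r) (?M z) = 1" if r: "r > 0" for z r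
  proof -
    let ?c = "circlepath z r"
    let ?k = "\<lambda>t. ?M z + (?c t - z)"
    have ne: "?c t - z \<noteq> 0" for t using r by (simp add: circlepath_eq)
    have "winding_number (?M \<circ> ?c) (?M z) = winding_number ?k (?M z)"
    proof (rule winding_number_loops_linear_eq)
      show "path (?M \<circ> ?c)" by (intro path_continuous_image cont) simp
      show "path ?k" unfolding path_def circlepath_eq by (intro continuous_intros)
      fix t :: real
      let ?v = "?c t - z"
      show "?M z \<notin> closed_segment (?k t) ((?M \<circ> ?c) t)"
      proof
        assume "?M z \<in> closed_segment (?k t) ((?M \<circ> ?c) t)"
        then obtain u where u: "0 \<le> u" "u \<le> 1" "?M z = (1 - u) *\<^sub>R ?k t + u *\<^sub>R ?M (?c t)"
          by (auto simp: closed_segment_def)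
        have "Im (?M z) = (1 - u) * Im (?k t) + u * Im (?M (?c t))"
             "Re (?M z) = (1 - u) * Re (?k t) + u * Re (?M (?c t))"
          using arg_cong[OF u(3), of Im] arg_cong[OF u(3), of Re] by simp_all
        hence 1: "(1 - u + u * d) * Im ?v = 0" and 2: "(1 - u + u * a) * Re ?v + u * b * Im ?v = 0"
          by (simp_all add: algebra_simps)
        have pos: "1 - u + u * e > 0" if "e > 0" for e
        proof (cases "u = 1")
          case False
          thus ?thesis using u that by (intro add_pos_nonneg) auto
        qed (use that in simp)
        have "Im ?v = 0" using 1 pos[OF d] by simp
        moreover from this have "Re ?v = 0" using 2 pos[OF a] by simp
        ultimately show False using ne[of t] by (simp add: complex_eq_iff)
      qed
    qed (simp_all add: pathstart_def pathfinish_def circlepath_eq)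
    also have "\<dots> = winding_number ?c z"
      by (subst (1 2) winding_number_offset) simp
    also have "\<dots> = 1" using r by (simp add: winding_number_circlepath_centre)
    finally show ?thesis .
  qed
  have "has_planar_index ?M z 1" for z
    unfolding has_planar_index_def using wn by (intro eventually_at_rightI[of 0 1]) auto
  thus ?thesis using h unfolding oriented_homeo_def by blast
qed

section \<open>Oriented coordinates on the torus\<close>

lemma oriented_coordinateD:
  assumes "oriented_coordinate M x U \<phi>"
  shows "openin (top_of_set (points M)) U" "x \<in> U" "\<phi> x = 0" "open (\<phi> ` U)" "continuous_on U \<phi>" "inj_on \<phi> U"
    "continuous_on (\<phi> ` U) (inv_into U \<phi>)"
proof -
  obtain g where g: "homeomorphism U (\<phi> ` U) \<phi> g" using assms unfolding oriented_coordinate_def by blast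
  show "continuous_on U \<phi>" using g homeomorphism_cont1 by blast
  show i: "inj_on \<phi> U" using g by (metis homeomorphism_apply1 inj_onI)
  have "inv_into U \<phi> w = g w" if "w \<in> \<phi> ` U" for w
    using that i g by (metis f_inv_into_f homeomorphism_apply1 inv_into_into)
  thus "continuous_on (\<phi> ` U) (inv_into U \<phi>)" using g homeomorphism_cont2 continuous_on_cong by metis
qed (use assms in \<open>auto simp: oriented_coordinate_def\<close>)

lemma torus_openin_nhd:
  assumes "openin (top_of_set (points T2)) U" "torus_param z \<in> U"
  obtains r where "0 < r" "r \<le> 1/2" "torus_param ` ball z r \<subseteq> U"
proof -
  have "openin (top_of_set UNIV) (UNIV \<inter> torus_param -` U)"
    by (rule continuous_openin_preimage[OF continuous_torus_param _ assms(1)]) (auto simp del: split_paired_All)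
  hence "open (torus_param -` U)" by simp
  then obtain e where e: "e > 0" "ball z e \<subseteq> torus_param -` U" using assms(2) openE by blast
  have "torus_param ` ball z (min e (1/2)) \<subseteq> U" using e by auto
  thus thesis using that[of "min e (1/2)"] e by auto
qed

lemma coordinate_param:
  assumes "oriented_coordinate T2 x U \<phi>" "torus_param z \<in> U"
  shows "isolated_in_fibre (\<phi> \<circ> torus_param) z" "has_planar_index (\<phi> \<circ> torus_param) z 1"
    "\<forall>\<^sub>F w in nhds z. torus_param w \<in> U"
proof -
  note c = oriented_coordinateD[OF assms(1)]
  obtain r where r: "0 < r" "r \<le> 1/2" "torus_param ` ball z r \<subseteq> U" using torus_openin_nhd c(1) assms(2) by metis
  show "isolated_in_fibre (\<phi> \<circ> torus_param) z"
  proof (rule isolated_in_fibre_inj[of "ball z r"])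
    show "continuous_on (ball z r) (\<phi> \<circ> torus_param)"
      by (intro continuous_on_compose continuous_torus_param continuous_on_subset[OF c(5) r(3)])
    show "inj_on (\<phi> \<circ> torus_param) (ball z r)"
      by (intro comp_inj_on torus_param_inj_ball r inj_on_subset[OF c(6) r(3)])
  qed (use r in auto)
  show "has_planar_index (\<phi> \<circ> torus_param) z 1"
    using assms unfolding oriented_coordinate_def params_T2 by blast
  show "\<forall>\<^sub>F w in nhds z. torus_param w \<in> U"
    using r by (intro eventually_nhds_in_open[of "ball z r", THEN eventually_mono]) auto
qed

text \<open>Over a set \<open>B\<close> on which \<open>torus_param\<close> is injective, coordinates of the torus are the same as
injective functions \<open>h\<close> on \<open>B\<close> of index 1; the index condition at the other preimages holds since these
are translates of points of \<open>B\<close>.\<close>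

lemma torus_chart:
  assumes B: "open B" "B \<subseteq> ball c (1/2)" "z \<in> B" and h: "continuous_on B h" "inj_on h B" "h z = 0"
    and ind: "\<And>w. w \<in> B \<Longrightarrow> has_planar_index h w 1"
  obtains \<phi> where "oriented_coordinate T2 (torus_param z) (torus_param ` B) \<phi>"
    "\<And>w. w \<in> B \<Longrightarrow> \<phi> (torus_param w) = h w"
proof -
  obtain g where g: "homeomorphism B (torus_param ` B) torus_param g"
    using torus_param_homeo[OF B(1,2)] by auto
  obtain h' where h': "homeomorphism B (h ` B) h h'"
    using invariance_of_domain_homeomorphism[OF B(1) h(1) _ h(2)] by auto
  let ?f = "h \<circ> g"
  have gp: "g (torus_param w) = w" if "w \<in> B" for w using g that homeomorphism_apply1 by blast
  have im: "?f ` torus_param ` B = h ` B" using gp by (force simp: image_image)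
  show thesis
  proof (rule that[of ?f])
    show "oriented_coordinate T2 (torus_param z) (torus_param ` B) ?f"
      unfolding oriented_coordinate_def params_T2
    proof (intro conjI ballI allI impI)
      show "openin (top_of_set (points T2)) (torus_param ` B)" by (rule torus_param_open_map[OF B(1)])
      show "?f (torus_param z) = 0" using gp[of z] B h by simp
      show "open (?f ` torus_param ` B)" unfolding im using invariance_of_domain[OF h(1) B(1) h(2)] .
      show "\<exists>h'. homeomorphism (torus_param ` B) (?f ` torus_param ` B) ?f h'"
        unfolding im using homeomorphism_compose[OF homeomorphism_symD[OF g] h'] by blast
      fix q w assume "q \<in> {torus_param}" "q w \<in> torus_param ` B"
      then obtain w0 where q: "q = torus_param" "w0 \<in> B" "w - w0 \<in> lat" by (auto simp: torus_param_eq_iff)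
      define v where "v = w - w0"
      have wv: "w - v \<in> B" using q by (simp add: v_def)
      have "has_planar_index (h \<circ> (\<lambda>u. u - v)) w (1 * 1)"
        using wv by (intro has_planar_index_comp isolated_in_fibre_translation has_planar_index_translation
            isolated_in_fibre_inj[OF B(1) _ h(1,2)] ind)
      hence "has_planar_index (h \<circ> (\<lambda>u. u - v)) w 1" by simp
      thus "has_planar_index (?f \<circ> q) w 1"
      proof (rule has_planar_index_cong)
        have "open ((\<lambda>u. u - v) -` B)" by (intro open_vimage continuous_intros B)
        hence "\<forall>\<^sub>F u in nhds w. u \<in> (\<lambda>u. u - v) -` B"
          using wv by (intro eventually_nhds_in_open) auto
        thus "\<forall>\<^sub>F u in nhds w. (h \<circ> (\<lambda>u. u - v)) u = (?f \<circ> q) u"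
        proof (rule eventually_mono)
          fix u assume "u \<in> (\<lambda>u. u - v) -` B"
          hence "g (torus_param (u - v)) = u - v" using gp by blast
          moreover have "torus_param (u - v) = torus_param u"
            using torus_param_add_lat[of v "u - v"] q(3) by (simp add: v_def)
          ultimately show "(h \<circ> (\<lambda>u. u - v)) u = (?f \<circ> q) u" using q by simp
        qed
      qed
    qed (use B in auto)
    show "\<And>w. w \<in> B \<Longrightarrow> ?f (torus_param w) = h w" using gp by simp
  qed
qed

lemma torus_ball_chart:
  assumes r: "0 < r" "r \<le> 1/2"
  obtains \<phi> where "oriented_coordinate T2 (torus_param z) (torus_param ` ball z r) \<phi>"
    "\<And>w. w \<in> ball z r \<Longrightarrow> \<phi> (torus_param w) = w - z"
proof (rule torus_chart[of "ball z r" z z "\<lambda>w. w - z"])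
  show "ball z r \<subseteq> ball z (1/2)" using r by auto
qed (use r that has_planar_index_translation in \<open>auto intro!: continuous_intros inj_onI\<close>)

section \<open>Torus endomorphisms and their lifts\<close>

text \<open>The local index may be witnessed by any pair of coordinates. It is nevertheless determined by the lift,
because the coordinates composed with \<open>torus_param\<close> have index 1 and indices are multiplicative.\<close>

lemma has_local_index_imp_planar_index:
  assumes F: "continuous_on (points T2) F" and E: "\<And>w. torus_param (E w) = F (torus_param w)"
    and cE: "isolated_in_fibre E z" and n: "has_local_index T2 T2 F (torus_param z) n"
  shows "has_planar_index E z n"
proof -
  obtain U \<phi> V \<psi> where U: "oriented_coordinate T2 (torus_param z) U \<phi>"
    and V: "oriented_coordinate T2 (F (torus_param z)) V \<psi>" and FU: "F ` U \<subseteq> V"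
    and iso: "\<And>u. u\<in>U \<Longrightarrow> F u = F (torus_param z) \<Longrightarrow> u = torus_param z"
    and ind: "has_planar_index (\<psi> \<circ> F \<circ> inv_into U \<phi>) 0 n"
    using n unfolding has_local_index_def by blast
  note u = oriented_coordinateD[OF U] and v = oriented_coordinateD[OF V]
  let ?k = "\<psi> \<circ> F \<circ> inv_into U \<phi>"
  have inv: "inv_into U \<phi> (\<phi> x) = x" if "x \<in> U" for x using u(6) that by simp
  have ok: "isolated_in_fibre ?k 0"
  proof -
    obtain e where e: "e > 0" "ball 0 e \<subseteq> \<phi> ` U" using u(2-4) openE by (metis image_eqI)
    show ?thesis unfolding isolated_in_fibre_def
    proof (intro exI[of _ e] conjI ballI impI)
      have iU: "inv_into U \<phi> ` \<phi> ` U \<subseteq> U" using inv by auto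
      have "continuous_on (\<phi> ` U) ?k"
        by (intro continuous_on_compose u(7) continuous_on_subset[OF F] continuous_on_subset[OF v(5)])
          (use iU openin_imp_subset[OF u(1)] FU in blast)+
      thus "continuous_on (ball 0 e) ?k" using e continuous_on_subset by blast
      fix w :: complex assume w: "w \<in> ball 0 e" "w \<noteq> 0"
      then obtain x where x: "x \<in> U" "w = \<phi> x" using e by blast
      hence "x \<noteq> torus_param z" using w u(3) by auto
      hence "F x \<noteq> F (torus_param z)" using iso x by blast
      hence "\<psi> (F x) \<noteq> \<psi> (F (torus_param z))" using v(6) FU x u(2) by (auto simp: inj_on_def)
      thus "?k w \<noteq> ?k 0" using x inv u(2,3) by (metis comp_apply)
    qed (use e in auto)
  qed
  have z0: "(\<phi> \<circ> torus_param) z = 0" using u(3) by simp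
  have i1: "has_planar_index (?k \<circ> (\<phi> \<circ> torus_param)) z (n * 1)"
    by (rule has_planar_index_comp) (use ok ind coordinate_param[OF U u(2)] z0 in simp_all)
  obtain m where m: "has_planar_index E z m" using has_planar_index_exists[OF cE] by blast
  have Ez: "torus_param (E z) \<in> V" using E v(2) by simp
  have i2: "has_planar_index ((\<psi> \<circ> torus_param) \<circ> E) z (1 * m)"
    by (rule has_planar_index_comp[OF cE _ m]) (use coordinate_param[OF V Ez] in auto)
  have "has_planar_index ((\<psi> \<circ> torus_param) \<circ> E) z (n * 1)"
    using i1 by (rule has_planar_index_cong)
      (rule eventually_mono[OF coordinate_param(3)[OF U u(2)]], simp add: inv E)
  hence "m = n" using i2 has_planar_index_unique by fastforce
  thus ?thesis using m by simp
qed

lemma continuous_torus_map: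
  assumes F: "\<And>w. torus_param (E w) = F (torus_param w)" and E: "continuous_on UNIV E"
  shows "continuous_on (points T2) F"
proof (rule continuous_on_T2I)
  have "F \<circ> torus_param = torus_param \<circ> E" using F by auto
  thus "continuous_on UNIV (F \<circ> torus_param)"
    using continuous_on_compose[OF E continuous_torus_param] by simp
qed

lemma oriented_homeo_small_ball:
  assumes E: "oriented_homeo E"
  obtains r where "0 < r" "r \<le> 1/2" "E ` ball z r \<subseteq> ball (E z) (1/2)"
proof -
  have "open (E -` ball (E z) (1/2))" by (intro open_vimage oriented_homeoD(1)[OF E]) auto
  then obtain e where e: "e > 0" "ball z e \<subseteq> E -` ball (E z) (1/2)"
    by (metis UNIV_I centre_in_ball half_gt_zero openE vimageI zero_less_one)
  have "E ` ball z (min e (1/2)) \<subseteq> ball (E z) (1/2)" using e by auto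
  thus thesis using that[of "min e (1/2)"] e by auto
qed

lemma has_local_index_of_lift:
  assumes F: "\<And>w. torus_param (E w) = F (torus_param w)" and E: "oriented_homeo E"
  shows "has_local_index T2 T2 F (torus_param z) 1"
proof -
  obtain r where r: "0 < r" "r \<le> 1/2" "E ` ball z r \<subseteq> ball (E z) (1/2)" using oriented_homeo_small_ball[OF E] .
  obtain \<phi> where \<phi>: "oriented_coordinate T2 (torus_param z) (torus_param ` ball z r) \<phi>"
    "\<And>w. w \<in> ball z r \<Longrightarrow> \<phi> (torus_param w) = w - z" using torus_ball_chart[OF r(1,2)] by metis
  obtain \<psi> where \<psi>: "oriented_coordinate T2 (torus_param (E z)) (torus_param ` ball (E z) (1/2)) \<psi>"
    "\<And>w. w \<in> ball (E z) (1/2) \<Longrightarrow> \<psi> (torus_param w) = w - E z" using torus_ball_chart[of "1/2" "E z"] by auto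
  let ?U = "torus_param ` ball z r"
  show ?thesis unfolding has_local_index_def
  proof (intro exI conjI)
    show "oriented_coordinate T2 (torus_param z) ?U \<phi>" by fact
    show "oriented_coordinate T2 (F (torus_param z)) (torus_param ` ball (E z) (1/2)) \<psi>"
      using \<psi>(1) unfolding F .
    show "F ` ?U \<subseteq> torus_param ` ball (E z) (1/2)" using r(3) by (auto simp: F[symmetric] simp del: mem_ball)
    show "\<forall>u\<in>?U. F u = F (torus_param z) \<longrightarrow> u = torus_param z"
    proof (intro ballI impI)
      fix u assume "u \<in> ?U" "F u = F (torus_param z)"
      then obtain w where u: "u = torus_param w" and w: "w \<in> ball z r" "F (torus_param w) = F (torus_param z)" by blast
      hence "torus_param (E w) = torus_param (E z)" by (simp only: F)
      hence "E w = E z" using torus_param_inj_ball[of "1/2" "E z"] r w(1) unfolding inj_on_def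
        by (meson centre_in_ball image_subset_iff order_refl)
      thus "u = torus_param z" using oriented_homeoD(2)[OF E] u by (simp add: inj_eq)
    qed
    let ?E = "(\<lambda>w. w - E z) \<circ> (E \<circ> (\<lambda>w. w - (-z)))"
    have "has_planar_index ?E 0 (1 * (1 * 1))"
      by (intro has_planar_index_comp isolated_in_fibre_comp isolated_in_fibre_translation has_planar_index_translation
        oriented_homeoD(4,5)[OF E])
    moreover have "\<forall>\<^sub>F w in nhds (0::complex). w \<in> ball 0 r" using r by (intro eventually_nhds_in_open) auto
    hence "\<forall>\<^sub>F w in nhds 0. ?E w = (\<psi> \<circ> F \<circ> inv_into ?U \<phi>) w"
    proof (rule eventually_mono)
      fix w :: complex assume "w \<in> ball 0 r"
      hence w: "w + z \<in> ball z r" by (simp add: dist_norm)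
      have "inv_into ?U \<phi> (\<phi> (torus_param (w + z))) = torus_param (w + z)"
        using w oriented_coordinateD(6)[OF \<phi>(1)] by (intro inv_into_f_f) auto
      hence "inv_into ?U \<phi> w = torus_param (w + z)" using \<phi>(2)[OF w] by simp
      moreover have "E (w + z) \<in> ball (E z) (1/2)" using r(3) w by blast
      ultimately show "?E w = (\<psi> \<circ> F \<circ> inv_into ?U \<phi>) w" using \<psi>(2) by (simp add: F[symmetric])
    qed
    ultimately show "has_planar_index (\<psi> \<circ> F \<circ> inv_into ?U \<phi>) 0 1"
      using has_planar_index_cong by fastforce
  qed
qed

lemma torus_endomorphism_of_lift:
  assumes F: "\<And>w. torus_param (E w) = F (torus_param w)" and E: "oriented_homeo E"
  shows "torus_endomorphism F"
  unfolding torus_endomorphism_def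
proof (intro conjI ballI)
  show "F ` points T2 \<subseteq> points T2"
    unfolding range_torus_param[symmetric] by (auto simp: F[symmetric] simp del: split_paired_All)
  fix x assume "x \<in> points T2"
  then obtain z where z: "x = torus_param z" using torus_param_surj by blast
  show "has_local_index T2 T2 F x 1" unfolding z by (rule has_local_index_of_lift[OF F E])
  obtain r where r: "0 < r" "r \<le> 1/2" "E ` ball z r \<subseteq> ball (E z) (1/2)" using oriented_homeo_small_ball[OF E] .
  obtain G where G: "homeomorphism UNIV UNIV E G" using E unfolding oriented_homeo_def by blast
  have oE: "open (E ` ball z r)" using homeomorphism_imp_open_map[OF G, of "ball z r"] by simp
  have "ball z r \<subseteq> ball z (1/2)" using r by auto
  then obtain g where g: "homeomorphism (ball z r) (torus_param ` ball z r) torus_param g"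
    using torus_param_homeo[of "ball z r" z] by auto
  obtain g' where g': "homeomorphism (E ` ball z r) (torus_param ` E ` ball z r) torus_param g'"
    using torus_param_homeo[OF oE r(3)] by auto
  have E': "homeomorphism (ball z r) (E ` ball z r) E G" using homeomorphism_of_subsets[OF G] by blast
  have FU: "F ` torus_param ` ball z r = torus_param ` E ` ball z r" by (simp add: image_image F)
  have h: "homeomorphism (torus_param ` ball z r) (torus_param ` E ` ball z r) (torus_param \<circ> (E \<circ> g)) (torus_param \<circ> G \<circ> g')"
    using homeomorphism_compose[OF homeomorphism_compose[OF homeomorphism_symD[OF g] E'] g'] .
  have "homeomorphism (torus_param ` ball z r) (torus_param ` E ` ball z r) F (torus_param \<circ> G \<circ> g')"
    by (rule homeomorphism_cong[OF h refl refl]) (use homeomorphism_apply1[OF g] F in auto)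
  thus "\<exists>U. openin (top_of_set (points T2)) U \<and> x \<in> U \<and> openin (top_of_set (points T2)) (F ` U) \<and>
             (\<exists>g. homeomorphism U (F ` U) F g)"
    using FU torus_param_open_map oE r z
    by (intro exI[of _ "torus_param ` ball z r"] conjI) auto
qed

lemma local_index_of_lift:
  assumes F: "\<And>w. torus_param (E w) = F (torus_param w)" and E: "oriented_homeo E" and x: "x \<in> points T2"
  shows "local_index T2 T2 F x = 1"
proof -
  obtain z where z: "x = torus_param z" using x torus_param_surj by blast
  show ?thesis unfolding local_index_def z
  proof (rule the_equality)
    show "has_local_index T2 T2 F (torus_param z) 1" by (rule has_local_index_of_lift[OF F E])
    fix n assume "has_local_index T2 T2 F (torus_param z) n"
    hence "has_planar_index E z n"
      using has_local_index_imp_planar_index[OF continuous_torus_map[of E F] F] F oriented_homeoD[OF E] by blast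
    thus "n = 1" using oriented_homeoD(4)[OF E] has_planar_index_unique by blast
  qed
qed

text \<open>As functions of \<open>u\<close>, both sides lift \<open>F \<circ> torus_param\<close>, and they agree at 0.\<close>

lemma lift_add_lat:
  assumes F: "\<And>w. torus_param (E w) = F (torus_param w)" and E: "continuous_on UNIV E" and v: "v \<in> lat"
  shows "E (u + v) = E u + (E v - E 0)" "E v - E 0 \<in> lat"
proof -
  have "torus_param (E v) = torus_param (E 0)" using torus_param_add_lat[OF v, of 0] by (simp add: F)
  thus L: "E v - E 0 \<in> lat" by (simp add: torus_param_eq_iff)
  show "E (u + v) = E u + (E v - E 0)"
  proof (rule covering_space_lift_unique[OF covering_torus_param, of "\<lambda>u. E (u + v)" 0 "\<lambda>u. E u + (E v - E 0)" UNIV "\<lambda>u. F (torus_param u)"])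
    have "continuous_on UNIV (torus_param \<circ> E)" by (intro continuous_on_compose E continuous_torus_param)
    thus "continuous_on UNIV (\<lambda>u. F (torus_param u))" by (simp add: F o_def)
    show "(\<lambda>u. F (torus_param u)) \<in> UNIV \<rightarrow> points T2" by (auto simp: F[symmetric] simp del: split_paired_All)
    show "continuous_on UNIV (\<lambda>u. E (u + v))" "continuous_on UNIV (\<lambda>u. E u + (E v - E 0))"
      by (intro continuous_on_compose2[OF E] continuous_intros E; simp)+
    show "F (torus_param x) = torus_param (E (x + v))" for x by (simp add: F torus_param_add_lat v)
    show "F (torus_param x) = torus_param (E x + (E v - E 0))" for x
      using L by (simp add: torus_param_add_lat F[symmetric])
  qed auto
qed

text \<open>Lift \<open>F \<circ> p\<close> through \<open>p\<close> to get \<open>E\<close>. Conversely lift \<open>p\<close> first through the covering \<open>F\<close> and then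
through \<open>p\<close> to get \<open>G\<close>. With matching base points, uniqueness of lifts shows that \<open>E\<close> and \<open>G\<close> are
inverse to each other.\<close>

lemma torus_endomorphism_lift:
  assumes "torus_endomorphism F"
  obtains E where "oriented_homeo E" "\<And>w. torus_param (E w) = F (torus_param w)"
proof -
  let ?T = "points T2"
  have covF: "covering_space ?T F ?T"
    using assms unfolding torus_endomorphism_def
    by (intro compact_local_homeo_covering compact_T2 connected_T2) (auto simp: range_torus_param[symmetric])
  have cF: "continuous_on ?T F" and FT: "F \<in> ?T \<rightarrow> ?T"
    using covering_space_imp_continuous[OF covF] covering_space_imp_surjective[OF covF] by auto
  have sc: "simply_connected (UNIV :: complex set)" "locally path_connected (UNIV :: complex set)"
    by (simp_all add: convex_imp_simply_connected convex_imp_locally_path_connected)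
  have cFp: "continuous_on UNIV (\<lambda>z. F (torus_param z))"
    by (intro continuous_on_compose2[OF cF] continuous_torus_param) (auto simp del: split_paired_All)
  have Fp: "(\<lambda>z. F (torus_param z)) \<in> UNIV \<rightarrow> ?T" using FT by auto
  obtain E where E: "continuous_on UNIV E" "\<And>z. torus_param (E z) = F (torus_param z)"
    using covering_space_lift[OF covering_torus_param sc cFp Fp] by auto
  obtain q where q: "continuous_on UNIV q" "q \<in> UNIV \<rightarrow> ?T" "q (E 0) = torus_param 0" "\<And>z. F (q z) = torus_param z"
    using covering_space_lift_strong[OF covF torus_param_in UNIV_I sc continuous_torus_param, of "E 0" 0] E(2) by auto
  obtain G where G: "continuous_on UNIV G" "G (E 0) = 0" "\<And>z. torus_param (G z) = q z"
    using covering_space_lift_strong[OF covering_torus_param UNIV_I UNIV_I sc q(1,2), of "E 0" 0] q(3) by auto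
  have EG: "E (G z) = z" for z
    by (rule covering_space_lift_unique[OF covering_torus_param, of "\<lambda>z. E (G z)" "E 0" "\<lambda>z. z" UNIV torus_param])
      (auto intro!: continuous_on_compose2[OF E(1)] G continuous_torus_param simp: G E q)
  have qT: "q z \<in> ?T" for z using q(2) by blast
  have qE: "q (E z) = torus_param z" for z
    by (rule covering_space_lift_unique[OF covF, of "\<lambda>z. q (E z)" 0 torus_param UNIV "\<lambda>z. F (torus_param z)"])
      (use q in \<open>auto intro!: continuous_on_compose2[OF q(1)] E continuous_torus_param cFp Fp simp: E q qT simp del: split_paired_All\<close>)
  have GE: "G (E z) = z" for z
    by (rule covering_space_lift_unique[OF covering_torus_param, of "\<lambda>z. G (E z)" 0 "\<lambda>z. z" UNIV torus_param])
      (auto intro!: continuous_on_compose2[OF G(1)] E continuous_torus_param simp: G qE)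
  have hom: "homeomorphism UNIV UNIV E G"
    by (intro homeomorphismI E G) (auto simp: EG GE)
  have "has_planar_index E z 1" for z
  proof (rule has_local_index_imp_planar_index[OF cF E(2)])
    have "inj E" using GE by (metis injI)
    thus "isolated_in_fibre E z" using isolated_in_fibre_inj[of UNIV z E] E by simp
    show "has_local_index T2 T2 F (torus_param z) 1" using assms unfolding torus_endomorphism_def by simp
  qed
  thus thesis using hom E that unfolding oriented_homeo_def by blast
qed

lemma finite_torus_fibre:
  assumes F: "\<And>w. torus_param (E w) = F (torus_param w)" and E: "oriented_homeo E"
  shows "finite {x \<in> points T2. F x = y}"
proof (rule finite_fibre[OF compact_T2 continuous_torus_map[OF F oriented_homeoD(1)[OF E]]])
  fix x assume "x \<in> points T2"
  then obtain z where z: "x = torus_param z" using torus_param_surj by blast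
  show "\<exists>U. openin (top_of_set (points T2)) U \<and> x \<in> U \<and> (\<forall>u\<in>U. F u = F x \<longrightarrow> u = x)"
    using has_local_index_of_lift[OF F E, of z] oriented_coordinateD(1,2) unfolding has_local_index_def z by meson
qed

text \<open>All local indices are 1, so the degree is the number of points in a fibre. This number is the same for
all fibres, because the translations of the plane, conjugated by \<open>E\<close>, descend to self-maps of the torus
that move one fibre injectively into another. A lattice vector \<open>w\<close> outside the image of the linear part
\<open>v \<mapsto> E v - E 0\<close> yields two distinct points in one fibre.\<close>

lemma topological_degree_ge_2:
  assumes F: "\<And>w. torus_param (E w) = F (torus_param w)" and E: "oriented_homeo E"
    and w: "w \<in> lat" "\<And>v. v \<in> lat \<Longrightarrow> E v \<noteq> E 0 + w"
  shows "topological_degree T2 T2 F \<ge> 2"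
proof -
  let ?fib = "\<lambda>y. {x \<in> points T2. F x = y}"
  obtain G where G: "homeomorphism UNIV UNIV E G" using E unfolding oriented_homeo_def by blast
  have EG: "E (G z) = z" and GE: "G (E z) = z" for z using G by (auto simp: homeomorphism_apply1 homeomorphism_apply2)
  note cE = oriented_homeoD(1)[OF E]
  have le: "card (?fib y) \<le> card (?fib y')" if y: "y \<in> points T2" "y' \<in> points T2" for y y'
  proof -
    obtain b b' where b: "y = torus_param b" "y' = torus_param b'" using y torus_param_surj by metis
    \<comment> \<open>The translation by \<open>b' - b\<close>, conjugated by \<open>E\<close>, and the map \<open>t\<close> that it induces on the torus.\<close>
    define s where "s z = G (E z + (b' - b))" for z
    define t where "t x = torus_param (s (SOME z. torus_param z = x))" for x
    have t: "t (torus_param z) = torus_param (s z) \<and> F (t (torus_param z)) = torus_param (E z + (b' - b))" for z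
    proof -
      define z' where "z' = (SOME z'. torus_param z' = torus_param z)"
      have "torus_param z' = torus_param z" unfolding z'_def by (rule someI) simp
      hence v: "z' - z \<in> lat" by (simp add: torus_param_eq_iff)
      let ?v = "z' - z"
      have "E z' = E z + (E ?v - E 0)" using lift_add_lat(1)[OF F cE v, of z] by simp
      moreover have "E (s z + ?v) = E (s z) + (E ?v - E 0)" using lift_add_lat(1)[OF F cE v] .
      ultimately have "E (s z + ?v) = E (s z')" by (simp add: s_def EG)
      hence "s z' = s z + ?v" using oriented_homeoD(2)[OF E] by (simp add: inj_eq)
      hence "torus_param (s z') = torus_param (s z)" using torus_param_add_lat v by simp
      thus ?thesis unfolding t_def z'_def[symmetric] by (simp add: F[symmetric] s_def EG)
    qed
    show ?thesis
    proof (rule card_inj_on_le[where f=t])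
      show "finite (?fib y')" by (rule finite_torus_fibre[OF F E])
      show "t ` ?fib y \<subseteq> ?fib y'"
      proof (rule image_subsetI)
        fix x assume x: "x \<in> ?fib y"
        then obtain z where z: "x = torus_param z" using torus_param_surj by blast
        have "E z - b \<in> lat" using x b z by (simp add: F[symmetric] torus_param_eq_iff[symmetric])
        hence "torus_param (b' + (E z - b)) = y'" using torus_param_add_lat b(2) by simp
        moreover have "b' + (E z - b) = E z + (b' - b)" by simp
        ultimately have "F (t (torus_param z)) = y'" using t[of z] by metis
        thus "t x \<in> ?fib y'" using t[of z] z by simp
      qed
      show "inj_on t (?fib y)"
      proof (rule inj_onI)
        fix x x' assume x: "x \<in> ?fib y" "x' \<in> ?fib y" "t x = t x'"
        then obtain z z' where z: "x = torus_param z" "x' = torus_param z'" using torus_param_surj by blast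
        have v: "s z' - s z \<in> lat" using x t[of z] t[of z'] z by (simp add: torus_param_eq_iff[symmetric])
        let ?v = "s z' - s z"
        have "E (s z + ?v) = E (s z) + (E ?v - E 0)" "E (z + ?v) = E z + (E ?v - E 0)"
          using lift_add_lat(1)[OF F cE v] by blast+
        hence "E (s z') = E (z + ?v) + (b' - b)" by (simp add: s_def EG)
        hence "E z' = E (z + ?v)" by (simp add: s_def EG)
        hence "z' = z + ?v" using oriented_homeoD(2)[OF E] by (simp add: inj_eq)
        thus "x = x'" using z torus_param_add_lat[OF v, of z] by simp
      qed
    qed
  qed
  define y0 where "y0 = F (torus_param 0)"
  have y0: "y0 \<in> points T2" by (simp add: y0_def F[symmetric])
  have sum: "(\<Sum>x\<in>?fib y. local_index T2 T2 F x) = int (card (?fib y0))" if "y \<in> points T2" for y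
  proof -
    have "card (?fib y) = card (?fib y0)" using le y0 that by (simp add: order_antisym)
    thus ?thesis using local_index_of_lift[OF F E] by simp
  qed
  have "topological_degree T2 T2 F = int (card (?fib y0))"
    unfolding topological_degree_def
  proof (rule the_equality)
    show "\<forall>y\<in>points T2. finite (?fib y) \<longrightarrow> (\<Sum>x\<in>?fib y. local_index T2 T2 F x) = int (card (?fib y0))"
      using sum by blast
    fix d assume d: "\<forall>y\<in>points T2. finite (?fib y) \<longrightarrow> (\<Sum>x\<in>?fib y. local_index T2 T2 F x) = d"
    have "(\<Sum>x\<in>?fib y0. local_index T2 T2 F x) = d"
      using bspec[OF d y0] finite_torus_fibre[OF F E] by (rule mp)
    thus "d = int (card (?fib y0))" unfolding sum[OF y0] by (rule sym)
  qed
  moreover have "card (?fib y0) \<ge> 2"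
  proof -
    let ?a = "torus_param 0" and ?b = "torus_param (G (E 0 + w))"
    have "?a \<noteq> ?b"
    proof
      assume "?a = ?b"
      hence "G (E 0 + w) \<in> lat" using torus_param_eq_iff[of "G (E 0 + w)" 0] by simp
      thus False using w(2) EG by blast
    qed
    moreover have "F ?b = y0" using torus_param_add_lat[OF w(1), of "E 0"] by (simp add: F[symmetric] EG y0_def)
    ultimately have "{?a, ?b} \<subseteq> ?fib y0" "card {?a, ?b} = 2" by (auto simp: y0_def)
    thus ?thesis using card_mono[OF finite_torus_fibre[OF F E], of "{?a, ?b}" y0] by simp
  qed
  ultimately show ?thesis by simp
qed

section \<open>Semiconjugacies between power maps\<close>

lemma power_ball: assumes "(\<zeta>::complex) \<in> ball 0 e" "a \<ge> 1" shows "\<zeta> ^ a \<in> ball 0 (e ^ a)"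
  using assms by (simp add: norm_power power_strict_mono)

lemma power_ball_surj:
  assumes "w \<in> ball 0 (e ^ a)" "a \<ge> 1" "e > 0"
  obtains \<zeta> :: complex where "\<zeta> \<in> ball 0 e" "\<zeta> ^ a = w"
proof -
  have "\<exists>\<zeta>. \<zeta> ^ a = w"
  proof (cases "w = 0")
    case False
    have "card {z. z ^ a = w} = a" using assms by (intro card_nth_roots False) auto
    thus ?thesis using assms(2) by (metis (mono_tags, lifting) card.empty empty_Collect_eq not_one_le_zero)
  qed (use assms in \<open>auto intro!: exI[of _ 0]\<close>)
  then obtain \<zeta> where \<zeta>: "\<zeta> ^ a = w" ..
  have "norm \<zeta> ^ a < e ^ a" using assms \<zeta> by (auto simp: norm_power)
  hence "\<zeta> \<in> ball 0 e" using assms(3) power_less_imp_less_base[of "norm \<zeta>" a e] by simp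
  thus thesis using that \<zeta> by blast
qed

lemma root_of_unity_quotient:
  assumes "\<zeta> ^ a = \<zeta>' ^ a" "\<zeta> \<noteq> 0" obtains \<rho> :: complex where "\<rho> ^ a = 1" "\<zeta>' = \<rho> * \<zeta>"
proof (rule that[of "\<zeta>' / \<zeta>"])
  have "\<zeta> ^ a \<noteq> 0" using assms(2) by simp
  thus "(\<zeta>' / \<zeta>) ^ a = 1" unfolding power_divide assms(1)[symmetric] by simp
qed (use assms in simp)

lemma norm_root_of_unity: assumes "\<rho> ^ a = (1::complex)" "a \<ge> 1" shows "norm \<rho> = 1"
proof -
  have "norm \<rho> ^ a = 1 ^ a" using assms by (simp flip: norm_power)
  thus ?thesis using assms power_eq_imp_eq_base[of "norm \<rho>" a 1] by simp
qed

text \<open>The quotient \<open>k (\<rho> \<zeta>) / k (\<zeta>)\<close> is a \<open>b\<close>-th root of unity that depends continuously on \<open>\<zeta>\<close>, so it is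
constant on the punctured disc.\<close>

lemma rotation_equivariance:
  fixes k :: "complex \<Rightarrow> complex"
  assumes e: "e > 0" and k: "continuous_on (ball 0 e) k" "inj_on k (ball 0 e)" "k 0 = 0"
    and a: "a \<ge> 1" and b: "b \<ge> 1" and \<rho>: "\<rho> ^ a = 1"
    and fib: "\<And>\<zeta> \<zeta>'. \<zeta> \<in> ball 0 e \<Longrightarrow> \<zeta>' \<in> ball 0 e \<Longrightarrow> \<zeta> ^ a = \<zeta>' ^ a \<Longrightarrow> k \<zeta> ^ b = k \<zeta>' ^ b"
  obtains m where "m ^ b = 1" "\<And>\<zeta>. \<zeta> \<in> ball 0 e \<Longrightarrow> k (\<rho> * \<zeta>) = m * k \<zeta>"
proof -
  let ?P = "ball 0 e - {0::complex}"
  have nr: "norm \<rho> = 1" using norm_root_of_unity[OF \<rho> a] .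
  have k0: "k \<zeta> \<noteq> 0" if "\<zeta> \<in> ?P" for \<zeta>
    using that k(2,3) e by (metis DiffD1 DiffD2 centre_in_ball inj_on_eq_iff singletonI)
  have rot: "\<rho> * \<zeta> \<in> ball 0 e" if "\<zeta> \<in> ball 0 e" for \<zeta> using that nr by (simp add: norm_mult)
  let ?m = "\<lambda>\<zeta>. k (\<rho> * \<zeta>) / k \<zeta>"
  have mb: "?m \<zeta> ^ b = 1" if "\<zeta> \<in> ?P" for \<zeta>
  proof -
    have "k (\<rho> * \<zeta>) ^ b = k \<zeta> ^ b" using that rot by (intro fib) (auto simp: power_mult_distrib \<rho>)
    thus ?thesis using k0[OF that] by (simp add: power_divide)
  qed
  have "?m constant_on ?P"
  proof (rule continuous_finite_range_constant)
    show "connected ?P" by (rule connected_punctured_ball) simp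
    show "continuous_on ?P ?m"
      by (intro continuous_intros continuous_on_compose2[OF k(1)] continuous_on_subset[OF k(1)]) (use k0 rot in auto)
    have "?m ` ?P \<subseteq> {z. z ^ b = 1}" using mb by blast
    moreover have "finite {z::complex. z ^ b = 1}" using b by (intro finite_roots_unity) auto
    ultimately show "finite (?m ` ?P)" using finite_subset by blast
  qed
  then obtain m where m: "\<And>\<zeta>. \<zeta> \<in> ?P \<Longrightarrow> ?m \<zeta> = m" unfolding constant_on_def by blast
  have p: "of_real (e/2) \<in> ?P" using e by simp
  show thesis
  proof (rule that[of m])
    show "m ^ b = 1" using mb[OF p] m[OF p] by simp
    fix \<zeta> :: complex assume \<zeta>: "\<zeta> \<in> ball 0 e"
    show "k (\<rho> * \<zeta>) = m * k \<zeta>"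
    proof (cases "\<zeta> = 0")
      case False
      hence "\<zeta> \<in> ?P" using \<zeta> by simp
      from m[OF this] k0[OF this] show ?thesis by (simp add: field_simps)
    qed (simp add: k)
  qed
qed

text \<open>By \<open>rotation_equivariance\<close> there is a map \<open>m\<close> of the group \<open>R\<close> of \<open>a\<close>-th roots of unity with
\<open>k (\<rho> \<zeta>) = m \<rho> k (\<zeta>)\<close>. Iterating a rotation shows that \<open>m\<close> takes values in \<open>R\<close>, and injectivity of \<open>k\<close>
makes \<open>m\<close> injective; hence \<open>m\<close> permutes the finite set \<open>R\<close>. Since the values of \<open>m\<close> are also
\<open>b\<close>-th roots of unity, \<open>a\<close> divides \<open>b\<close>. Moreover \<open>k (\<zeta>)\<^sup>a\<close> and \<open>k (\<zeta>')\<^sup>a\<close> agree if and only if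
\<open>\<zeta>\<^sup>a\<close> and \<open>\<zeta>'\<^sup>a\<close> do, so \<open>h\<close> is well defined and injective.\<close>

lemma power_semiconjugacy:
  fixes k :: "complex \<Rightarrow> complex"
  assumes e: "e > 0" and k: "continuous_on (ball 0 e) k" "inj_on k (ball 0 e)" "k 0 = 0"
    and a: "a \<ge> 1" and b: "b \<ge> 1"
    and fib: "\<And>\<zeta> \<zeta>'. \<zeta> \<in> ball 0 e \<Longrightarrow> \<zeta>' \<in> ball 0 e \<Longrightarrow> \<zeta> ^ a = \<zeta>' ^ a \<Longrightarrow> k \<zeta> ^ b = k \<zeta>' ^ b"
  obtains h d where "d \<ge> 1" "b = a * d" "continuous_on (ball 0 (e ^ a)) h" "inj_on h (ball 0 (e ^ a))"
    "\<And>\<zeta>. \<zeta> \<in> ball 0 e \<Longrightarrow> h (\<zeta> ^ a) = k \<zeta> ^ a"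
proof -
  let ?B = "ball 0 e :: complex set" and ?R = "{\<rho>::complex. \<rho> ^ a = 1}"
  have "\<exists>m. m ^ b = 1 \<and> (\<forall>\<zeta>\<in>?B. k (\<rho> * \<zeta>) = m * k \<zeta>)" if "\<rho> \<in> ?R" for \<rho>
    using rotation_equivariance[OF e k a b _ fib, of \<rho>] that by (metis mem_Collect_eq)
  then obtain m where m: "\<And>\<rho>. \<rho> \<in> ?R \<Longrightarrow> m \<rho> ^ b = 1" "\<And>\<rho> \<zeta>. \<rho> \<in> ?R \<Longrightarrow> \<zeta> \<in> ?B \<Longrightarrow> k (\<rho> * \<zeta>) = m \<rho> * k \<zeta>"
    by metis
  have nr: "norm \<rho> = 1" if "\<rho> \<in> ?R" for \<rho>
    using that norm_root_of_unity a by blast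
  have rot: "\<rho> * \<zeta> \<in> ?B" if "\<zeta> \<in> ?B" "\<rho> \<in> ?R" for \<zeta> \<rho> using that nr[of \<rho>] by (simp add: norm_mult)
  \<comment> \<open>A base point at which \<open>k\<close> does not vanish.\<close>
  define p where "p = complex_of_real (e/2)"
  have p: "p \<in> ?B" "p \<noteq> 0" using e by (auto simp: p_def)
  have kp: "k p \<noteq> 0" using p k e by (metis centre_in_ball inj_on_eq_iff)
  have mpow: "m \<rho> ^ a = 1" if \<rho>: "\<rho> \<in> ?R" for \<rho>
  proof -
    have "k (\<rho> ^ j * p) = m \<rho> ^ j * k p" for j
    proof (induction j)
      case (Suc j)
      have "\<rho> ^ j \<in> ?R" using \<rho> by (simp add: power_mult[symmetric] mult.commute power_mult)
      hence "\<rho> ^ j * p \<in> ?B" using rot p by blast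
      from m(2)[OF \<rho> this] Suc show ?case by (simp add: mult.assoc)
    qed simp
    from this[of a] show ?thesis using \<rho> kp by simp
  qed
  have minj: "inj_on m ?R"
  proof (rule inj_onI)
    fix \<rho> \<rho>' assume r: "\<rho> \<in> ?R" "\<rho>' \<in> ?R" "m \<rho> = m \<rho>'"
    hence "k (\<rho> * p) = k (\<rho>' * p)" using m(2) p by metis
    hence "\<rho> * p = \<rho>' * p" using k(2) rot p r by (metis inj_onD)
    thus "\<rho> = \<rho>'" using p by simp
  qed
  have fin: "finite ?R" using a by (intro finite_roots_unity) auto
  have msurj: "m ` ?R = ?R"
    by (rule endo_inj_surj[OF fin _ minj]) (use mpow in blast)
  have "a dvd b"
  proof -
    define w :: complex where "w = exp (2 * of_real pi * \<i> * of_nat 1 / of_nat a)"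
    have "w \<in> ?R" using complex_root_unity[of a 1] a by (simp add: w_def)
    hence "w \<in> m ` ?R" unfolding msurj .
    hence "w ^ b = 1" using m(1) by blast
    moreover have "w ^ b = exp (2 * of_real pi * \<i> * of_nat b / of_nat a)"
      unfolding w_def by (subst exp_of_nat_mult[symmetric]) (simp add: ac_simps)
    ultimately show ?thesis using complex_root_unity_eq_1[of a b] a by simp
  qed
  then obtain d where d: "b = a * d" by blast
  have d1: "d \<ge> 1" using d b by (cases d) auto
  define h where "h w = k (SOME \<zeta>. \<zeta> \<in> ?B \<and> \<zeta> ^ a = w) ^ a" for w
  have h: "h (\<zeta> ^ a) = k \<zeta> ^ a" if \<zeta>: "\<zeta> \<in> ?B" for \<zeta>
  proof -
    define \<zeta>' where "\<zeta>' = (SOME \<zeta>'. \<zeta>' \<in> ?B \<and> \<zeta>' ^ a = \<zeta> ^ a)"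
    have z: "\<zeta>' \<in> ?B \<and> \<zeta>' ^ a = \<zeta> ^ a" unfolding \<zeta>'_def by (rule someI[of _ \<zeta>]) (use \<zeta> in simp)
    have "k \<zeta>' ^ a = k \<zeta> ^ a"
    proof (cases "\<zeta> = 0")
      case True
      hence "\<zeta>' = 0" using z a by (simp add: power_0_left)
      thus ?thesis using True by simp
    next
      case False
      obtain \<rho> where \<rho>: "\<rho> ^ a = 1" "\<zeta>' = \<rho> * \<zeta>" using root_of_unity_quotient[of \<zeta> a \<zeta>'] z False by metis
      thus ?thesis using m(2)[of \<rho> \<zeta>] mpow[of \<rho>] \<zeta> by (simp add: power_mult_distrib)
    qed
    thus ?thesis unfolding h_def \<zeta>'_def .
  qed
  have hinj: "inj_on h (ball 0 (e ^ a))"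
  proof (rule inj_onI)
    fix w w' assume w: "w \<in> ball 0 (e ^ a)" "w' \<in> ball 0 (e ^ a)" "h w = h w'"
    obtain \<zeta> where \<zeta>: "\<zeta> \<in> ?B" "\<zeta> ^ a = w" using power_ball_surj[OF w(1) a e] .
    obtain \<zeta>' where \<zeta>': "\<zeta>' \<in> ?B" "\<zeta>' ^ a = w'" using power_ball_surj[OF w(2) a e] .
    have eq: "k \<zeta> ^ a = k \<zeta>' ^ a" using h \<zeta> \<zeta>' w(3) by metis
    show "w = w'"
    proof (cases "k \<zeta> = 0")
      case True
      hence "k \<zeta>' = 0" using eq a by (simp add: power_0_left)
      hence "\<zeta>' = \<zeta>" using True k(2) \<zeta> \<zeta>' by (metis inj_onD)
      thus ?thesis using \<zeta> \<zeta>' by simp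
    next
      case False
      obtain \<rho>' where \<rho>': "\<rho>' ^ a = 1" "k \<zeta>' = \<rho>' * k \<zeta>" using root_of_unity_quotient[OF eq False] .
      then obtain \<rho> where \<rho>: "\<rho> \<in> ?R" "m \<rho> = \<rho>'" using msurj by (metis (mono_tags, lifting) imageE mem_Collect_eq)
      hence "k \<zeta>' = k (\<rho> * \<zeta>)" using m(2)[OF \<rho>(1) \<zeta>(1)] \<rho>' by simp
      hence "\<zeta>' = \<rho> * \<zeta>" using k(2) rot[OF \<zeta>(1) \<rho>(1)] \<zeta>'(1) by (metis inj_onD)
      thus ?thesis using \<zeta> \<zeta>' \<rho> by (simp add: power_mult_distrib)
    qed
  qed
  \<comment> \<open>Preimages under \<open>h\<close> are images under the open map \<open>\<zeta>\<^sup>a\<close> of preimages under \<open>k (\<zeta>)\<^sup>a\<close>.\<close>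
  have hcont: "continuous_on (ball 0 (e ^ a)) h"
  proof (subst continuous_on_open_vimage; (intro allI impI)?)
    fix O' :: "complex set" assume O': "open O'"
    let ?S = "(\<lambda>\<zeta>. k \<zeta> ^ a) -` O' \<inter> ?B"
    have "continuous_on ?B (\<lambda>\<zeta>. k \<zeta> ^ a)" by (intro continuous_intros k)
    hence oS: "open ?S" using O' continuous_on_open_vimage[of ?B] by blast
    have "open ((\<lambda>\<zeta>. \<zeta> ^ a) ` ?S)"
    proof (rule open_mapping_thm[where S=UNIV])
      show "\<not> (\<lambda>\<zeta>::complex. \<zeta> ^ a) constant_on UNIV"
      proof
        assume "(\<lambda>\<zeta>::complex. \<zeta> ^ a) constant_on UNIV"
        hence "(1::complex) ^ a = 0 ^ a" unfolding constant_on_def by (metis UNIV_I)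
        thus False using a by (simp add: power_0_left)
      qed
    qed (auto intro!: holomorphic_intros oS)
    moreover have "h -` O' \<inter> ball 0 (e ^ a) = (\<lambda>\<zeta>. \<zeta> ^ a) ` ?S"
    proof (intro equalityI subsetI)
      fix w assume w: "w \<in> h -` O' \<inter> ball 0 (e ^ a)"
      then obtain \<zeta> where \<zeta>: "\<zeta> \<in> ?B" "\<zeta> ^ a = w" using power_ball_surj[OF _ a e] by blast
      thus "w \<in> (\<lambda>\<zeta>. \<zeta> ^ a) ` ?S" using w h[OF \<zeta>(1)] by auto
    next
      fix w assume "w \<in> (\<lambda>\<zeta>. \<zeta> ^ a) ` ?S"
      then obtain \<zeta> where \<zeta>: "\<zeta> \<in> ?B" "k \<zeta> ^ a \<in> O'" "w = \<zeta> ^ a" by blast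
      thus "w \<in> h -` O' \<inter> ball 0 (e ^ a)" using h[OF \<zeta>(1)] power_ball[OF \<zeta>(1) a] by simp
    qed
    ultimately show "open (h -` O' \<inter> ball 0 (e ^ a))" by simp
  qed simp
  show thesis by (rule that[OF d1 d hcont hinj h])
qed

text \<open>Compare indices in \<open>h (\<zeta>\<^sup>a) = k (\<zeta>)\<^sup>a\<close>: both sides contain the power map, which has the same nonzero
index at \<open>\<zeta>\<close> and at \<open>k \<zeta>\<close> because \<open>k\<close> vanishes only at 0.\<close>

lemma power_semiconjugacy_index:
  fixes k :: "complex \<Rightarrow> complex"
  assumes e: "e > 0" and k: "continuous_on (ball 0 e) k" "inj_on k (ball 0 e)" "k 0 = 0" and a: "a \<ge> 1"
    and ind: "\<And>\<zeta>. \<zeta> \<in> ball 0 e \<Longrightarrow> has_planar_index k \<zeta> 1"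
    and h: "continuous_on (ball 0 (e ^ a)) h" "inj_on h (ball 0 (e ^ a))"
    "\<And>\<zeta>. \<zeta> \<in> ball 0 e \<Longrightarrow> h (\<zeta> ^ a) = k \<zeta> ^ a"
    and w: "w \<in> ball 0 (e ^ a)"
  shows "has_planar_index h w 1"
proof -
  obtain \<zeta> where \<zeta>: "\<zeta> \<in> ball 0 e" "\<zeta> ^ a = w" using power_ball_surj[OF w a e] .
  let ?p = "\<lambda>\<zeta>. \<zeta> ^ a"
  have iso: "isolated_in_fibre h (?p \<zeta>)"
    using isolated_in_fibre_inj[OF _ _ h(1,2)] w \<zeta> by simp
  then obtain n where n: "has_planar_index h (?p \<zeta>) n" using has_planar_index_exists by blast
  define c where "c = (if \<zeta> = 0 then int a else 1)"
  have k0: "k \<zeta> = 0 \<longleftrightarrow> \<zeta> = 0" using k \<zeta>(1) e by (metis centre_in_ball inj_on_eq_iff)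
  have "has_planar_index (h \<circ> ?p) \<zeta> (n * c)"
    unfolding c_def by (intro has_planar_index_comp isolated_in_fibre_power iso n has_planar_index_power a)
  moreover have "has_planar_index (?p \<circ> k) \<zeta> (c * 1)"
  proof -
    have "has_planar_index ?p (k \<zeta>) c" unfolding c_def using has_planar_index_power[OF a, of "k \<zeta>"] k0 by simp
    thus ?thesis using isolated_in_fibre_inj[OF open_ball \<zeta>(1) k(1,2)] ind[OF \<zeta>(1)]
      by (intro has_planar_index_comp isolated_in_fibre_power a)
  qed
  hence "has_planar_index (h \<circ> ?p) \<zeta> (c * 1)"
  proof (rule has_planar_index_cong)
    have "\<forall>\<^sub>F z in nhds \<zeta>. z \<in> ball 0 e" by (intro eventually_nhds_in_open open_ball \<zeta>)
    thus "\<forall>\<^sub>F z in nhds \<zeta>. (?p \<circ> k) z = (h \<circ> ?p) z" by (rule eventually_mono) (simp add: h)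
  qed
  ultimately have "n * c = c * 1" by (rule has_planar_index_unique)
  hence "n = 1" using a by (auto simp: c_def split: if_splits)
  thus ?thesis using n \<zeta> by simp
qed

section \<open>Power forms\<close>

lemma coordinate_image_open:
  assumes "oriented_coordinate M x U \<phi>" "openin (top_of_set (points M)) W" "W \<subseteq> U"
  shows "open (\<phi> ` W)"
proof -
  obtain g where g: "homeomorphism U (\<phi> ` U) \<phi> g" using assms(1) unfolding oriented_coordinate_def by blast
  have "openin (top_of_set U) W"
    using assms(2,3) openin_imp_subset[OF oriented_coordinateD(1)[OF assms(1)]] by (rule openin_subset_trans)
  hence "openin (top_of_set (\<phi> ` U)) (\<phi> ` W)" using homeomorphism_imp_open_map[OF g] by blast
  thus ?thesis using oriented_coordinateD(4)[OF assms(1)] by (rule openin_open_trans)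
qed

lemma coordinate_preimage_open:
  assumes "oriented_coordinate M x U \<phi>" "open B"
  shows "openin (top_of_set (points M)) {u \<in> U. \<phi> u \<in> B}"
proof -
  have "openin (top_of_set U) (U \<inter> \<phi> -` B)"
    using continuous_openin_preimage_gen[OF oriented_coordinateD(5)[OF assms(1)] assms(2)] .
  moreover have "U \<inter> \<phi> -` B = {u \<in> U. \<phi> u \<in> B}" by blast
  ultimately show ?thesis using openin_trans[OF _ oriented_coordinateD(1)[OF assms(1)]] by metis
qed

lemma power_form_isolated:
  assumes "has_power_form M N f x d" "d \<ge> 1"
  obtains U where "openin (top_of_set (points M)) U" "x \<in> U" "\<And>u. u \<in> U \<Longrightarrow> f u = f x \<Longrightarrow> u = x"
    "\<And>u. u \<in> U \<Longrightarrow> u \<noteq> x \<Longrightarrow> \<exists>W. openin (top_of_set (points M)) W \<and> u \<in> W \<and> inj_on f W"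
proof -
  obtain U \<phi> V \<psi> where U: "oriented_coordinate M x U \<phi>" and V: "oriented_coordinate N (f x) V \<psi>"
    and f: "\<And>u. u\<in>U \<Longrightarrow> \<psi> (f u) = \<phi> u ^ d"
    using assms unfolding has_power_form_def by blast
  note u = oriented_coordinateD[OF U] and v = oriented_coordinateD[OF V]
  show thesis
  proof (rule that[OF u(1,2)])
    fix w assume w: "w \<in> U"
    show "w = x" if "f w = f x"
    proof -
      have "\<phi> w ^ d = 0" using f[OF w] that v(3) by simp
      hence "\<phi> w = \<phi> x" using u(3) by simp
      thus ?thesis using u(2,6) w by (metis inj_onD)
    qed
    show "\<exists>W. openin (top_of_set (points M)) W \<and> w \<in> W \<and> inj_on f W" if "w \<noteq> x"
    proof -
      have nz: "\<phi> w \<noteq> 0" using u(2,3,6) w that by (metis inj_onD)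
      obtain r where r: "r > 0" "inj_on (\<lambda>z. z ^ d) (ball (\<phi> w) r)"
        using power_locally_injective[OF nz assms(2)] .
      let ?W = "{x\<in>U. \<phi> x \<in> ball (\<phi> w) r}"
      have "inj_on f ?W"
      proof (rule inj_onI)
        fix x y assume xy: "x \<in> ?W" "y \<in> ?W" "f x = f y"
        hence "\<phi> x ^ d = \<phi> y ^ d" using f by (metis mem_Collect_eq)
        hence "\<phi> x = \<phi> y" using r(2) xy by (auto simp: inj_on_def)
        thus "x = y" using u(6) xy by (auto simp: inj_on_def)
      qed
      thus ?thesis using coordinate_preimage_open[OF U, of "ball (\<phi> w) r"] w r(1) by (intro exI[of _ ?W]) simp
    qed
  qed
qed

text \<open>Branched coverings are open maps: in power coordinates, the image of a disc of radius \<open>e\<close> is the part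
of the target chart that lies in the disc of radius \<open>e\<^sup>d\<close>.\<close>

lemma power_form_open:
  assumes p: "has_power_form M N f x d" and d: "d \<ge> 1" and O': "openin (top_of_set (points M)) O'" "x \<in> O'"
  obtains W where "openin (top_of_set (points N)) W" "f x \<in> W" "W \<subseteq> f ` O'"
proof -
  obtain U \<phi> V \<psi> where U: "oriented_coordinate M x U \<phi>" and V: "oriented_coordinate N (f x) V \<psi>"
    and fU: "f ` U \<subseteq> V" and f: "\<And>u. u\<in>U \<Longrightarrow> \<psi> (f u) = \<phi> u ^ d"
    using p unfolding has_power_form_def by blast
  note u = oriented_coordinateD[OF U] and v = oriented_coordinateD[OF V]
  have "open (\<phi> ` (U \<inter> O'))" using coordinate_image_open[OF U] u(1) O'(1) by (simp add: openin_Int)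
  moreover have "0 \<in> \<phi> ` (U \<inter> O')" using u(2,3) O'(2) by (metis IntI image_eqI)
  ultimately obtain e where e: "e > 0" "ball 0 e \<subseteq> \<phi> ` (U \<inter> O')" using openE by metis
  show thesis
  proof (rule that)
    let ?W = "{y \<in> V. \<psi> y \<in> ball 0 (e ^ d)}"
    show "openin (top_of_set (points N)) ?W" by (rule coordinate_preimage_open[OF V]) simp
    show "f x \<in> ?W" using v(2,3) e by simp
    show "?W \<subseteq> f ` O'"
    proof
      fix y assume y: "y \<in> ?W"
      then obtain \<zeta> where \<zeta>: "\<zeta> \<in> ball 0 e" "\<zeta> ^ d = \<psi> y" using power_ball_surj[OF _ d e(1)] by blast
      obtain w where w: "w \<in> U \<inter> O'" "\<phi> w = \<zeta>" using e(2) \<zeta>(1) by blast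
      have "\<psi> (f w) = \<psi> y" using f w \<zeta> by simp
      hence "f w = y" using v(6) y fU w by (auto simp: inj_on_def)
      thus "y \<in> f ` O'" using w by blast
    qed
  qed
qed

text \<open>The degree is visible in the fibres. For the second power form, a point near \<open>x\<close> has \<open>d'\<close> companions
with the same value of \<open>f\<close>, itself included, all of them in the domain of the first; and the first
admits only \<open>d\<close> points with a given value different from \<open>f x\<close>.\<close>

lemma power_form_degree_le:
  assumes "has_power_form M N f x d" "d \<ge> 1" "has_power_form M N f x d'" "d' \<ge> 1"
  shows "d' \<le> d"
proof -
  obtain U \<phi> V \<psi> where U: "oriented_coordinate M x U \<phi>" and f: "\<And>u. u\<in>U \<Longrightarrow> \<psi> (f u) = \<phi> u ^ d"
    using assms(1) unfolding has_power_form_def by blast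
  obtain U' \<phi>' V' \<psi>' where U': "oriented_coordinate M x U' \<phi>'" and V': "oriented_coordinate N (f x) V' \<psi>'"
    and fU': "f ` U' \<subseteq> V'" and f': "\<And>u. u\<in>U' \<Longrightarrow> \<psi>' (f u) = \<phi>' u ^ d'"
    using assms(3) unfolding has_power_form_def by blast
  note u = oriented_coordinateD[OF U] and u' = oriented_coordinateD[OF U'] and v' = oriented_coordinateD[OF V']
  have "open (\<phi>' ` (U \<inter> U'))" using coordinate_image_open[OF U'] u(1) u'(1) by (simp add: openin_Int)
  moreover have "0 \<in> \<phi>' ` (U \<inter> U')" using u(2) u'(2,3) by (metis IntI image_eqI)
  ultimately obtain e where e: "e > 0" "ball 0 e \<subseteq> \<phi>' ` (U \<inter> U')" using openE by metis
  \<comment> \<open>The \<open>d'\<close>-th roots of \<open>c\<close> lie on the circle of radius \<open>e/2\<close>, inside both charts.\<close>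
  define c where "c = complex_of_real (e/2) ^ d'"
  have c: "c \<noteq> 0" using e by (simp add: c_def)
  let ?R = "{\<zeta>. \<zeta> ^ d' = c}"
  define s where "s = (\<lambda>\<zeta>. SOME t. t \<in> U \<inter> U' \<and> \<phi>' t = \<zeta>)"
  have s: "s \<zeta> \<in> U \<inter> U'" "\<phi>' (s \<zeta>) = \<zeta>" if "\<zeta> \<in> ?R" for \<zeta>
  proof -
    have "norm \<zeta> ^ d' = (e/2) ^ d'" using that e by (metis (mono_tags) c_def mem_Collect_eq norm_power norm_of_real abs_of_pos half_gt_zero)
    hence "norm \<zeta> = e/2" using assms(4) e power_eq_imp_eq_base[of "norm \<zeta>" d' "e/2"] by simp
    hence "\<zeta> \<in> \<phi>' ` (U \<inter> U')" using e by (intro subsetD[OF e(2)]) simp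
    hence "\<exists>t. t \<in> U \<inter> U' \<and> \<phi>' t = \<zeta>" by blast
    hence "s \<zeta> \<in> U \<inter> U' \<and> \<phi>' (s \<zeta>) = \<zeta>" unfolding s_def by (rule someI_ex)
    thus "s \<zeta> \<in> U \<inter> U'" "\<phi>' (s \<zeta>) = \<zeta>" by auto
  qed
  define p where "p = complex_of_real (e/2)"
  have pR: "p \<in> ?R" by (simp add: p_def c_def)
  define c' where "c' = \<phi> (s p) ^ d"
  have "s p \<noteq> x" using s[OF pR] u'(3) e by (auto simp: p_def)
  hence "\<phi> (s p) \<noteq> 0" using u(2,3,6) s(1)[OF pR] by (metis IntD1 inj_onD)
  hence c': "c' \<noteq> 0" by (simp add: c'_def)
  have fs: "\<phi> (s \<zeta>) ^ d = c'" if z: "\<zeta> \<in> ?R" for \<zeta>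
  proof -
    have "\<psi>' (f (s \<zeta>)) = \<psi>' (f (s p))" using f' s[OF z] s[OF pR] z pR by simp
    hence "f (s \<zeta>) = f (s p)" using v'(6) fU' s(1)[OF z] s(1)[OF pR] by (auto simp: inj_on_def)
    thus ?thesis unfolding c'_def using f s(1)[OF z] s(1)[OF pR] by (metis IntD1)
  qed
  have "card ?R \<le> card {\<eta>. \<eta> ^ d = c'}"
  proof (rule card_inj_on_le[where f="\<phi> \<circ> s"])
    show "inj_on (\<phi> \<circ> s) ?R"
    proof (rule inj_onI)
      fix \<zeta> \<zeta>' assume z: "\<zeta> \<in> ?R" "\<zeta>' \<in> ?R" "(\<phi> \<circ> s) \<zeta> = (\<phi> \<circ> s) \<zeta>'"
      hence "s \<zeta> = s \<zeta>'" using u(6) s(1)[OF z(1)] s(1)[OF z(2)] by (auto simp: inj_on_def)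
      thus "\<zeta> = \<zeta>'" using s(2)[OF z(1)] s(2)[OF z(2)] by metis
    qed
    show "(\<phi> \<circ> s) ` ?R \<subseteq> {\<eta>. \<eta> ^ d = c'}" using fs by (intro image_subsetI) simp
    show "finite {\<eta>. \<eta> ^ d = c'}" using assms(2) by (intro finite_nth_roots) simp
  qed
  thus ?thesis using card_nth_roots[OF c, of d'] card_nth_roots[OF c', of d] assms(2,4) by simp
qed

lemma local_degree_eq:
  assumes "has_power_form M N f x d" "d \<ge> 1" shows "local_degree M N f x = d"
  unfolding local_degree_def
proof (rule the_equality)
  fix d' assume d': "d' \<ge> 1 \<and> has_power_form M N f x d'"
  show "d' = d"
    by (rule order_antisym) (use assms d' power_form_degree_le[of M N f x] in blast)+
qed (use assms in blast)

lemma power_form_1_inj: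
  assumes "has_power_form M N f x 1"
  obtains U where "openin (top_of_set (points M)) U" "x \<in> U" "inj_on f U"
proof -
  obtain U \<phi> V \<psi> where U: "oriented_coordinate M x U \<phi>" and f: "\<And>u. u\<in>U \<Longrightarrow> \<psi> (f u) = \<phi> u ^ 1"
    using assms unfolding has_power_form_def by meson
  note u = oriented_coordinateD[OF U]
  have "inj_on f U"
  proof (rule inj_onI)
    fix s t assume st: "s \<in> U" "t \<in> U" "f s = f t"
    hence "\<phi> s = \<phi> t" using f[OF st(1)] f[OF st(2)] by simp
    thus "s = t" using inj_onD[OF u(6)] st(1,2) by blast
  qed
  thus thesis using that u(1,2) by blast
qed

section \<open>Quotients of torus endomorphisms have power forms\<close>

lemma sphere_param_eqs:
  "sphere_param_south z $ 1 = 2 * Re z / (1 + (norm z)\<^sup>2)" "sphere_param_south z $ 2 = 2 * Im z / (1 + (norm z)\<^sup>2)"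
  "sphere_param_south z $ 3 = ((norm z)\<^sup>2 - 1) / (1 + (norm z)\<^sup>2)"
  "sphere_param_north z $ 1 = 2 * Re z / (1 + (norm z)\<^sup>2)" "sphere_param_north z $ 2 = - 2 * Im z / (1 + (norm z)\<^sup>2)"
  "sphere_param_north z $ 3 = (1 - (norm z)\<^sup>2) / (1 + (norm z)\<^sup>2)"
  by (simp_all add: sphere_param_south_def sphere_param_north_def vector_3)

text \<open>The two parametrizations differ only by a sign \<open>\<epsilon>\<close> in the second and third coordinate, which allows a
common treatment.\<close>

lemma S2_params:
  assumes "p \<in> params S2"
  shows "continuous_on UNIV p" "inj p" "p z \<in> points S2"
proof -
  have pos: "1 + (norm z)\<^sup>2 > 0" for z :: complex by (intro add_pos_nonneg) auto
  have p: "p = sphere_param_south \<or> p = sphere_param_north" using assms by (simp add: S2_def)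
  obtain \<epsilon> :: real where eps: "\<epsilon>\<^sup>2 = 1" and
    c: "\<And>z. p z $ 1 = 2 * Re z / (1 + (norm z)\<^sup>2)" "\<And>z. p z $ 2 = \<epsilon> * (2 * Im z / (1 + (norm z)\<^sup>2))"
    "\<And>z. p z $ 3 = \<epsilon> * (((norm z)\<^sup>2 - 1) / (1 + (norm z)\<^sup>2))"
  proof (cases "p = sphere_param_south")
    case True
    show thesis by (rule that[of 1]) (simp_all add: True sphere_param_eqs)
  next
    case False
    hence "p = sphere_param_north" using p by blast
    thus thesis by (intro that[of "-1"]) (simp_all add: sphere_param_eqs diff_divide_distrib)
  qed
  show "continuous_on UNIV p"
  proof -
    have nz: "1 + (norm z)\<^sup>2 \<noteq> 0" for z :: complex using pos[of z] by linarith
    have "continuous_on UNIV (\<lambda>z. p z $ i)" for i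
    proof -
      consider "i = 1" | "i = 2" | "i = 3" using exhaust_3 by blast
      thus ?thesis by cases (simp_all add: c continuous_intros nz)
    qed
    hence "continuous_on UNIV (\<lambda>z. \<chi> i. p z $ i)" by (rule continuous_on_vec_lambda)
    thus ?thesis by (simp add: vec_lambda_eta)
  qed
  show "inj p"
  proof (rule injI)
    fix z w assume eq: "p z = p w"
    have e: "\<epsilon> \<noteq> 0" using eps by auto
    have "\<epsilon> * (((norm z)\<^sup>2 - 1) / (1 + (norm z)\<^sup>2)) = \<epsilon> * (((norm w)\<^sup>2 - 1) / (1 + (norm w)\<^sup>2))"
      using c(3)[of z] c(3)[of w] eq by (simp only:)
    hence "1 - ((norm z)\<^sup>2 - 1) / (1 + (norm z)\<^sup>2) = 1 - ((norm w)\<^sup>2 - 1) / (1 + (norm w)\<^sup>2)"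
      using e by (simp only: mult_cancel_left) simp
    hence "2 / (1 + (norm z)\<^sup>2) = 2 / (1 + (norm w)\<^sup>2)" using pos[of z] pos[of w] by (simp add: field_simps)
    hence n: "1 + (norm z)\<^sup>2 = 1 + (norm w)\<^sup>2" by simp
    have "Re z = Re w" using c(1)[of z] c(1)[of w] eq n pos[of w] by simp
    moreover have "Im z = Im w" using c(2)[of z] c(2)[of w] eq n pos[of w] e by simp
    ultimately show "z = w" by (rule complex_eqI)
  qed
  show "p z \<in> points S2"
  proof -
    define n where "n = (norm z)\<^sup>2"
    have n: "1 + n \<noteq> 0" using pos[of z] by (simp add: n_def)
    have "p z \<bullet> p z = (p z $ 1)\<^sup>2 + (p z $ 2)\<^sup>2 + (p z $ 3)\<^sup>2"
      by (simp add: inner_vec_def sum_3 power2_eq_square)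
    also have "\<dots> = (4 * ((Re z)\<^sup>2 + (Im z)\<^sup>2) + (n - 1)\<^sup>2) / (1 + n)\<^sup>2"
      unfolding c power_mult_distrib eps n_def[symmetric] by (simp add: power_divide add_divide_distrib)
    also have "(Re z)\<^sup>2 + (Im z)\<^sup>2 = n" by (simp add: n_def cmod_def)
    also have "4 * n + (n - 1)\<^sup>2 = (1 + n)\<^sup>2" by (simp add: power2_eq_square algebra_simps)
    finally have "p z \<bullet> p z = 1" using n by simp
    thus ?thesis by (simp add: S2_def norm_eq_1)
  qed
qed

lemma coordinate_S2_param_isolated:
  assumes "oriented_coordinate S2 x U \<phi>" "p \<in> params S2" "p z \<in> U"
  shows "isolated_in_fibre (\<phi> \<circ> p) z"
proof (rule isolated_in_fibre_inj)
  note c = oriented_coordinateD[OF assms(1)] and q = S2_params[OF assms(2)]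
  have "openin (top_of_set UNIV) (UNIV \<inter> p -` U)"
    by (rule continuous_openin_preimage[OF q(1) _ c(1)]) (use q(3) in auto)
  thus "open (p -` U)" by simp
  show "z \<in> p -` U" using assms by simp
  show "continuous_on (p -` U) (\<phi> \<circ> p)"
    by (intro continuous_on_compose continuous_on_subset[OF q(1)] continuous_on_subset[OF c(5)]) auto
  show "inj_on (\<phi> \<circ> p) (p -` U)"
    by (intro comp_inj_on inj_on_subset[OF q(2)] inj_on_subset[OF c(6)]) auto
qed

lemma torus_lift_locally_injective:
  assumes F: "\<And>w. torus_param (E w) = F (torus_param w)" and E: "oriented_homeo E"
  obtains O' where "openin (top_of_set (points T2)) O'" "torus_param z \<in> O'" "inj_on F O'"
proof -
  obtain r where r: "0 < r" "r \<le> 1/2" "E ` ball z r \<subseteq> ball (E z) (1/2)" using oriented_homeo_small_ball[OF E] .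
  show thesis
  proof (rule that[of "torus_param ` ball z r"])
    show "inj_on F (torus_param ` ball z r)"
    proof (rule inj_onI)
      fix x y assume xy: "x \<in> torus_param ` ball z r" "y \<in> torus_param ` ball z r" "F x = F y"
      then obtain u v where uv: "u \<in> ball z r" "v \<in> ball z r" "x = torus_param u" "y = torus_param v" by blast
      hence "torus_param (E u) = torus_param (E v)" using xy F by simp
      moreover have "E u \<in> ball (E z) (1/2)" "E v \<in> ball (E z) (1/2)" using r(3) uv by blast+
      ultimately have "E u = E v" using torus_param_inj_ball[of "1/2" "E z"] by (meson inj_onD order_refl)
      thus "x = y" using uv oriented_homeoD(2)[OF E] by (simp add: inj_eq)
    qed
  qed (use r torus_param_open_map in auto)
qed

text \<open>In coordinates, \<open>F\<close> becomes an injective map \<open>k\<close> of index 1 with \<open>\<psi>' (f (\<psi>\<inverse> (\<zeta>\<^sup>a))) = k (\<zeta>)\<^sup>b\<close>. The map \<open>h\<close> of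
\<open>power_semiconjugacy\<close> satisfies \<open>h (\<zeta>\<^sup>a) = k (\<zeta>)\<^sup>a\<close>, so \<open>h \<circ> \<psi>\<close> is a coordinate at \<open>y\<close> in
which \<open>f\<close> is the power map of exponent \<open>b / a\<close>.\<close>

lemma power_form_of_quotient:
  assumes F: "\<And>w. torus_param (E w) = F (torus_param w)" and E: "oriented_homeo E"
    and \<pi>: "branched_covering T2 S2 \<pi>" and semi: "\<And>x. x \<in> points T2 \<Longrightarrow> \<pi> (F x) = f (\<pi> x)"
    and y: "y \<in> points S2"
  obtains d where "d \<ge> 1" "has_power_form S2 S2 f y d"
proof -
  have cF: "continuous_on (points T2) F" by (rule continuous_torus_map[OF F oriented_homeoD(1)[OF E]])
  have FT: "F \<in> points T2 \<rightarrow> points T2"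
    using torus_endomorphism_of_lift[OF F E] unfolding torus_endomorphism_def by blast
  obtain x where x: "x \<in> points T2" "\<pi> x = y" using \<pi> y unfolding branched_covering_def by (metis imageE)
  obtain z where z: "x = torus_param z" using x torus_param_surj by blast
  have Fx: "F x \<in> points T2" using FT x by blast
  obtain a where a: "a \<ge> 1" "has_power_form T2 S2 \<pi> x a" using \<pi> x unfolding branched_covering_def by blast
  obtain b where b: "b \<ge> 1" "has_power_form T2 S2 \<pi> (F x) b" using \<pi> Fx unfolding branched_covering_def by blast
  obtain U \<phi> V \<psi> where U: "oriented_coordinate T2 x U \<phi>" and V: "oriented_coordinate S2 (\<pi> x) V \<psi>"
    and \<pi>U: "\<pi> ` U \<subseteq> V" and p: "\<And>u. u\<in>U \<Longrightarrow> \<psi> (\<pi> u) = \<phi> u ^ a"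
    using a(2) unfolding has_power_form_def by blast
  obtain U' \<phi>' V' \<psi>' where U': "oriented_coordinate T2 (F x) U' \<phi>'" and V': "oriented_coordinate S2 (\<pi> (F x)) V' \<psi>'"
    and \<pi>U': "\<pi> ` U' \<subseteq> V'" and p': "\<And>u. u\<in>U' \<Longrightarrow> \<psi>' (\<pi> u) = \<phi>' u ^ b"
    using b(2) unfolding has_power_form_def by blast
  note u = oriented_coordinateD[OF U] and v = oriented_coordinateD[OF V]
   and u' = oriented_coordinateD[OF U'] and v' = oriented_coordinateD[OF V']
  have UT: "U \<subseteq> points T2" using u(1) openin_imp_subset by blast
  obtain O' where O': "openin (top_of_set (points T2)) O'" "x \<in> O'" "inj_on F O'"
    using torus_lift_locally_injective[OF F E, of z] z by blast
  \<comment> \<open>A neighbourhood of \<open>x\<close> on which \<open>F\<close> is injective, and which \<open>F\<close> maps into the chart at \<open>F x\<close>.\<close>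
  define W where "W = U \<inter> (O' \<inter> (points T2 \<inter> F -` U'))"
  have oW: "openin (top_of_set (points T2)) W" unfolding W_def
    by (intro openin_Int u(1) O' continuous_openin_preimage[OF cF FT u'(1)])
  have xW: "x \<in> W" using x u(2) u'(2) O' by (simp add: W_def)
  have WU: "W \<subseteq> U" "F ` W \<subseteq> U'" by (auto simp: W_def)
  have injW: "inj_on F W" by (rule inj_on_subset[OF O'(3)]) (auto simp: W_def)
  have "open (\<phi> ` W)" by (rule coordinate_image_open[OF U oW WU(1)])
  moreover have "0 \<in> \<phi> ` W" using xW u(3) by (metis image_eqI)
  ultimately obtain e where e: "e > 0" "ball 0 e \<subseteq> \<phi> ` W" using openE by metis
  define g where "g = inv_into U \<phi>"
  have g\<phi>: "g (\<phi> t) = t" if "t \<in> U" for t unfolding g_def using u(6) that by simp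
  have g: "g \<zeta> \<in> W" "\<phi> (g \<zeta>) = \<zeta>" if \<zeta>: "\<zeta> \<in> ball 0 e" for \<zeta>
  proof -
    obtain t where t: "t \<in> W" "\<zeta> = \<phi> t" using e \<zeta> by blast
    hence "g \<zeta> = t" using g\<phi> WU by blast
    thus "g \<zeta> \<in> W" "\<phi> (g \<zeta>) = \<zeta>" using t by auto
  qed
  define k where "k = \<phi>' \<circ> F \<circ> g"
  have kc: "continuous_on (ball 0 e) k" unfolding k_def
  proof (intro continuous_on_compose)
    show "continuous_on (ball 0 e) g" unfolding g_def
      by (rule continuous_on_subset[OF u(7)]) (use e WU in blast)
    have gW: "g ` ball 0 e \<subseteq> W" using g by blast
    show "continuous_on (g ` ball 0 e) F" by (rule continuous_on_subset[OF cF]) (use gW WU UT in blast)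
    show "continuous_on (F ` g ` ball 0 e) \<phi>'" by (rule continuous_on_subset[OF u'(5)]) (use gW WU in blast)
  qed
  have ki: "inj_on k (ball 0 e)"
  proof (rule inj_onI)
    fix s t assume st: "s \<in> ball 0 e" "t \<in> ball 0 e" "k s = k t"
    have "F (g s) = F (g t)" using st(3) u'(6) WU(2) g(1)[OF st(1)] g(1)[OF st(2)] unfolding k_def by (auto simp: inj_on_def)
    hence "g s = g t" using injW g(1)[OF st(1)] g(1)[OF st(2)] by (auto simp: inj_on_def)
    thus "s = t" using g(2)[OF st(1)] g(2)[OF st(2)] by metis
  qed
  have k0: "k 0 = 0" using g\<phi>[OF u(2)] u(3) u'(3) by (simp add: k_def)
  have kb: "\<psi>' (f (\<pi> (g \<zeta>))) = k \<zeta> ^ b" if \<zeta>: "\<zeta> \<in> ball 0 e" for \<zeta>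
  proof -
    have "g \<zeta> \<in> points T2" using g(1)[OF \<zeta>] WU UT by blast
    hence "f (\<pi> (g \<zeta>)) = \<pi> (F (g \<zeta>))" using semi by simp
    moreover have "F (g \<zeta>) \<in> U'" using g(1)[OF \<zeta>] WU by blast
    ultimately show ?thesis using p' by (simp add: k_def)
  qed
  have \<pi>g: "\<psi> (\<pi> (g \<zeta>)) = \<zeta> ^ a" "\<pi> (g \<zeta>) \<in> V" if \<zeta>: "\<zeta> \<in> ball 0 e" for \<zeta>
  proof -
    have "g \<zeta> \<in> U" using g(1)[OF \<zeta>] WU by blast
    thus "\<psi> (\<pi> (g \<zeta>)) = \<zeta> ^ a" "\<pi> (g \<zeta>) \<in> V" using p[of "g \<zeta>"] g(2)[OF \<zeta>] \<pi>U by auto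
  qed
  have fib: "k \<zeta> ^ b = k \<zeta>' ^ b" if \<zeta>: "\<zeta> \<in> ball 0 e" "\<zeta>' \<in> ball 0 e" "\<zeta> ^ a = \<zeta>' ^ a" for \<zeta> \<zeta>'
  proof -
    have "\<pi> (g \<zeta>) = \<pi> (g \<zeta>')" using \<pi>g[OF \<zeta>(1)] \<pi>g[OF \<zeta>(2)] \<zeta>(3) v(6) by (auto simp: inj_on_def)
    thus ?thesis using kb[OF \<zeta>(1)] kb[OF \<zeta>(2)] by simp
  qed
  have kind: "has_planar_index k \<zeta> 1" if \<zeta>: "\<zeta> \<in> ball 0 e" for \<zeta>
  proof -
    have gU: "g \<zeta> \<in> U" "F (g \<zeta>) \<in> U'" using g(1)[OF \<zeta>] WU by blast+
    then obtain s where s: "g \<zeta> = torus_param s" using torus_param_surj UT by blast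
    have sU: "torus_param s \<in> U" "torus_param (E s) \<in> U'" using gU by (simp_all add: s[symmetric] F)
    have \<zeta>s: "(\<phi> \<circ> torus_param) s = \<zeta>" using g(2)[OF \<zeta>] s by simp
    have iso: "isolated_in_fibre k \<zeta>" by (rule isolated_in_fibre_inj[OF open_ball \<zeta> kc ki])
    then obtain n where n: "has_planar_index k \<zeta> n" using has_planar_index_exists by blast
    have 1: "has_planar_index (k \<circ> (\<phi> \<circ> torus_param)) s (n * 1)"
      by (rule has_planar_index_comp) (use coordinate_param[OF U sU(1)] iso n \<zeta>s in simp_all)
    have "has_planar_index ((\<phi>' \<circ> torus_param) \<circ> E) s (1 * 1)"
      by (rule has_planar_index_comp[OF oriented_homeoD(5)[OF E] _ oriented_homeoD(4)[OF E]])
         (use coordinate_param[OF U' sU(2)] in simp_all)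
    hence "has_planar_index (k \<circ> (\<phi> \<circ> torus_param)) s (1 * 1)"
      by (rule has_planar_index_cong)
         (rule eventually_mono[OF coordinate_param(3)[OF U sU(1)]], simp add: k_def g\<phi> F)
    hence "n = 1" using 1 has_planar_index_unique by fastforce
    thus ?thesis using n by simp
  qed
  obtain h d where h: "d \<ge> 1" "b = a * d" "continuous_on (ball 0 (e ^ a)) h" "inj_on h (ball 0 (e ^ a))"
    "\<And>\<zeta>. \<zeta> \<in> ball 0 e \<Longrightarrow> h (\<zeta> ^ a) = k \<zeta> ^ a"
    using power_semiconjugacy[OF e(1) kc ki k0 a(1) b(1) fib] by blast
  have hind: "has_planar_index h w 1" if "w \<in> ball 0 (e ^ a)" for w
    by (rule power_semiconjugacy_index[OF e(1) kc ki k0 a(1) kind h(3-5) that])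
  \<comment> \<open>The domain of the new coordinate is cut down to the image of the disc of radius \<open>e\<close> under \<open>\<zeta>\<^sup>a\<close>.\<close>
  define B where "B = ball (0::complex) (e ^ a)"
  define V0 where "V0 = {t \<in> V. \<psi> t \<in> B}"
  have oV0: "openin (top_of_set (points S2)) V0" unfolding V0_def B_def by (rule coordinate_preimage_open[OF V open_ball])
  have V0V: "V0 \<subseteq> V" by (auto simp: V0_def)
  have 0: "0 \<in> B" using e by (simp add: B_def)
  have h0: "h 0 = 0" using h(5)[of 0] k0 e a(1) by (simp add: power_0_left)
  have oB: "open (\<psi> ` V0)" by (rule coordinate_image_open[OF V oV0 V0V])
  have VB: "\<psi> ` V0 \<subseteq> B" by (auto simp: V0_def)
  have coord: "oriented_coordinate S2 y V0 (h \<circ> \<psi>)"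
    unfolding oriented_coordinate_def
  proof (intro conjI ballI allI impI)
    show "openin (top_of_set (points S2)) V0" by fact
    show "y \<in> V0" using v(2,3) x 0 by (simp add: V0_def)
    show "(h \<circ> \<psi>) y = 0" using v(3) x h0 by simp
    have hc: "continuous_on (\<psi> ` V0) h" "inj_on h (\<psi> ` V0)"
      using h(3,4) VB unfolding B_def by (blast intro: continuous_on_subset inj_on_subset)+
    show "open ((h \<circ> \<psi>) ` V0)" unfolding image_comp[symmetric] using invariance_of_domain[OF hc(1) oB hc(2)] .
    obtain h' where h': "homeomorphism (\<psi> ` V0) (h ` \<psi> ` V0) h h'"
      using invariance_of_domain_homeomorphism[OF oB hc(1) _ hc(2)] by auto
    obtain g' where "homeomorphism V (\<psi> ` V) \<psi> g'" using V unfolding oriented_coordinate_def by blast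
    hence "homeomorphism V0 (\<psi> ` V0) \<psi> g'" using homeomorphism_of_subsets[OF _ V0V order_refl refl] by blast
    from homeomorphism_compose[OF this h']
    show "\<exists>g. homeomorphism V0 ((h \<circ> \<psi>) ` V0) (h \<circ> \<psi>) g" unfolding image_comp by blast
    fix q s assume q: "q \<in> params S2" "q s \<in> V0"
    have \<psi>q: "(\<psi> \<circ> q) s \<in> B" using q by (simp add: V0_def)
    have "has_planar_index (h \<circ> (\<psi> \<circ> q)) s (1 * 1)"
    proof (rule has_planar_index_comp)
      show "isolated_in_fibre (\<psi> \<circ> q) s" using coordinate_S2_param_isolated[OF V q(1)] q(2) V0V by blast
      show "has_planar_index (\<psi> \<circ> q) s 1" using V q V0V unfolding oriented_coordinate_def by blast
      show "isolated_in_fibre h ((\<psi> \<circ> q) s)" by (rule isolated_in_fibre_inj[OF open_ball _ h(3,4)]) (use \<psi>q B_def in blast)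
      show "has_planar_index h ((\<psi> \<circ> q) s) 1" by (rule hind) (use \<psi>q B_def in blast)
    qed
    thus "has_planar_index (h \<circ> \<psi> \<circ> q) s 1" by (simp add: o_assoc)
  qed
  have V0rep: "\<exists>\<zeta>\<in>ball 0 e. t = \<pi> (g \<zeta>) \<and> \<psi> t = \<zeta> ^ a" if t: "t \<in> V0" for t
  proof -
    obtain \<zeta> where \<zeta>: "\<zeta> \<in> ball 0 e" "\<zeta> ^ a = \<psi> t" using power_ball_surj[OF _ a(1) e(1), of "\<psi> t"] t unfolding V0_def B_def by blast
    hence "\<psi> (\<pi> (g \<zeta>)) = \<psi> t" using \<pi>g by simp
    hence "\<pi> (g \<zeta>) = t" using v(6) \<pi>g(2)[OF \<zeta>(1)] t V0V by (auto simp: inj_on_def)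
    thus ?thesis using \<zeta> by (intro bexI[of _ \<zeta>]) auto
  qed
  have "has_power_form S2 S2 f y d" unfolding has_power_form_def
  proof (intro exI conjI)
    show "oriented_coordinate S2 y V0 (h \<circ> \<psi>)" by (rule coord)
    show "oriented_coordinate S2 (f y) V' \<psi>'" using V' semi[OF x(1)] x(2) by simp
    show "f ` V0 \<subseteq> V'"
    proof (rule image_subsetI)
      fix t assume "t \<in> V0"
      then obtain \<zeta> where \<zeta>: "\<zeta> \<in> ball 0 e" "t = \<pi> (g \<zeta>)" using V0rep by blast
      have "g \<zeta> \<in> points T2" "F (g \<zeta>) \<in> U'" using g(1)[OF \<zeta>(1)] WU UT by blast+
      thus "f t \<in> V'" using semi[of "g \<zeta>"] \<zeta>(2) \<pi>U' by auto
    qed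
    show "\<forall>t\<in>V0. \<psi>' (f t) = (h \<circ> \<psi>) t ^ d"
    proof
      fix t assume "t \<in> V0"
      then obtain \<zeta> where \<zeta>: "\<zeta> \<in> ball 0 e" "t = \<pi> (g \<zeta>)" "\<psi> t = \<zeta> ^ a" using V0rep by blast
      show "\<psi>' (f t) = (h \<circ> \<psi>) t ^ d" using kb[OF \<zeta>(1)] h(5)[OF \<zeta>(1)] \<zeta> by (simp add: h(2) power_mult)
    qed
  qed
  thus thesis using that h(1) by blast
qed

text \<open>The image of a critical point is postcritical, so the exponent at \<open>y\<close> can only be 1.\<close>

lemma locally_injective_off_critical:
  assumes "has_power_form S2 S2 f y d" "d \<ge> 1" "y \<in> points S2" "f y \<notin> postcritical_points f"
  obtains W where "openin (top_of_set (points S2)) W" "y \<in> W" "inj_on f W"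
proof -
  have "y \<notin> critical_points f"
  proof
    assume "y \<in> critical_points f"
    hence "f y \<in> postcritical_points f" unfolding postcritical_points_def by (intro UN_I[of 1]) auto
    thus False using assms by blast
  qed
  hence "d < 2" using assms local_degree_eq[OF assms(1,2)] unfolding critical_points_def by simp
  hence "has_power_form S2 S2 f y 1" using assms(1,2) by (simp add: le_Suc_eq less_2_cases_iff)
  thus thesis using power_form_1_inj that by blast
qed

section \<open>Branched coverings of the sphere by the torus\<close>

text \<open>Since \<open>E\<close> may fail to preserve the lattice, it acts on the torus only locally, on small discs; this is
enough to transport coordinates.\<close>

lemma branched_covering_precompose:
  fixes \<pi> :: "complex \<times> complex \<Rightarrow> 'b::topological_space"
  assumes \<pi>: "branched_covering T2 N \<pi>" and E: "oriented_homeo E"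
    and \<pi>': "\<And>w. \<pi>' (torus_param w) = \<pi> (torus_param (E w))"
  shows "branched_covering T2 N \<pi>'"
  unfolding branched_covering_def
proof (intro conjI ballI)
  have c\<pi>: "continuous_on (points T2) \<pi>" and s\<pi>: "\<pi> ` points T2 = points N" using \<pi> unfolding branched_covering_def by auto
  have "continuous_on UNIV (\<lambda>w. \<pi> (torus_param (E w)))"
    by (intro continuous_on_compose2[OF c\<pi>] continuous_on_compose2[OF continuous_torus_param] oriented_homeoD(1)[OF E])
      (auto simp del: split_paired_All)
  thus "continuous_on (points T2) \<pi>'" by (intro continuous_on_T2I) (simp add: o_def \<pi>')
  have "\<pi>' ` points T2 = range (\<lambda>w. \<pi> (torus_param (E w)))" unfolding range_torus_param[symmetric] by (simp add: image_image \<pi>')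
  also have "\<dots> = \<pi> ` torus_param ` range E" by (simp add: image_image)
  also have "\<dots> = points N" unfolding oriented_homeoD(3)[OF E] range_torus_param s\<pi> ..
  finally show "\<pi>' ` points T2 = points N" .
  fix x assume "x \<in> points T2"
  then obtain z where z: "x = torus_param z" using torus_param_surj by blast
  let ?y = "torus_param (E z)"
  obtain d where d: "d \<ge> 1" "has_power_form T2 N \<pi> ?y d" using \<pi> unfolding branched_covering_def by (meson torus_param_in)
  obtain U \<phi> V \<psi> where U: "oriented_coordinate T2 ?y U \<phi>" and V: "oriented_coordinate N (\<pi> ?y) V \<psi>"
    and \<pi>U: "\<pi> ` U \<subseteq> V" and p: "\<And>u. u\<in>U \<Longrightarrow> \<psi> (\<pi> u) = \<phi> u ^ d"
    using d(2) unfolding has_power_form_def by blast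
  note u = oriented_coordinateD[OF U]
  obtain r where r: "0 < r" "r \<le> 1/2" "torus_param ` ball (E z) r \<subseteq> U" using torus_openin_nhd[OF u(1,2)] .
  define B where "B = ball z (1/2) \<inter> E -` ball (E z) r"
  have B: "open B" "B \<subseteq> ball z (1/2)" "z \<in> B"
    using r by (auto simp: B_def intro!: open_Int open_vimage oriented_homeoD(1)[OF E])
  have EB: "E ` B \<subseteq> ball (E z) r" by (auto simp: B_def)
  have pEB: "torus_param (E w) \<in> U" if "w \<in> B" for w using that r(3) EB by blast
  let ?h = "(\<phi> \<circ> torus_param) \<circ> E"
  have "continuous_on B ?h"
    by (intro continuous_on_compose continuous_on_subset[OF oriented_homeoD(1)[OF E]] continuous_torus_param
         continuous_on_subset[OF u(5)]) (use pEB in auto)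
  moreover have "inj_on ?h B"
    by (intro comp_inj_on inj_on_subset[OF oriented_homeoD(2)[OF E]] inj_on_subset[OF torus_param_inj_ball[OF r(2)] EB]
        inj_on_subset[OF u(6)]) (use pEB in auto)
  moreover have "?h z = 0" using u(3) by simp
  moreover have "has_planar_index ?h w 1" if "w \<in> B" for w
    using has_planar_index_comp[OF oriented_homeoD(5)[OF E] coordinate_param(1)[OF U pEB[OF that]]
       oriented_homeoD(4)[OF E] coordinate_param(2)[OF U pEB[OF that]]] by (simp only: mult_1)
  ultimately obtain \<phi>' where \<phi>': "oriented_coordinate T2 (torus_param z) (torus_param ` B) \<phi>'"
    "\<And>w. w \<in> B \<Longrightarrow> \<phi>' (torus_param w) = ?h w" using torus_chart[OF B] by metis
  have "has_power_form T2 N \<pi>' x d" unfolding has_power_form_def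
  proof (intro exI conjI)
    show "oriented_coordinate T2 x (torus_param ` B) \<phi>'" using \<phi>' z by simp
    show "oriented_coordinate N (\<pi>' x) V \<psi>" using V z \<pi>' by simp
    show "\<pi>' ` torus_param ` B \<subseteq> V" using pEB \<pi>U by (auto simp: \<pi>')
    show "\<forall>u\<in>torus_param ` B. \<psi> (\<pi>' u) = \<phi>' u ^ d" using pEB p \<phi>'(2) by (simp add: \<pi>')
  qed
  thus "\<exists>d\<ge>1. has_power_form T2 N \<pi>' x d" using d by blast
qed

lemma branched_covering_finite_fibre:
  fixes \<pi> :: "complex \<times> complex \<Rightarrow> 'b::metric_space"
  assumes \<pi>: "branched_covering T2 N \<pi>"
  shows "finite {x \<in> points T2. \<pi> x = y}"
proof (rule finite_fibre[OF compact_T2])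
  show "continuous_on (points T2) \<pi>" using \<pi> unfolding branched_covering_def by blast
  fix x assume "x \<in> points T2"
  then obtain d where "d \<ge> 1" "has_power_form T2 N \<pi> x d" using \<pi> unfolding branched_covering_def by blast
  thus "\<exists>U. openin (top_of_set (points T2)) U \<and> x \<in> U \<and> (\<forall>u\<in>U. \<pi> u = \<pi> x \<longrightarrow> u = x)"
    using power_form_isolated by metis
qed

text \<open>In power coordinates, only the centre can fail to be a point of local injectivity.\<close>

lemma branched_covering_critical_sparse:
  assumes \<pi>: "branched_covering T2 N \<pi>"
  shows "{z. \<nexists>W. openin (top_of_set (points T2)) W \<and> torus_param z \<in> W \<and> inj_on \<pi> W} sparse_in UNIV"
    (is "?B sparse_in UNIV")
  unfolding sparse_in_eventually_iff[OF open_UNIV]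
proof
  fix z
  obtain d where "d \<ge> 1" "has_power_form T2 N \<pi> (torus_param z) d" using \<pi> unfolding branched_covering_def by (meson torus_param_in)
  then obtain U where U: "openin (top_of_set (points T2)) U" "torus_param z \<in> U"
    "\<And>u. u \<in> U \<Longrightarrow> u \<noteq> torus_param z \<Longrightarrow> \<exists>W. openin (top_of_set (points T2)) W \<and> u \<in> W \<and> inj_on \<pi> W"
    using power_form_isolated by metis
  obtain r where r: "0 < r" "r \<le> 1/2" "torus_param ` ball z r \<subseteq> U" using torus_openin_nhd[OF U(1,2)] .
  have "\<forall>\<^sub>F w in at z. w \<in> ball z r - {z}"
    using r by (intro eventually_at_in_open) auto
  thus "\<forall>\<^sub>F w in at z. w \<notin> ?B"
  proof (rule eventually_mono)
    fix w assume w: "w \<in> ball z r - {z}"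
    hence "torus_param w \<noteq> torus_param z"
      using torus_param_inj_ball[OF r(2), of z] r(1) by (auto simp: inj_on_def)
    moreover have "torus_param w \<in> U" using w r(3) by blast
    ultimately show "w \<notin> ?B" using U(3) by blast
  qed
qed

section \<open>Periods of the lifted semiconjugacy\<close>

text \<open>A unique continuation principle. The coincidence set is closed. It is open relative to the complement
of \<open>B\<close>, since two continuous functions with values near \<open>\<Phi> z\<close> agree once their images under \<open>f\<close> do and
\<open>f\<close> is injective there. The complement of the sparse set \<open>B\<close> is connected and dense.\<close>

lemma semiconjugate_lifts_eq:
  fixes \<Phi> \<Psi> :: "complex \<Rightarrow> 'b::t2_space"
  assumes c: "continuous_on UNIV \<Phi>" "continuous_on UNIV \<Psi>"
    and N: "range \<Phi> \<subseteq> N" "range \<Psi> \<subseteq> N" and f: "\<And>z. f (\<Phi> z) = f (\<Psi> z)"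
    and B: "B sparse_in UNIV"
    and inj: "\<And>z. z \<notin> B \<Longrightarrow> \<exists>W. openin (top_of_set N) W \<and> \<Phi> z \<in> W \<and> inj_on f W"
    and a: "openin (top_of_set N) W" "\<Phi> a \<in> W" "inj_on f W" "\<Phi> a = \<Psi> a"
  shows "\<Phi> z = \<Psi> z"
proof -
  have loc: "\<forall>\<^sub>F w in nhds b. \<Phi> w = \<Psi> w"
    if W: "openin (top_of_set N) W" "\<Phi> b \<in> W" "inj_on f W" and b: "\<Phi> b = \<Psi> b" for b W
  proof -
    obtain O' where O': "open O'" "W = N \<inter> O'" using W(1) openin_open by metis
    have "\<forall>\<^sub>F w in nhds b. w \<in> \<Phi> -` O' \<inter> \<Psi> -` O'"
      using O' W b by (intro eventually_nhds_in_open open_Int open_vimage c) auto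
    thus ?thesis
    proof (rule eventually_mono)
      fix w assume "w \<in> \<Phi> -` O' \<inter> \<Psi> -` O'"
      hence "\<Phi> w \<in> W" "\<Psi> w \<in> W" using N O'(2) by auto
      thus "\<Phi> w = \<Psi> w" using W(3) f by (meson inj_onD)
    qed
  qed
  have frequently: "\<exists>w. w \<notin> B \<and> P w" if "\<forall>\<^sub>F w in nhds b. P w" for b P
  proof -
    have "\<forall>\<^sub>F w in at b. w \<notin> B" using B sparse_in_eventually_iff[OF open_UNIV] by blast
    moreover have "\<forall>\<^sub>F w in at b. P w" using that unfolding eventually_nhds_conv_at by blast
    ultimately have "\<forall>\<^sub>F w in at b. w \<notin> B \<and> P w" by (rule eventually_conj)
    thus ?thesis using eventually_happens[of _ "at b"] by fastforce
  qed
  let ?S = "- B" and ?A = "{z. \<Phi> z = \<Psi> z}"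
  have conn: "connected ?S" using sparse_imp_connected[OF _ connected_UNIV open_UNIV B] by (simp add: Compl_eq_Diff_UNIV)
  have cl: "closed ?A" using closed_Collect_eq[OF c] .
  have "openin (top_of_set ?S) (?S \<inter> ?A)"
  proof (subst openin_subopen, safe)
    fix b assume b: "b \<notin> B" "\<Phi> b = \<Psi> b"
    have "\<forall>\<^sub>F w in nhds b. \<Phi> w = \<Psi> w" using inj[OF b(1)] loc b(2) by blast
    then obtain T where "open T" "b \<in> T" "\<forall>w\<in>T. \<Phi> w = \<Psi> w" unfolding eventually_nhds by blast
    thus "\<exists>T. openin (top_of_set ?S) T \<and> b \<in> T \<and> T \<subseteq> ?S \<inter> ?A"
      using b by (intro exI[of _ "?S \<inter> T"]) (auto intro: openin_open_Int)
  qed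
  moreover have "closedin (top_of_set ?S) (?S \<inter> ?A)" using cl by (rule closedin_closed_Int)
  moreover have "?S \<inter> ?A \<noteq> {}" using frequently[OF loc[OF a]] by blast
  ultimately have SA: "?S \<inter> ?A = ?S" using conn connected_clopen by blast
  show ?thesis
  proof (rule ccontr)
    assume "\<Phi> z \<noteq> \<Psi> z"
    hence "\<forall>\<^sub>F w in nhds z. w \<in> - ?A" using cl by (intro eventually_nhds_in_open) auto
    from frequently[OF this] SA show False by blast
  qed
qed

section \<open>Sublattices\<close>

text \<open>In terms of the columns of the integral matrix of \<open>L\<close>, with determinant \<open>D\<close>, Cramer's rule expresses
\<open>(D, 0)\<close> and \<open>(0, D)\<close> as images of lattice vectors. If \<open>D\<close> were 0, these lattice vectors would lie in
the kernel, which would force the first column to vanish.\<close>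

lemma sublattice_full_rank:
  assumes add: "\<And>u v. u \<in> lat \<Longrightarrow> v \<in> lat \<Longrightarrow> L (u + v) = L u + L v"
    and lat: "\<And>v. v \<in> lat \<Longrightarrow> L v \<in> lat" and ker: "\<And>v. v \<in> lat \<Longrightarrow> L v = 0 \<Longrightarrow> v = 0"
  obtains D where "D \<in> \<int>" "D > 0" "Complex D 0 \<in> L ` lat" "Complex 0 D \<in> L ` lat"
proof -
  have one: "1 \<in> lat" and i: "\<i> \<in> lat" by (auto simp: lat_def)
  have L0: "L 0 = 0" using add[of 0 0] by simp
  have mult_nat: "of_nat n * v \<in> lat \<and> L (of_nat n * v) = of_nat n * L v" if "v \<in> lat" for n v
  proof (induction n)
    case (Suc n)
    thus ?case using add[OF that, of "of_nat n * v"] lat_add[OF that, of "of_nat n * v"] by (simp add: algebra_simps)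
  qed (simp add: L0)
  have neg: "L (- v) = - L v" if "v \<in> lat" for v
    using add[OF that lat_minus[OF that]] L0 by (simp add: eq_neg_iff_add_eq_0 add.commute)
  have mult: "of_int n * v \<in> lat \<and> L (of_int n * v) = of_int n * L v" if "v \<in> lat" for n v
  proof (cases "n \<ge> 0")
    case True thus ?thesis using mult_nat[OF that, of "nat n"] by simp
  next
    case False
    let ?u = "of_nat (nat (-n)) * v"
    have u: "?u \<in> lat" "L ?u = of_nat (nat (-n)) * L v" using mult_nat[OF that, of "nat (-n)"] by auto
    have "of_int n * v = - ?u" "of_int n * L v = - (of_nat (nat (-n)) * L v)" using False by simp_all
    thus ?thesis using neg[OF u(1)] lat_minus[OF u(1)] u(2) by metis
  qed
  have comb: "of_int m + of_int n * \<i> \<in> lat" "L (of_int m + of_int n * \<i>) = of_int m * L 1 + of_int n * L \<i>" for m n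
    using mult[OF one, of m] mult[OF i, of n] add lat_add by simp_all
  obtain a c where ac: "Re (L 1) = of_int a" "Im (L 1) = of_int c" using lat[OF one] by (auto simp: lat_def elim!: Ints_cases)
  obtain b d where bd: "Re (L \<i>) = of_int b" "Im (L \<i>) = of_int d" using lat[OF i] by (auto simp: lat_def elim!: Ints_cases)
  define D where "D = a * d - b * c"
  have v1: "L (of_int d + of_int (-c) * \<i>) = Complex (of_int D) 0"
    unfolding comb(2) by (simp add: complex_eq_iff ac bd D_def algebra_simps)
  have v2: "L (of_int (-b) + of_int a * \<i>) = Complex 0 (of_int D)"
    unfolding comb(2) by (simp add: complex_eq_iff ac bd D_def algebra_simps)
  have "D \<noteq> 0"
  proof
    assume "D = 0"
    hence "L (of_int d + of_int (-c) * \<i>) = 0" "L (of_int (-b) + of_int a * \<i>) = 0"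
      unfolding v1 v2 by (simp_all add: complex_eq_iff)
    hence "of_int d + of_int (-c) * \<i> = 0" "of_int (-b) + of_int a * \<i> = 0"
      using ker[OF comb(1)] by blast+
    hence "L 1 = 0" using ac by (simp add: complex_eq_iff)
    thus False using ker[OF one] by simp
  qed
  have mem: "Complex (of_int D) 0 \<in> L ` lat" "Complex 0 (of_int D) \<in> L ` lat"
    using v1 v2 comb(1) by (metis image_eqI)+
  have negm: "- u \<in> L ` lat" if "u \<in> L ` lat" for u using that neg lat_minus by force
  show thesis
  proof (cases "D > 0")
    case True
    thus thesis using mem by (intro that[of "of_int D"]) auto
  next
    case False
    have "- Complex (of_int D) 0 = Complex (of_int (-D)) 0" "- Complex 0 (of_int D) = Complex 0 (of_int (-D))"
      by (simp_all add: complex_eq_iff)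
    thus thesis using negm[OF mem(1)] negm[OF mem(2)] False \<open>D \<noteq> 0\<close> by (intro that[of "of_int (-D)"]) simp_all
  qed
qed

text \<open>A basis in Hermite normal form: \<open>d\<close> is the least positive imaginary part in \<open>H\<close>, attained at \<open>b + \<i> d\<close>,
and \<open>a\<close> is the least positive real number in \<open>H\<close>. Division with remainder reduces every element of \<open>H\<close>
to 0.\<close>

lemma sublattice_basis:
  assumes H: "H \<subseteq> lat" "\<And>u v. u \<in> H \<Longrightarrow> v \<in> H \<Longrightarrow> u - v \<in> H"
    and D: "D \<in> \<int>" "D > 0" "Complex D 0 \<in> H" "Complex 0 D \<in> H"
  obtains a b d :: real where "a > 0" "d > 0" "(\<lambda>z. Complex (a * Re z + b * Im z) (d * Im z)) ` lat = H"
proof -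
  have H0: "0 \<in> H" using H(2)[OF D(3) D(3)] by simp
  have Hneg: "- u \<in> H" if "u \<in> H" for u using H(2)[OF H0 that] by simp
  have Hadd: "u + v \<in> H" if "u \<in> H" "v \<in> H" for u v using H(2)[OF that(1) Hneg[OF that(2)]] by simp
  have Hnat: "of_nat n * u \<in> H" if "u \<in> H" for n u
  proof (induction n)
    case (Suc n)
    have "of_nat (Suc n) * u = u + of_nat n * u" by (simp add: algebra_simps)
    thus ?case using Hadd[OF that Suc] by simp
  qed (simp add: H0)
  have Hint: "of_int n * u \<in> H" if "u \<in> H" for n u
    using Hnat[OF that, of "nat n"] Hneg[OF Hnat[OF that, of "nat (-n)"]] by (cases "n \<ge> 0") auto
  obtain m where m: "D = of_int m" using D(1) by (elim Ints_cases)
  hence m': "D = real (nat m)" "nat m > 0" using D(2) by auto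
  let ?P = "\<lambda>n. n > 0 \<and> Complex (real n) 0 \<in> H" and ?Q = "\<lambda>n. n > 0 \<and> (\<exists>x. Complex x (real n) \<in> H)"
  define a where "a = (LEAST n. ?P n)"
  define d where "d = (LEAST n. ?Q n)"
  have a: "?P a" unfolding a_def by (rule LeastI[of _ "nat m"]) (use m' D in simp)
  have d: "?Q d" unfolding d_def by (rule LeastI[of _ "nat m"]) (use m' D in auto)
  then obtain b where b: "Complex b (real d) \<in> H" by blast
  have bint: "b \<in> \<int>" using b H(1) by (auto simp: lat_def)
  let ?M = "\<lambda>z. Complex (real a * Re z + b * Im z) (real d * Im z)"
  have "?M ` lat = H"
  proof (intro equalityI subsetI)
    fix w assume "w \<in> ?M ` lat"
    then obtain z where z: "z \<in> lat" "w = ?M z" by blast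
    obtain x y where xy: "Re z = of_int x" "Im z = of_int y" using z by (auto simp: lat_def elim!: Ints_cases)
    have "w = of_int x * Complex (real a) 0 + of_int y * Complex b (real d)"
      by (simp add: z xy complex_eq_iff)
    thus "w \<in> H" using Hadd Hint a b by simp
  next
    fix w assume w: "w \<in> H"
    then obtain x y where xy: "Re w = of_int x" "Im w = of_int y" using H(1) by (auto simp: lat_def elim!: Ints_cases)
    \<comment> \<open>Subtract multiples of \<open>b + \<i> d\<close> to kill the imaginary part, then multiples of \<open>a\<close> to kill the real part.\<close>
    define n where "n = y div int d"
    define u where "u = w - of_int n * Complex b (real d)"
    have u: "u \<in> H" unfolding u_def by (intro H(2) w Hint b)
    have yn': "y - n * int d = y mod int d" by (simp add: n_def minus_div_mult_eq_mod)
    moreover have "Im u = of_int (y - n * int d)" by (simp add: u_def xy)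
    ultimately have Imu: "Im u = of_int (y mod int d)" by simp
    have "y mod int d = 0"
    proof (rule ccontr)
      assume ne: "y mod int d \<noteq> 0"
      let ?k = "nat (y mod int d)"
      have "y mod int d \<ge> 0" using d by simp
      hence k: "?k > 0" "Im u = real ?k" using ne Imu by auto
      have "Complex (Re u) (real ?k) = u" by (simp add: k(2)[symmetric])
      hence "?Q ?k" using u k(1) by metis
      hence "d \<le> ?k" unfolding d_def by (rule Least_le)
      moreover have "?k < d" using d by (simp add: nat_less_iff)
      ultimately show False by simp
    qed
    hence Imu0: "Im u = 0" and yn: "y = n * int d" using Imu yn' by auto
    obtain x' where x': "Re u = of_int x'" using u H(1) by (auto simp: lat_def elim!: Ints_cases)
    define l where "l = x' div int a"
    define v where "v = u - of_int l * Complex (real a) 0"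
    have v: "v \<in> H" unfolding v_def using a by (intro H(2) u Hint) auto
    have xm: "x' - l * int a = x' mod int a" by (simp add: l_def minus_div_mult_eq_mod)
    moreover have "Re v = of_int (x' - l * int a)" by (simp add: v_def x')
    ultimately have Rev: "Re v = of_int (x' mod int a)" by simp
    have Imv: "Im v = 0" by (simp add: v_def Imu0)
    have "x' mod int a = 0"
    proof (rule ccontr)
      assume ne: "x' mod int a \<noteq> 0"
      let ?k = "nat (x' mod int a)"
      have "x' mod int a \<ge> 0" using a by simp
      hence k: "?k > 0" "Re v = real ?k" using ne Rev by auto
      have "Complex (real ?k) 0 = v" using Imv by (simp add: k(2)[symmetric] complex_eq_iff)
      hence "?P ?k" using v k(1) by metis
      hence "a \<le> ?k" unfolding a_def by (rule Least_le)
      moreover have "?k < a" using a by (simp add: nat_less_iff)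
      ultimately show False by simp
    qed
    hence "x' = l * int a" using xm by simp
    hence "w = ?M (Complex (of_int l) (of_int n))"
      using x' xy yn by (auto simp: u_def complex_eq_iff algebra_simps)
    moreover have "Complex (of_int l) (of_int n) \<in> lat" by (simp add: lat_def)
    ultimately show "w \<in> ?M ` lat" by (rule image_eqI)
  qed
  thus thesis using a d by (intro that[of "real a" "real d" b]) auto
qed

section \<open>Reducing the semiconjugacy\<close>

lemma torus_descend:
  assumes "\<And>u v. v \<in> lat \<Longrightarrow> k (u + v) = k u"
  shows "\<exists>K. \<forall>u. K (torus_param u) = k u"
proof (intro exI[of _ "\<lambda>x. k (SOME u. torus_param u = x)"] allI)
  fix u
  define u' where "u' = (SOME u'. torus_param u' = torus_param u)"
  have "torus_param u' = torus_param u" unfolding u'_def by (rule someI) simp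
  hence "u' - u \<in> lat" by (simp add: torus_param_eq_iff)
  from assms[OF this, of u] show "k (SOME u'. torus_param u' = torus_param u) = k u" by (simp add: u'_def)
qed

text \<open>The function \<open>\<Theta> u = \<pi> (torus_param (G u))\<close> and its translate by \<open>w = E z - E z'\<close> agree at \<open>E z\<close> and
become equal after composition with \<open>f\<close>. For \<open>semiconjugate_lifts_eq\<close>, the function \<open>f\<close> has to be
injective near \<open>\<Theta> b\<close> except for a sparse set of points \<open>b\<close>; since \<open>f \<circ> \<Theta> = \<pi> \<circ> torus_param\<close>
and \<open>\<Theta>\<close> is open, this holds wherever \<open>\<pi>\<close> is locally injective at \<open>torus_param b\<close>.\<close>

lemma semiconjugate_period:
  assumes F: "\<And>w. torus_param (E w) = F (torus_param w)" and E: "oriented_homeo E" and G: "homeomorphism UNIV UNIV E G"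
    and \<pi>: "branched_covering T2 S2 \<pi>" and semi: "\<And>x. x \<in> points T2 \<Longrightarrow> \<pi> (F x) = f (\<pi> x)"
    and z: "F (torus_param z) = F (torus_param z')" "\<pi> (torus_param z) = \<pi> (torus_param z')"
    and np: "f (\<pi> (torus_param z)) \<notin> postcritical_points f"
  shows "\<pi> (torus_param (G (u + (E z - E z')))) = \<pi> (torus_param (G u))"
proof -
  have EG: "E (G z) = z" and GE: "G (E z) = z" for z using G by (auto simp: homeomorphism_apply1 homeomorphism_apply2)
  have oG: "oriented_homeo G" by (rule oriented_homeo_inverse[OF E G])
  have c\<pi>: "continuous_on (points T2) \<pi>" and s\<pi>: "\<pi> ` points T2 = points S2" using \<pi> unfolding branched_covering_def by auto
  define w where "w = E z - E z'"
  have w: "w \<in> lat" using z(1) F by (simp add: w_def torus_param_eq_iff[symmetric])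
  define \<Theta> where "\<Theta> u = \<pi> (torus_param (G u))" for u
  have f\<Theta>: "f (\<Theta> u) = \<pi> (torus_param u)" for u
    unfolding \<Theta>_def using semi[OF torus_param_in, of "G u"] by (simp add: F[symmetric] EG)
  have c\<Theta>: "continuous_on UNIV (\<lambda>u. \<Theta> (u - c))" for c
    unfolding \<Theta>_def
    by (intro continuous_on_compose2[OF c\<pi>] continuous_on_compose2[OF continuous_torus_param]
         continuous_on_compose2[OF oriented_homeoD(1)[OF oG]] continuous_intros) (auto simp del: split_paired_All)
  have r\<Theta>: "\<Theta> u \<in> points S2" for u unfolding \<Theta>_def s\<pi>[symmetric] by simp
  let ?B = "{z. \<nexists>W. openin (top_of_set (points T2)) W \<and> torus_param z \<in> W \<and> inj_on \<pi> W}"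
  obtain d where d: "d \<ge> 1" "has_power_form S2 S2 f (\<pi> (torus_param z)) d"
    using power_form_of_quotient[OF F E \<pi> semi, of "\<pi> (torus_param z)"] s\<pi> torus_param_in by blast
  obtain W where W: "openin (top_of_set (points S2)) W" "\<pi> (torus_param z) \<in> W" "inj_on f W"
    using locally_injective_off_critical[OF d(2,1) _ np] s\<pi> torus_param_in by blast
  have per: "\<Theta> u = \<Theta> (u - w)" for u
  proof (rule semiconjugate_lifts_eq[where \<Phi>=\<Theta> and \<Psi>="\<lambda>u. \<Theta> (u - w)" and N="points S2" and f=f and B="?B" and W=W and a="E z"])
    show "continuous_on UNIV \<Theta>" using c\<Theta>[of 0] by simp
    show "continuous_on UNIV (\<lambda>u. \<Theta> (u - w))" by (rule c\<Theta>)
    show "range \<Theta> \<subseteq> points S2" "range (\<lambda>u. \<Theta> (u - w)) \<subseteq> points S2" using r\<Theta> by auto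
    show "f (\<Theta> u) = f (\<Theta> (u - w))" for u
      unfolding f\<Theta> using torus_param_add_lat[OF w, of "u - w"] by simp
    show "?B sparse_in UNIV" by (rule branched_covering_critical_sparse[OF \<pi>])
    show "openin (top_of_set (points S2)) W" "inj_on f W" by fact+
    show "\<Theta> (E z) \<in> W" using W(2) by (simp add: \<Theta>_def GE)
    show "\<Theta> (E z) = \<Theta> (E z - w)" using z(2) by (simp add: \<Theta>_def GE w_def)
    fix b assume "b \<notin> ?B"
    then obtain W0 where W0: "openin (top_of_set (points T2)) W0" "torus_param b \<in> W0" "inj_on \<pi> W0" by blast
    obtain r where r: "0 < r" "r \<le> 1/2" "torus_param ` ball b r \<subseteq> W0" using torus_openin_nhd[OF W0(1,2)] .
    have "open (G ` ball b r)" using homeomorphism_imp_open_map[OF homeomorphism_symD[OF G], of "ball b r"] by simp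
    hence O': "openin (top_of_set (points T2)) (torus_param ` G ` ball b r)" by (rule torus_param_open_map)
    obtain d where "d \<ge> 1" "has_power_form T2 S2 \<pi> (torus_param (G b)) d"
      using \<pi> unfolding branched_covering_def by (meson torus_param_in)
    then obtain V where V: "openin (top_of_set (points S2)) V" "\<pi> (torus_param (G b)) \<in> V" "V \<subseteq> \<pi> ` torus_param ` G ` ball b r"
      using power_form_open[OF _ _ O'] r(1) by (metis centre_in_ball image_eqI)
    have "inj_on f V"
    proof (rule inj_onI)
      fix s t assume st: "s \<in> V" "t \<in> V" "f s = f t"
      obtain x where x: "x \<in> ball b r" "s = \<Theta> x" using st(1) V(3) unfolding \<Theta>_def by blast
      obtain y where y: "y \<in> ball b r" "t = \<Theta> y" using st(2) V(3) unfolding \<Theta>_def by blast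
      have "\<pi> (torus_param x) = \<pi> (torus_param y)" using st(3) x y f\<Theta> by metis
      hence "torus_param x = torus_param y" using W0(3) r(3) x(1) y(1) by (meson image_subset_iff inj_onD)
      hence "x = y" using torus_param_inj_ball[OF r(2)] x(1) y(1) by (metis inj_onD)
      thus "s = t" using x y by metis
    qed
    thus "\<exists>W. openin (top_of_set (points S2)) W \<and> \<Theta> b \<in> W \<and> inj_on f W" using V unfolding \<Theta>_def by blast
  qed
  have "\<Theta> (u + w) = \<Theta> u" using per[of "u + w"] by simp
  thus ?thesis by (simp add: \<Theta>_def w_def)
qed

definition torus_quotient ::
  "(real ^ 3 \<Rightarrow> real ^ 3) \<Rightarrow> (complex \<times> complex \<Rightarrow> real ^ 3) \<Rightarrow>
   (complex \<times> complex \<Rightarrow> complex \<times> complex) \<Rightarrow> bool" where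
  "torus_quotient f \<pi> F \<longleftrightarrow> branched_covering T2 S2 \<pi> \<and> torus_endomorphism F \<and>
           topological_degree T2 T2 F \<ge> 2 \<and> (\<forall>x\<in>points T2. \<pi> (F x) = f (\<pi> x))"

text \<open>Let \<open>H\<close> be the group of lattice vectors that are periods of \<open>\<Theta>\<close>. The plane modulo \<open>H\<close> is a torus,
identified with the standard one by \<open>M\<close>. On it \<open>\<Theta>\<close> and \<open>E\<close> induce \<open>\<pi>'\<close> and \<open>F'\<close>, and \<open>E\<close> induces a map
\<open>q\<close> from the old torus with \<open>\<pi> = \<pi>' \<circ> q\<close>. Because \<open>w\<close> is in \<open>H\<close> but not in the image of the linear
part \<open>L\<close> of \<open>E\<close>, every fibre of \<open>q\<close> has at least two points, and because \<open>w\<close> is in \<open>H\<close> but not in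
\<open>L ` H\<close>, the degree of \<open>F'\<close> is at least 2.\<close>

lemma torus_quotient_reduce:
  assumes tq: "torus_quotient f \<pi> F" and ninj: "\<not> pi_injective f \<pi> F" and y0: "y0 \<in> points S2"
  obtains \<pi>' F' where "torus_quotient f \<pi>' F'" "card {x \<in> points T2. \<pi>' x = y0} < card {x \<in> points T2. \<pi> x = y0}"
proof -
  have \<pi>: "branched_covering T2 S2 \<pi>" and semi: "\<And>x. x \<in> points T2 \<Longrightarrow> \<pi> (F x) = f (\<pi> x)"
    and teF: "torus_endomorphism F" using tq unfolding torus_quotient_def by auto
  obtain E where E: "oriented_homeo E" and F: "\<And>w. torus_param (E w) = F (torus_param w)"
    using torus_endomorphism_lift[OF teF] by blast
  obtain G where G: "homeomorphism UNIV UNIV E G" using E unfolding oriented_homeo_def by blast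
  have EG: "E (G z) = z" and GE: "G (E z) = z" for z using G by (auto simp: homeomorphism_apply1 homeomorphism_apply2)
  have oG: "oriented_homeo G" by (rule oriented_homeo_inverse[OF E G])
  obtain z z' where z: "F (torus_param z) = F (torus_param z')" "\<pi> (torus_param z) = \<pi> (torus_param z')"
    "f (\<pi> (torus_param z)) \<notin> postcritical_points f" "torus_param z \<noteq> torus_param z'"
  proof -
    obtain y where y: "y \<in> points S2" "f y \<notin> postcritical_points f" "\<not> inj_on F {x \<in> points T2. \<pi> x = y}"
      using ninj unfolding pi_injective_def by blast
    then obtain x x' where "x \<in> points T2" "\<pi> x = y" "x' \<in> points T2" "\<pi> x' = y" "F x = F x'" "x \<noteq> x'"
      unfolding inj_on_def by blast
    moreover obtain z z' where "x = torus_param z" "x' = torus_param z'" using torus_param_surj calculation by metis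
    ultimately show thesis using that y by metis
  qed
  define w where "w = E z - E z'"
  define \<Theta> where "\<Theta> u = \<pi> (torus_param (G u))" for u
  define L where "L v = E v - E 0" for v
  have EL: "E (u + v) = E u + L v" "L v \<in> lat" if "v \<in> lat" for u v
    using lift_add_lat[OF F oriented_homeoD(1)[OF E] that] by (auto simp: L_def)
  have \<Theta>E: "\<Theta> (E u) = \<pi> (torus_param u)" for u by (simp add: \<Theta>_def GE)
  have f\<Theta>: "f (\<Theta> u) = \<pi> (torus_param u)" for u
    unfolding \<Theta>_def using semi[OF torus_param_in, of "G u"] by (simp add: F[symmetric] EG)
  define H where "H = {h \<in> lat. \<forall>u. \<Theta> (u + h) = \<Theta> u}"
  have wlat: "w \<in> lat" using z(1) F by (simp add: w_def torus_param_eq_iff[symmetric])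
  have wH: "w \<in> H" unfolding H_def \<Theta>_def using wlat semiconjugate_period[OF F E G \<pi> semi z(1-3)] by (simp add: w_def)
  have wL: "w \<noteq> L v" if v: "v \<in> lat" for v
  proof
    assume "w = L v"
    hence "E z = E (z' + v)" using EL(1)[OF v, of z'] by (simp add: w_def algebra_simps)
    hence "z = z' + v" using oriented_homeoD(2)[OF E] by (simp add: inj_eq)
    thus False using z(4) torus_param_add_lat[OF v] by simp
  qed
  have HP: "\<Theta> (u + h) = \<Theta> u" if "h \<in> H" for u h using that by (simp add: H_def)
  have Hd: "u - v \<in> H" if "u \<in> H" "v \<in> H" for u v
  proof -
    have "\<Theta> (t + (u - v)) = \<Theta> t" for t
    proof -
      have "\<Theta> (t + (u - v)) = \<Theta> (t + (u - v) + v)" by (rule HP[OF that(2), symmetric])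
      also have "\<dots> = \<Theta> (t + u)" by simp
      also have "\<dots> = \<Theta> t" by (rule HP[OF that(1)])
      finally show ?thesis .
    qed
    thus ?thesis using that lat_diff by (simp add: H_def)
  qed
  have LH: "L v \<in> H" if v: "v \<in> lat" for v
  proof -
    have "\<Theta> (u + L v) = \<Theta> u" for u
    proof -
      have "\<Theta> (u + L v) = \<Theta> (E (G u + v))" using EL(1)[OF v] EG by simp
      also have "\<dots> = \<Theta> (E (G u))" using torus_param_add_lat[OF v] by (simp add: \<Theta>E)
      finally show ?thesis by (simp add: EG)
    qed
    thus ?thesis using EL(2)[OF v] by (simp add: H_def)
  qed
  obtain D where D: "D \<in> \<int>" "D > 0" "Complex D 0 \<in> L ` lat" "Complex 0 D \<in> L ` lat"
  proof (rule sublattice_full_rank[of L])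
    show "L (u + v) = L u + L v" if "u \<in> lat" "v \<in> lat" for u v using EL(1)[OF that(2), of u] by (simp add: L_def)
    show "v = 0" if "L v = 0" for v using that oriented_homeoD(2)[OF E] by (simp add: L_def inj_eq)
  qed (use EL(2) in auto)
  have LH': "L ` lat \<subseteq> H" by (rule image_subsetI) (rule LH)
  have Hlat': "H \<subseteq> lat" by (auto simp: H_def)
  obtain a b d :: real where abd: "a > 0" "d > 0" "(\<lambda>z. Complex (a * Re z + b * Im z) (d * Im z)) ` lat = H"
    using sublattice_basis[OF Hlat' Hd D(1,2) subsetD[OF LH' D(3)] subsetD[OF LH' D(4)]] .
  define M where "M z = Complex (a * Re z + b * Im z) (d * Im z)" for z
  have oM: "oriented_homeo M" unfolding M_def[abs_def] by (rule oriented_homeo_triangular[OF abd(1,2)])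
  obtain M' where hM: "homeomorphism UNIV UNIV M M'" using oM unfolding oriented_homeo_def by blast
  have MM': "M (M' z) = z" and M'M: "M' (M z) = z" for z using hM by (auto simp: homeomorphism_apply1 homeomorphism_apply2)
  have oM': "oriented_homeo M'" by (rule oriented_homeo_inverse[OF oM hM])
  have Madd: "M (u + v) = M u + M v" for u v by (simp add: M_def complex_eq_iff algebra_simps)
  have M0: "M 0 = 0" by (simp add: M_def complex_eq_iff)
  have M'add: "M' (u + v) = M' u + M' v" for u v
    using M'M[of "M' u + M' v"] by (simp add: Madd MM')
  have Mlat: "M ` lat = H" using abd(3) by (simp add: M_def[abs_def])
  have MH: "M v \<in> H" if "v \<in> lat" for v using Mlat that by blast
  have M'lat: "M' h \<in> lat" if h: "h \<in> H" for h
  proof -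
    obtain v where "v \<in> lat" "h = M v" using h Mlat by blast
    thus ?thesis using M'M by simp
  qed
  have Hlat: "h \<in> lat" if "h \<in> H" for h using that by (simp add: H_def)
  define E' where "E' = M' \<circ> (E \<circ> M)"
  have oE': "oriented_homeo E'" unfolding E'_def by (intro oriented_homeo_comp oM E oM')
  have E'add: "E' (u + v) = E' u + M' (L (M v))" if v: "v \<in> lat" for u v
    using EL(1)[OF Hlat[OF MH[OF v]]] by (simp add: E'_def Madd M'add)
  have "\<exists>K. \<forall>u. K (torus_param u) = torus_param (E' u)"
  proof (rule torus_descend)
    fix u v assume v: "v \<in> lat"
    have "M' (L (M v)) \<in> lat" by (intro M'lat LH Hlat MH v)
    thus "torus_param (E' (u + v)) = torus_param (E' u)" by (simp add: E'add[OF v] torus_param_add_lat)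
  qed
  then obtain F' where F': "\<And>u. F' (torus_param u) = torus_param (E' u)" by blast
  have "\<exists>K. \<forall>u. K (torus_param u) = \<Theta> (M u)"
  proof (rule torus_descend)
    fix u v assume v: "v \<in> lat"
    show "\<Theta> (M (u + v)) = \<Theta> (M u)" by (simp add: Madd HP[OF MH[OF v]])
  qed
  then obtain \<pi>' where \<pi>': "\<And>u. \<pi>' (torus_param u) = \<Theta> (M u)" by blast
  have "\<exists>K. \<forall>u. K (torus_param u) = torus_param (M' (E u))"
  proof (rule torus_descend)
    fix u v assume v: "v \<in> lat"
    show "torus_param (M' (E (u + v))) = torus_param (M' (E u))"
      by (simp add: EL(1)[OF v] M'add torus_param_add_lat M'lat[OF LH[OF v]])
  qed
  then obtain q where q: "\<And>u. q (torus_param u) = torus_param (M' (E u))" by blast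
  have "torus_quotient f \<pi>' F'" unfolding torus_quotient_def
  proof (intro conjI ballI)
    show "branched_covering T2 S2 \<pi>'"
      by (rule branched_covering_precompose[OF \<pi> oriented_homeo_comp[OF oM oG]]) (simp add: \<pi>' \<Theta>_def)
    show "torus_endomorphism F'" by (rule torus_endomorphism_of_lift[OF _ oE']) (simp add: F')
    show "topological_degree T2 T2 F' \<ge> 2"
    proof (rule topological_degree_ge_2[OF _ oE'])
      show "M' w \<in> lat" by (rule M'lat[OF wH])
      fix v assume v: "v \<in> lat"
      show "E' v \<noteq> E' 0 + M' w"
      proof
        assume "E' v = E' 0 + M' w"
        hence "M' (L (M v)) = M' w" using E'add[OF v, of 0] by simp
        hence "L (M v) = w" by (metis MM')
        thus False using wL Hlat[OF MH[OF v]] by metis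
      qed
    qed (simp add: F')
    fix x assume "x \<in> points T2"
    then obtain u where u: "x = torus_param u" using torus_param_surj by blast
    show "\<pi>' (F' x) = f (\<pi>' x)" by (simp add: u F' \<pi>' E'_def MM' \<Theta>E f\<Theta>)
  qed
  moreover have "card {x \<in> points T2. \<pi>' x = y0} < card {x \<in> points T2. \<pi> x = y0}"
  proof -
    let ?A = "{x \<in> points T2. \<pi> x = y0}" and ?A' = "{x \<in> points T2. \<pi>' x = y0}"
    have fin: "finite ?A" by (rule branched_covering_finite_fibre[OF \<pi>])
    have \<pi>'q: "\<pi>' (q (torus_param u)) = \<pi> (torus_param u)" for u by (simp add: q \<pi>' MM' \<Theta>E)
    have "?A' \<subseteq> q ` ?A"
    proof
      fix x assume x: "x \<in> ?A'"
      then obtain u where u: "x = torus_param u" using torus_param_surj by blast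
      have "q (torus_param (G (M u))) = x" by (simp add: q EG M'M u)
      moreover from this have "torus_param (G (M u)) \<in> ?A" using x \<pi>'q by force
      ultimately show "x \<in> q ` ?A" by blast
    qed
    hence "card ?A' \<le> card (q ` ?A)" using fin by (intro card_mono) auto
    also have "\<dots> < card ?A"
    proof -
      obtain x where x: "x \<in> ?A" using \<pi> y0 unfolding branched_covering_def by (metis (mono_tags, lifting) imageE mem_Collect_eq)
      then obtain u where u: "x = torus_param u" using torus_param_surj by blast
      let ?x' = "torus_param (G (E u + w))"
      have "q ?x' = q x" using torus_param_add_lat[OF M'lat[OF wH]] by (simp add: q EG M'add u)
      moreover have "\<pi> ?x' = \<pi> x" using HP[OF wH, of "E u"] by (simp add: \<Theta>_def GE u)
      hence "?x' \<in> ?A" using x by simp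
      moreover have "?x' \<noteq> x"
      proof
        assume "?x' = x"
        hence v: "G (E u + w) - u \<in> lat" (is "?v \<in> lat") by (simp add: u torus_param_eq_iff)
        have "E u + w = E u + L ?v" using EL(1)[OF v, of u] by (simp add: EG)
        thus False using wL[OF v] by simp
      qed
      ultimately have "\<not> inj_on q ?A" using x inj_onD[of q ?A ?x' x] by blast
      hence "card (q ` ?A) \<noteq> card ?A" using eq_card_imp_inj_on[OF fin] by blast
      thus ?thesis using card_image_le[OF fin, of q] by linarith
    qed
    finally show ?thesis .
  qed
  ultimately show thesis by (rule that)
qed

theorem theorem12:
  fixes f :: "real ^ 3 \<Rightarrow> real ^ 3"
  assumes "quotient_of_torus_endomorphism f"
  shows "\<exists>\<pi> F. branched_covering T2 S2 \<pi> \<and> torus_endomorphism F \<and>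
           topological_degree T2 T2 F \<ge> 2 \<and>
           (\<forall>x\<in>points T2. \<pi> (F x) = f (\<pi> x)) \<and>
           pi_injective f \<pi> F"
proof -
  define y0 where "y0 = sphere_param_south 0"
  have y0: "y0 \<in> points S2" unfolding y0_def by (rule S2_params(3)) (simp add: S2_def)
  have "\<exists>\<pi>' F'. torus_quotient f \<pi>' F' \<and> pi_injective f \<pi>' F'" if "torus_quotient f \<pi> F" for \<pi> F
    using that
  proof (induction "card {x \<in> points T2. \<pi> x = y0}" arbitrary: \<pi> F rule: less_induct)
    case less
    show ?case
    proof (cases "pi_injective f \<pi> F")
      case False
      obtain \<pi>' F' where "torus_quotient f \<pi>' F'"
        "card {x \<in> points T2. \<pi>' x = y0} < card {x \<in> points T2. \<pi> x = y0}"
        by (rule torus_quotient_reduce[OF less.prems False y0])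
      from less.hyps[OF this(2,1)] show ?thesis .
    qed (use less.prems in blast)
  qed
  moreover obtain \<pi> F where "torus_quotient f \<pi> F"
    using assms unfolding quotient_of_torus_endomorphism_def torus_quotient_def by blast
  ultimately show ?thesis unfolding torus_quotient_def by blast
qed

end
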